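(* Let $q\in L^1[0,1]$ be real-valued, $m_1,m_2>0$, $0=x_0<x_1<x_2<x_3=1$, and suppose that the problem $-y''+qy=\lambda y$, $y(0)=0=y(1)$, is left-definite. Put $L_j=L(x_j)$, $R_j=R(x_j)$ for $j=1,2$, $$X_1=L_1R_1,\quad X_2=L_2R_2,\quad X_3=L_1R_2[L_2R_1-L_1R_2],\quad W(t)=\frac{R_1L(t)}{L_1R(t)},\quad W'(t)=\frac{R_1}{L_1R(t)^2},$$ $$c(t)=m_1m_2\left[-(1-W)^2X_1X_2-X_3W(1-W)\right]-\left(m_1X_1+W^2m_2\frac{X_1X_2-X_3}{X_1}\right)+W(m_1X_1+m_2X_2),$$ with $W=W(t)$, and let $r>0$ satisfy $$r\notin\left\{\frac{W'(t)\,(m_1X_1+m_2X_2+m_1m_2X_3)}{|c(t)|}\ :\ c(t)\neq0,\ t\in(x_1,x_2]\right\}.$$ Let $\lambda(t)$ be the first eigenvalue function of $(P_2)$. Then (for given $m_1,m_2,x_1,x_2,r$) $q$ is uniquely determined by $\lambda(t)$. Moreover, $q$ can be recovered explicitly by $$q(t)=\left\{\sqrt{1/|Y'(t)|}\right\}''\Big/\sqrt{1/|Y'(t)|},\qquad t\in(0,1),$$ where $$Y(t)=\begin{cases}V(t)=\dfrac{R_1}{L_1}\displaystyle\int_0^t\frac{ds}{R^2(s)},& t\in(0,x_2],\\[2mm] U(t)=\dfrac{L_2}{R_2}\displaystyle\int_t^1\frac{ds}{L^2(s)},& t\in[x_2,1),\end{cases}$$ and $Y$ (meaning $V$ on the first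 two subintervals and $U$ on the third) satisfies the following Cauchy problems on the three subintervals: $$Y'(t)=r\,[c_jY+b_j]\,[l_jY+g_j],\quad t\in I_j=[x_{j-1},x_j],\qquad Y(t_j)=1,\qquad 1\le j\le3,$$ with $t_1=t_2=x_1$, $t_3=x_2$ (the endpoints $0$ and $1$ being excluded). The coefficients $c_j,b_j,l_j,g_j$ are functions of $t$ completely determined by the spectral data $\lambda(t)$, namely $$c_1=1,\quad b_1=0,\quad l_1=\frac{\mu_1L_1}{\gamma_1R_1},\quad g_1=1;$$ $$c_2=\frac{\alpha_2}{\alpha_3},\quad b_2=\frac{\beta_2R_1}{\alpha_3L_1},\quad l_2=\frac{\mu_2L_1}{R_1},\quad g_2=\gamma_2;$$ $$c_3=-1,\quad b_3=0,\quad l_3=\frac{R_2\beta_3}{\alpha_3L_2},\quad g_3=1,$$ where $\alpha_j,\beta_j,\mu_j,\gamma_j$ are evaluated at $\lambda=\lambda(t)$.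
   Context: Left-definiteness of $-y''+qy=\lambda y$, $y(0)=0=y(1)$, means that all its (Dirichlet) eigenvalues are positive. $L$ and $R$ are solutions of $-y''+qy=0$ on $[0,1]$ with $L(0)=0$, $L'(0)>0$, $R(1)=0$, $R'(1)<0$, normalized so that $W[L,R]=LR'-L'R\equiv-1$. Under left-definiteness, $L>0$ and $R>0$ on $(0,1)$. Identities for $q$ are understood almost everywhere, $q$ being an element of $L^1[0,1]$. The unperturbed problem is $$(P_2):\quad -y''+q(x)y=\lambda\,[m_1\delta(x-x_1)+m_2\delta(x-x_2)]\,y,\ x\in[0,1],\qquad y(0)=0=y(1),$$ and for fixed $r>0$ and $t\in[0,1]$ the perturbed problem is $$(P_2^t):\quad -y''+[q(x)-r\delta(x-t)]y=\lambda\,[m_1\delta(x-x_1)+m_2\delta(x-x_2)]\,y,\ x\in[0,1],\qquad y(0)=0=y(1).$$ Solutions are functions $y$ absolutely continuous on $[0,1]$, with $y'$ absolutely continuous on each open subinterval between consecutive points of $\{0,x_1,x_2,t,1\}$ and with one-sided derivatives at these points, such that $-y''+qy=0$ a.e. away from $x_1,x_2,t$, $y(0)=0=y(1)$, and at each interior point $s$ one has $y'(s^-)-y'(s^+)=\kappa(s)y(s)$, where $\kappa(s)$ is the sum of $\lambda m_j$ (if $s=x_j$) and $r$ (if $s=t$). For $(P_2)$ the $r$-term is absent. For $t=0$ and $t=1$ the perturbation has no effect, so $\lambda(0)=\lambda(1)=\lambda_1$, the first eigenvalue of $(P_2)$. An eigenvalue is a number $\lambda$ for which a nontrivial solution exists;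 the first eigenvalue is the smallest one. The first eigenvalue function $\lambda(t)$ of $(P_2)$ is the function assigning to $t$ the first eigenvalue of $(P_2^t)$; under the stated hypotheses it exists. Let $\varphi(x,\lambda)$ and $\psi(x,\lambda)$ be the solutions of the unperturbed equation $-y''+qy=\lambda[m_1\delta(x-x_1)+m_2\delta(x-x_2)]y$ (in the sense that $y$ is absolutely continuous on $[0,1]$, $y'$ is absolutely continuous on each of $(0,x_1)$, $(x_1,x_2)$, $(x_2,1)$ with one-sided derivatives at the endpoints of these intervals, $-y''+qy=0$ a.e. away from $x_1,x_2$, and $y'(x_j^-)-y'(x_j^+)=\lambda m_jy(x_j)$ for $j=1,2$) with $\varphi(0)=0$, $\varphi'(0)=L'(0)$, $\psi(1)=0$, $\psi'(1)=R'(1)$. The coefficients $\alpha_j,\beta_j,\mu_j,\gamma_j$ (functions of $\lambda$) are defined by $$\varphi(x,\lambda)=\alpha_jL(x)+\beta_jR(x),\qquad \psi(x,\lambda)=\mu_jL(x)+\gamma_jR(x),\qquad x\in[x_{j-1},x_j],\ 1\le j\le3,$$ so that $\alpha_1=1$, $\beta_1=0$, $\mu_3=0$, $\gamma_3=1$. "Uniquely determined" means: two potentials satisfying the hypotheses (with the same $m_1,m_2,x_1,x_2,r$) and having the same first eigenvalue function coincide a.e. on $[0,1]$.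
   Formalization: On the middle interval the differential equation is asserted only at t where α_3(λ(t)) ≠ 0, since c_2 and b_2 are undefined otherwise (e.g. q=0, m_1=m_2=1, x_1=1/3, x_2=2/3, r=20, t=1/2); it is also proved that at most one such t exists. *)

theory Defs
  imports "HOL-Analysis.Analysis"
begin

definition abs_continuous_on :: "real set \<Rightarrow> (real \<Rightarrow> real) \<Rightarrow> bool" where
  "abs_continuous_on S f \<longleftrightarrow>
    (\<forall>\<epsilon>>0. \<exists>\<delta>>0. \<forall>D :: (real \<times> real) set.
       finite D \<and> (\<forall>(a, b)\<in>D. a < b \<and> {a..b} \<subseteq> S) \<and>
       pairwise (\<lambda>(a, b) (c, d). {a<..<b} \<inter> {c<..<d} = {}) D \<and>
       (\<Sum>(a, b)\<in>D. b - a) < \<delta>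
       \<longrightarrow> (\<Sum>(a, b)\<in>D. \<bar>f b - f a\<bar>) < \<epsilon>)"

text \<open>
  Solutions on \<open>[0,1]\<close> of \<open>-y'' + q y = (\<Sum>s\<in>P. \<kappa> s * \<delta>(x - s)) y\<close>, where \<open>P\<close> is a
  finite subset of the open interval \<open>(0,1)\<close>.  The values of \<open>y\<close> outside \<open>[0,1]\<close> are irrelevant.
\<close>

definition consecutive :: "real set \<Rightarrow> real \<Rightarrow> real \<Rightarrow> bool" where
  "consecutive P a b \<longleftrightarrow> a \<in> P \<and> b \<in> P \<and> a < b \<and> {a<..<b} \<inter> P = {}"

definition delta_solution ::
    "(real \<Rightarrow> real) \<Rightarrow> real set \<Rightarrow> (real \<Rightarrow> real) \<Rightarrow> (real \<Rightarrow> real) \<Rightarrow> bool" where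
  "delta_solution q P \<kappa> y \<longleftrightarrow>
     abs_continuous_on {0..1} y \<and>
     (\<forall>a b. consecutive (P \<union> {0, 1}) a b \<longrightarrow>
        y differentiable (at_right a) \<and> y differentiable (at_left b) \<and>
        (\<forall>x\<in>{a<..<b}. y differentiable (at x)) \<and>
        abs_continuous_on {a<..<b} (deriv y) \<and>
        (AE x in lebesgue. x \<in> {a<..<b} \<longrightarrow>
           (\<exists>d. (deriv y has_real_derivative d) (at x) \<and> - d + q x * y x = 0))) \<and>
     (\<forall>s\<in>P. \<exists>dl dr. (y has_real_derivative dl) (at_left s) \<and>
        (y has_real_derivative dr) (at_right s) \<and> dl - dr = \<kappa> s * y s)"

abbreviation regular_solution :: "(real \<Rightarrow> real) \<Rightarrow> (real \<Rightarrow> real) \<Rightarrow> bool" where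
  "regular_solution q y \<equiv> delta_solution q {} (\<lambda>_. 0) y"

definition dirichlet_nontrivial :: "(real \<Rightarrow> real) \<Rightarrow> bool" where
  "dirichlet_nontrivial y \<longleftrightarrow> y 0 = 0 \<and> y 1 = 0 \<and> (\<exists>x\<in>{0..1}. y x \<noteq> 0)"

definition left_definite :: "(real \<Rightarrow> real) \<Rightarrow> bool" where
  "left_definite q \<longleftrightarrow>
     (\<forall>l. (\<exists>y. regular_solution (\<lambda>x. q x - l) y \<and> dirichlet_nontrivial y) \<longrightarrow> l > 0)"

text \<open>The conditions do not determine \<open>(L, R)\<close>: for \<open>k > 0\<close> the pair
  \<open>(k L, R / k)\<close> satisfies them too.  All quantities below are invariant under this rescaling,
  except the connection coefficients \<open>\<beta>\<close> and \<open>\<mu>\<close>, which enter only in invariant combinations.\<close>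

definition normalized_pair ::
    "(real \<Rightarrow> real) \<Rightarrow> (real \<Rightarrow> real) \<Rightarrow> (real \<Rightarrow> real) \<Rightarrow> bool" where
  "normalized_pair q L R \<longleftrightarrow>
     regular_solution q L \<and> regular_solution q R \<and> L 0 = 0 \<and> R 1 = 0 \<and>
     (\<exists>L' R'. (\<forall>x\<in>{0..1}. (L has_real_derivative L' x) (at x within {0..1}) \<and>
                          (R has_real_derivative R' x) (at x within {0..1}) \<and>
                          L x * R' x - L' x * R x = -1) \<and>
              L' 0 > 0 \<and> R' 1 < 0)"

text \<open>The problem with potential \<open>q - r \<delta>(x - t)\<close>.  If \<open>t\<close> is \<open>0\<close> or \<open>1\<close> then
  it is not an interior point and the \<open>r\<close>-term plays no role.\<close>

definition perturbed_eigenvalue ::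
    "real \<Rightarrow> real \<Rightarrow> real \<Rightarrow> real \<Rightarrow> real \<Rightarrow> (real \<Rightarrow> real) \<Rightarrow> real \<Rightarrow> real \<Rightarrow> bool" where
  "perturbed_eigenvalue m1 m2 x1 x2 r q t l \<longleftrightarrow>
     (\<exists>y. delta_solution q ({x1, x2, t} \<inter> {0<..<1})
            (\<lambda>s. l * ((if s = x1 then m1 else 0) + (if s = x2 then m2 else 0)) +
                 (if s = t then r else 0)) y \<and>
          dirichlet_nontrivial y)"

definition first_eigenvalue ::
    "real \<Rightarrow> real \<Rightarrow> real \<Rightarrow> real \<Rightarrow> real \<Rightarrow> (real \<Rightarrow> real) \<Rightarrow> real \<Rightarrow> real" where
  "first_eigenvalue m1 m2 x1 x2 r q t = (LEAST l. perturbed_eigenvalue m1 m2 x1 x2 r q t l)"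

definition X1 :: "real \<Rightarrow> (real \<Rightarrow> real) \<Rightarrow> (real \<Rightarrow> real) \<Rightarrow> real" where
  "X1 x1 L R = L x1 * R x1"

definition X2 :: "real \<Rightarrow> (real \<Rightarrow> real) \<Rightarrow> (real \<Rightarrow> real) \<Rightarrow> real" where
  "X2 x2 L R = L x2 * R x2"

definition X3 :: "real \<Rightarrow> real \<Rightarrow> (real \<Rightarrow> real) \<Rightarrow> (real \<Rightarrow> real) \<Rightarrow> real" where
  "X3 x1 x2 L R = L x1 * R x2 * (L x2 * R x1 - L x1 * R x2)"

definition W :: "real \<Rightarrow> (real \<Rightarrow> real) \<Rightarrow> (real \<Rightarrow> real) \<Rightarrow> real \<Rightarrow> real" where
  "W x1 L R t = R x1 * L t / (L x1 * R t)"

definition W' :: "real \<Rightarrow> (real \<Rightarrow> real) \<Rightarrow> (real \<Rightarrow> real) \<Rightarrow> real \<Rightarrow> real" where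
  "W' x1 L R t = R x1 / (L x1 * (R t)\<^sup>2)"

definition c_fun ::
    "real \<Rightarrow> real \<Rightarrow> real \<Rightarrow> real \<Rightarrow> (real \<Rightarrow> real) \<Rightarrow> (real \<Rightarrow> real) \<Rightarrow> real \<Rightarrow> real" where
  "c_fun m1 m2 x1 x2 L R t =
    (let X1 = X1 x1 L R; X2 = X2 x2 L R; X3 = X3 x1 x2 L R; W = W x1 L R t in
       m1 * m2 * (- (1 - W)\<^sup>2 * X1 * X2 - X3 * W * (1 - W))
       - (m1 * X1 + W\<^sup>2 * m2 * ((X1 * X2 - X3) / X1))
       + W * (m1 * X1 + m2 * X2))"

definition excluded_strengths ::
    "real \<Rightarrow> real \<Rightarrow> real \<Rightarrow> real \<Rightarrow> (real \<Rightarrow> real) \<Rightarrow> (real \<Rightarrow> real) \<Rightarrow> real set" where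
  "excluded_strengths m1 m2 x1 x2 L R =
     {W' x1 L R t * (m1 * X1 x1 L R + m2 * X2 x2 L R + m1 * m2 * X3 x1 x2 L R)
        / \<bar>c_fun m1 m2 x1 x2 L R t\<bar> | t. t \<in> {x1<..x2} \<and> c_fun m1 m2 x1 x2 L R t \<noteq> 0}"

definition admissible ::
    "real \<Rightarrow> real \<Rightarrow> real \<Rightarrow> real \<Rightarrow> real \<Rightarrow>
     (real \<Rightarrow> real) \<Rightarrow> (real \<Rightarrow> real) \<Rightarrow> (real \<Rightarrow> real) \<Rightarrow> bool" where
  "admissible m1 m2 x1 x2 r q L R \<longleftrightarrow>
     q absolutely_integrable_on {0..1} \<and> left_definite q \<and> normalized_pair q L R \<and>
     r \<notin> excluded_strengths m1 m2 x1 x2 L R"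

definition node :: "real \<Rightarrow> real \<Rightarrow> nat \<Rightarrow> real" where
  "node x1 x2 j = (if j = 0 then 0 else if j = 1 then x1 else if j = 2 then x2 else 1)"

definition connection_coeffs ::
    "real \<Rightarrow> real \<Rightarrow> real \<Rightarrow> real \<Rightarrow> (real \<Rightarrow> real) \<Rightarrow> (real \<Rightarrow> real) \<Rightarrow> (real \<Rightarrow> real) \<Rightarrow>
     (nat \<Rightarrow> real \<Rightarrow> real) \<Rightarrow> (nat \<Rightarrow> real \<Rightarrow> real) \<Rightarrow>
     (nat \<Rightarrow> real \<Rightarrow> real) \<Rightarrow> (nat \<Rightarrow> real \<Rightarrow> real) \<Rightarrow> bool" where
  "connection_coeffs m1 m2 x1 x2 q L R \<alpha> \<beta> \<mu> \<gamma> \<longleftrightarrow>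
     (\<forall>l. \<exists>\<phi> \<psi>.
        delta_solution q {x1, x2} (\<lambda>s. l * (if s = x1 then m1 else m2)) \<phi> \<and>
        delta_solution q {x1, x2} (\<lambda>s. l * (if s = x1 then m1 else m2)) \<psi> \<and>
        \<phi> 0 = 0 \<and>
        (\<exists>d. (\<phi> has_real_derivative d) (at_right 0) \<and> (L has_real_derivative d) (at_right 0)) \<and>
        \<psi> 1 = 0 \<and>
        (\<exists>d. (\<psi> has_real_derivative d) (at_left 1) \<and> (R has_real_derivative d) (at_left 1)) \<and>
        (\<forall>j\<in>{1, 2, 3}. \<forall>x\<in>{node x1 x2 (j - 1)..node x1 x2 j}.
           \<phi> x = \<alpha> j l * L x + \<beta> j l * R x \<and> \<psi> x = \<mu> j l * L x + \<gamma> j l * R x))"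

text \<open>The quadruple \<open>(c\<^sub>j, b\<^sub>j, l\<^sub>j, g\<^sub>j)\<close> as a function of the eigenvalue parameter \<open>l\<close>.\<close>

definition cauchy_coeffs ::
    "real \<Rightarrow> real \<Rightarrow> (real \<Rightarrow> real) \<Rightarrow> (real \<Rightarrow> real) \<Rightarrow>
     (nat \<Rightarrow> real \<Rightarrow> real) \<Rightarrow> (nat \<Rightarrow> real \<Rightarrow> real) \<Rightarrow>
     (nat \<Rightarrow> real \<Rightarrow> real) \<Rightarrow> (nat \<Rightarrow> real \<Rightarrow> real) \<Rightarrow>
     nat \<Rightarrow> real \<Rightarrow> real \<times> real \<times> real \<times> real" where
  "cauchy_coeffs x1 x2 L R \<alpha> \<beta> \<mu> \<gamma> j l =
     (if j = 1 then (1, 0, \<mu> 1 l * L x1 / (\<gamma> 1 l * R x1), 1)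
      else if j = 2 then (\<alpha> 2 l / \<alpha> 3 l, \<beta> 2 l * R x1 / (\<alpha> 3 l * L x1),
                          \<mu> 2 l * L x1 / R x1, \<gamma> 2 l)
      else (-1, 0, R x2 * \<beta> 3 l / (\<alpha> 3 l * L x2), 1))"

definition V_fun :: "real \<Rightarrow> (real \<Rightarrow> real) \<Rightarrow> (real \<Rightarrow> real) \<Rightarrow> real \<Rightarrow> real" where
  "V_fun x1 L R t = R x1 / L x1 * integral {0..t} (\<lambda>s. 1 / (R s)\<^sup>2)"

definition U_fun :: "real \<Rightarrow> (real \<Rightarrow> real) \<Rightarrow> (real \<Rightarrow> real) \<Rightarrow> real \<Rightarrow> real" where
  "U_fun x2 L R t = L x2 / R x2 * integral {t..1} (\<lambda>s. 1 / (L s)\<^sup>2)"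

text \<open>The two branches of \<open>Y\<close> have different values at \<open>x2\<close>.  \<open>Y_piece\<close> is the branch
  used on the \<open>j\<close>-th subinterval; \<open>Y_fun\<close> takes the left branch at \<open>x2\<close>.\<close>

definition Y_piece ::
    "real \<Rightarrow> real \<Rightarrow> (real \<Rightarrow> real) \<Rightarrow> (real \<Rightarrow> real) \<Rightarrow> nat \<Rightarrow> real \<Rightarrow> real" where
  "Y_piece x1 x2 L R j = (if j = 3 then U_fun x2 L R else V_fun x1 L R)"

definition Y_fun :: "real \<Rightarrow> real \<Rightarrow> (real \<Rightarrow> real) \<Rightarrow> (real \<Rightarrow> real) \<Rightarrow> real \<Rightarrow> real" where
  "Y_fun x1 x2 L R t = (if t \<le> x2 then V_fun x1 L R t else U_fun x2 L R t)"

definition recovers :: "(real \<Rightarrow> real) \<Rightarrow> real set \<Rightarrow> (real \<Rightarrow> real) \<Rightarrow> bool" where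
  "recovers Y S q \<longleftrightarrow>
     (let f = (\<lambda>t. sqrt (1 / \<bar>deriv Y t\<bar>)) in
        (\<forall>t\<in>S. Y differentiable (at t) \<and> deriv Y t \<noteq> 0 \<and> f differentiable (at t)) \<and>
        (AE t in lebesgue. t \<in> S \<longrightarrow>
           (\<exists>d. (deriv f has_real_derivative d) (at t) \<and> q t = d / f t)))"

end

theory Submission
  imports Defs
begin

text \<open>
  The idea. Let \<open>L\<close>, \<open>R\<close> be the normalized pair, \<open>L\<^sub>j = L(x\<^sub>j)\<close>, \<open>R\<^sub>j = R(x\<^sub>j)\<close>, and
  \<open>G(s, x) = L(min s x) R(max s x)\<close> Green's function of \<open>-y'' + q y\<close> with Dirichlet
  conditions. A solution of the problem with point masses is a combination of the functions
  \<open>G(s, \<cdot>)\<close> with \<open>s = x\<^sub>1, x\<^sub>2, t\<close> (\<open>Green_representation\<close>, \<open>Green_solution\<close>). So \<open>l\<close> is an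
  eigenvalue of the perturbed problem exactly if a determinant of size three vanishes, which
  is the equation \<open>E(l) = r \<phi>(t, l) \<psi>(t, l)\<close> with \<open>E(l) = 1 - l (Z\<^sub>1 + Z\<^sub>2) + l\<^sup>2 Z\<^sub>3\<close>,
  \<open>Z\<^sub>1 = m\<^sub>1 X\<^sub>1\<close>, \<open>Z\<^sub>2 = m\<^sub>2 X\<^sub>2\<close>, \<open>Z\<^sub>3 = m\<^sub>1 m\<^sub>2 X\<^sub>3\<close> (\<open>perturbed_eigenvalue_iff\<close>). It is
  at most quadratic in \<open>l\<close>, and a comparison of signs at the two roots of \<open>E\<close> shows that it
  has a smallest real root (\<open>first_eigenvalue_exists\<close>).

  All this needs that \<open>L\<close> and \<open>R\<close> are positive inside the interval (\<open>left_definite_imp_L_pos\<close>,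
  \<open>left_definite_imp_R_pos\<close>). If \<open>L\<close> had a zero in \<open>(0, 1]\<close>, one could deform the parameter
  of \<open>-y'' + q y = l y\<close> from \<open>l = 0\<close>, where the solution starting at \<open>0\<close> is \<open>L\<close>, down to a
  very negative \<open>l\<close>, for which the solution is positive. At some \<open>l \<le> 0\<close> in between the
  solution is positive inside and vanishes at \<open>1\<close>, which is a Dirichlet eigenvalue excluded
  by left-definiteness. The deformation is made by variation of parameters relative to \<open>L\<close>
  and \<open>R\<close>, which leads to a linear system with continuous coefficients.

  Division of the eigenvalue equation by a multiple of \<open>R\<^sup>2\<close> or \<open>L\<^sup>2\<close> gives the Cauchy
  problems for \<open>Y\<close> (\<open>left_ode\<close>, \<open>middle_ode\<close>, \<open>right_ode\<close>). Their coefficients depend on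
  \<open>\<lambda>(t)\<close> and on \<open>Z\<^sub>1\<close>, \<open>Z\<^sub>2\<close>, \<open>Z\<^sub>3\<close> only (\<open>cauchy_coeffs_eq\<close>). And these three numbers can
  be read off from \<open>\<lambda>(0)\<close>, \<open>\<lambda>(x\<^sub>1)\<close>, \<open>\<lambda>(x\<^sub>2)\<close>: at \<open>x\<^sub>1\<close> and \<open>x\<^sub>2\<close> the perturbation merely
  enlarges a mass, so the three eigenvalue equations say that three explicitly known
  distinct points lie on the hyperbola \<open>1 - a Z\<^sub>1 - b Z\<^sub>2 + a b Z\<^sub>3 = 0\<close>, and three points
  determine such a hyperbola (\<open>Z_determined\<close>).

  It remains to see that the Cauchy problems have unique solutions, for a function \<open>\<lambda>(t)\<close>
  about which nothing but the eigenvalue equation is known. On the outer intervals the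
  equation for \<open>1 / Y\<close> is linear (\<open>bernoulli_unique\<close>). On the middle interval it is a
  Riccati equation whose coefficients are quotients with denominator \<open>E(\<lambda>(t))\<close>. By
  compactness they are bounded as long as \<open>Y\<close> stays away from the one value at which \<open>\<phi> \<psi>\<close>
  and \<open>E\<close> can vanish together (\<open>common_zero_unique\<close>, \<open>riccati_unique\<close>); \<open>Y\<close> is increasing
  and takes this value at most once, so that it can be continued from \<open>x\<^sub>1\<close> and from \<open>x\<^sub>2\<close>
  up to that point. Finally \<open>Y\<close> determines \<open>q\<close> by the recovery formula: up to constants \<open>Y'\<close>
  is \<open>1 / R\<^sup>2\<close> or \<open>-1 / L\<^sup>2\<close>, and \<open>R'' = q R\<close>, \<open>L'' = q L\<close> (\<open>recovery\<close>,
  \<open>potentials_coincide\<close>).\<close>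

section \<open>Absolutely continuous functions\<close>

definition interval_family :: "real set \<Rightarrow> (real \<times> real) set \<Rightarrow> bool" where
  "interval_family S D \<longleftrightarrow> finite D \<and> (\<forall>(a, b)\<in>D. a < b \<and> {a..b} \<subseteq> S) \<and>
     pairwise (\<lambda>(a, b) (c, d). {a<..<b} \<inter> {c<..<d} = {}) D"

lemma abs_continuous_on_iff:
  "abs_continuous_on S f \<longleftrightarrow> (\<forall>e>0. \<exists>d>0. \<forall>D. interval_family S D \<longrightarrow>
     (\<Sum>(a, b)\<in>D. b - a) < d \<longrightarrow> (\<Sum>(a, b)\<in>D. \<bar>f b - f a\<bar>) < e)"
  by (simp only: abs_continuous_on_def interval_family_def imp_conjL conj_assoc)

lemma abs_continuous_onE:
  assumes "abs_continuous_on S f" "e > 0"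
  obtains d where "d > 0"
    "\<And>D. interval_family S D \<Longrightarrow> (\<Sum>(a, b)\<in>D. b - a) < d \<Longrightarrow> (\<Sum>(a, b)\<in>D. \<bar>f b - f a\<bar>) < e"
  using assms unfolding abs_continuous_on_iff by blast

text \<open>Sums, products with bounded factors, Lipschitz functions and functions that are changed only
  outside \<open>S\<close> are all covered by this criterion, which dominates increments by increments.\<close>

lemma abs_continuous_on_dominated:
  assumes f: "abs_continuous_on S f" and g: "abs_continuous_on S g"
    and h: "\<And>a b. a < b \<Longrightarrow> {a..b} \<subseteq> S \<Longrightarrow> \<bar>h b - h a\<bar> \<le> K * (\<bar>f b - f a\<bar> + \<bar>g b - g a\<bar>)"
  shows "abs_continuous_on S h"
  unfolding abs_continuous_on_iff
proof (intro allI impI)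
  fix e :: real assume e: "e > 0"
  define M where "M = \<bar>K\<bar> + 1"
  have M: "M > 0" "K \<le> M" unfolding M_def by linarith+
  define e' where "e' = e / (2 * M)"
  have e': "e' > 0" using e M by (simp add: e'_def)
  obtain d1 where d1: "d1 > 0" "\<And>D. interval_family S D \<Longrightarrow> (\<Sum>(a, b)\<in>D. b - a) < d1 \<Longrightarrow>
      (\<Sum>(a, b)\<in>D. \<bar>f b - f a\<bar>) < e'"
    using abs_continuous_onE[OF f e'] by blast
  obtain d2 where d2: "d2 > 0" "\<And>D. interval_family S D \<Longrightarrow> (\<Sum>(a, b)\<in>D. b - a) < d2 \<Longrightarrow>
      (\<Sum>(a, b)\<in>D. \<bar>g b - g a\<bar>) < e'"
    using abs_continuous_onE[OF g e'] by blast
  show "\<exists>d>0. \<forall>D. interval_family S D \<longrightarrow> (\<Sum>(a, b)\<in>D. b - a) < d \<longrightarrow> (\<Sum>(a, b)\<in>D. \<bar>h b - h a\<bar>) < e"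
  proof (intro exI[of _ "min d1 d2"] conjI allI impI)
    show "0 < min d1 d2" using d1 d2 by simp
    fix D assume D: "interval_family S D" "(\<Sum>(a, b)\<in>D. b - a) < min d1 d2"
    have 1: "(\<Sum>(a, b)\<in>D. \<bar>f b - f a\<bar>) < e'" and 2: "(\<Sum>(a, b)\<in>D. \<bar>g b - g a\<bar>) < e'"
      using d1(2)[OF D(1)] d2(2)[OF D(1)] D(2) by auto
    have "(\<Sum>(a, b)\<in>D. \<bar>h b - h a\<bar>) \<le> (\<Sum>(a, b)\<in>D. M * (\<bar>f b - f a\<bar> + \<bar>g b - g a\<bar>))"
    proof (rule sum_mono, clarify)
      fix a b assume ab: "(a, b) \<in> D"
      then have "\<bar>h b - h a\<bar> \<le> K * (\<bar>f b - f a\<bar> + \<bar>g b - g a\<bar>)"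
        using D(1) by (intro h) (auto simp: interval_family_def)
      also have "\<dots> \<le> M * (\<bar>f b - f a\<bar> + \<bar>g b - g a\<bar>)"
        using M by (intro mult_right_mono) auto
      finally show "\<bar>h b - h a\<bar> \<le> M * (\<bar>f b - f a\<bar> + \<bar>g b - g a\<bar>)" .
    qed
    also have "\<dots> = M * ((\<Sum>(a, b)\<in>D. \<bar>f b - f a\<bar>) + (\<Sum>(a, b)\<in>D. \<bar>g b - g a\<bar>))"
      by (simp add: sum.distrib sum_distrib_left case_prod_unfold distrib_left)
    also have "\<dots> < M * (e' + e')"
      using 1 2 M by (intro mult_strict_left_mono) auto
    also have "\<dots> = e" using M by (simp add: e'_def field_simps)
    finally show "(\<Sum>(a, b)\<in>D. \<bar>h b - h a\<bar>) < e" .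
  qed
qed

lemma abs_continuous_on_id: "abs_continuous_on S (\<lambda>x. x)"
proof -
  have eq: "(\<Sum>(a, b)\<in>D. \<bar>b - a\<bar>) = (\<Sum>(a, b)\<in>D. b - a)" if "interval_family S D" for D
    using that by (intro sum.cong) (auto simp: interval_family_def)
  show ?thesis unfolding abs_continuous_on_iff using eq by auto
qed

lemma abs_continuous_on_lipschitz:
  assumes "\<And>a b. a \<in> S \<Longrightarrow> b \<in> S \<Longrightarrow> a < b \<Longrightarrow> \<bar>h b - h a\<bar> \<le> K * (b - a)"
  shows "abs_continuous_on S h"
proof (rule abs_continuous_on_dominated[OF abs_continuous_on_id abs_continuous_on_id])
  fix a b :: real assume ab: "a < b" "{a..b} \<subseteq> S"
  then have "\<bar>h b - h a\<bar> \<le> K * (b - a)" by (intro assms) auto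
  then show "\<bar>h b - h a\<bar> \<le> (K / 2) * (\<bar>b - a\<bar> + \<bar>b - a\<bar>)" using ab by (simp add: field_simps)
qed

lemma abs_continuous_on_subset:
  assumes "abs_continuous_on T f" "S \<subseteq> T"
  shows "abs_continuous_on S f"
proof -
  have "interval_family T D" if "interval_family S D" for D
    using that assms(2) unfolding interval_family_def by blast
  then show ?thesis using assms(1) unfolding abs_continuous_on_iff by meson
qed

lemma abs_continuous_on_add:
  assumes "abs_continuous_on S f" "abs_continuous_on S g"
  shows "abs_continuous_on S (\<lambda>x. f x + g x)"
  by (rule abs_continuous_on_dominated[OF assms, of _ 1]) auto

lemma abs_continuous_on_diff:
  assumes "abs_continuous_on S f" "abs_continuous_on S g"
  shows "abs_continuous_on S (\<lambda>x. f x - g x)"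
  by (rule abs_continuous_on_dominated[OF assms, of _ 1]) auto

lemma abs_continuous_on_mult:
  assumes f: "abs_continuous_on S f" and g: "abs_continuous_on S g"
    and bd: "bounded (f ` S)" "bounded (g ` S)"
  shows "abs_continuous_on S (\<lambda>x. f x * g x)"
proof -
  obtain M1 where M1: "\<And>x. x \<in> S \<Longrightarrow> \<bar>f x\<bar> \<le> M1" using bd(1) by (auto simp: bounded_iff)
  obtain M2 where M2: "\<And>x. x \<in> S \<Longrightarrow> \<bar>g x\<bar> \<le> M2" using bd(2) by (auto simp: bounded_iff)
  show ?thesis
  proof (rule abs_continuous_on_dominated[OF f g])
    fix a b :: real assume ab: "a < b" "{a..b} \<subseteq> S"
    then have S: "a \<in> S" "b \<in> S" by auto
    have "\<bar>f b * g b - f a * g a\<bar> = \<bar>(f b - f a) * g b + f a * (g b - g a)\<bar>"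
      by (simp add: algebra_simps)
    also have "\<dots> \<le> \<bar>f b - f a\<bar> * \<bar>g b\<bar> + \<bar>f a\<bar> * \<bar>g b - g a\<bar>"
      by (metis abs_mult abs_triangle_ineq)
    also have "\<dots> \<le> \<bar>f b - f a\<bar> * max M1 M2 + max M1 M2 * \<bar>g b - g a\<bar>"
      using M1[OF S(1)] M2[OF S(2)] by (intro add_mono mult_mono) auto
    finally show "\<bar>f b * g b - f a * g a\<bar> \<le> max M1 M2 * (\<bar>f b - f a\<bar> + \<bar>g b - g a\<bar>)"
      by (simp add: algebra_simps)
  qed
qed

lemma abs_continuous_on_imp_uniformly_continuous:
  assumes f: "abs_continuous_on S f" and S: "is_interval S"
  shows "uniformly_continuous_on S f"
  unfolding uniformly_continuous_on_def
proof (intro allI impI)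
  fix e :: real assume e: "e > 0"
  obtain d where d: "d > 0" and D: "\<And>D. interval_family S D \<Longrightarrow> (\<Sum>(a, b)\<in>D. b - a) < d \<Longrightarrow>
      (\<Sum>(a, b)\<in>D. \<bar>f b - f a\<bar>) < e"
    using abs_continuous_onE[OF f e] by blast
  have key: "\<bar>f b - f a\<bar> < e" if "a \<in> S" "b \<in> S" "a < b" "b - a < d" for a b
  proof -
    have "{a..b} \<subseteq> S" using S that by (meson atLeastAtMost_iff is_interval_1 subsetI)
    then show ?thesis using D[of "{(a, b)}"] that by (auto simp: interval_family_def pairwise_def)
  qed
  have "dist (f x') (f x) < e" if "x \<in> S" "x' \<in> S" "dist x' x < d" for x x'
    using key[of x x'] key[of x' x] that e
    by (cases x x' rule: linorder_cases) (auto simp: dist_real_def abs_minus_commute)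
  then show "\<exists>d>0. \<forall>x\<in>S. \<forall>x'\<in>S. dist x' x < d \<longrightarrow> dist (f x') (f x) < e"
    using d by blast
qed

lemma abs_continuous_on_imp_bounded:
  assumes "abs_continuous_on S f" "is_interval S" "bounded S"
  shows "bounded (f ` S)"
  using assms abs_continuous_on_imp_uniformly_continuous bounded_uniformly_continuous_image by blast

text \<open>A gauge argument. Cover the exceptional null set \<open>N\<close> by an open set whose measure is below
  the threshold that absolute continuity provides for \<open>e\<close>, and take a gauge that keeps the
  intervals tagged in \<open>N\<close> inside this open set and forces difference quotients below \<open>e\<close> at
  all other tags. In a fine tagged division of \<open>{c..d}\<close> the former intervals contribute less
  than \<open>e\<close> to \<open>f d - f c\<close>, and the latter at most \<open>e * (d - c)\<close>.\<close>

lemma abs_continuous_on_deriv_zero: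
  fixes f :: "real \<Rightarrow> real"
  assumes ac: "abs_continuous_on {c..d} f" and cd: "c \<le> d" and N: "negligible N"
    and der: "\<And>x. x \<in> {c..d} - N \<Longrightarrow> (f has_real_derivative 0) (at x within {c..d})"
  shows "f d = f c"
proof -
  have main: "\<bar>f d - f c\<bar> \<le> e * (1 + (d - c))" if e: "e > 0" for e
  proof -
    obtain \<delta> where \<delta>: "\<delta> > 0" and D: "\<And>D. interval_family {c..d} D \<Longrightarrow>
        (\<Sum>(a, b)\<in>D. b - a) < \<delta> \<Longrightarrow> (\<Sum>(a, b)\<in>D. \<bar>f b - f a\<bar>) < e"
      using abs_continuous_onE[OF ac e] by blast
    obtain T where T: "open T" "N \<subseteq> T" "T \<in> lmeasurable" "measure lebesgue T < \<delta>"
    proof -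
      have Ns: "N \<in> sets lebesgue" using N negligible_imp_sets by blast
      obtain T where T: "open T" "N \<subseteq> T" "T - N \<in> lmeasurable" "emeasure lebesgue (T - N) < ennreal \<delta>"
        using sets_lebesgue_outer_open[OF Ns \<delta>] .
      have T1: "T = (T - N) \<union> N" using T(2) by auto
      have Nl: "N \<in> lmeasurable" using N negligible_iff_measure by blast
      have T2: "T \<in> lmeasurable" using T(3) Nl T1 by (metis fmeasurable.Un)
      have "measure lebesgue T = measure lebesgue (T - N)"
        using N negligible_iff_null_sets T2
        by (metis fmeasurableD measure_Diff_null_set)
      also have "\<dots> < \<delta>"
        using T(3,4) \<delta> by (simp add: emeasure_eq_measure2 ennreal_less_iff)
      finally show ?thesis using that T T2 by blast
    qed
    have "\<exists>r>0. \<forall>y\<in>{c..d}. \<bar>y - x\<bar> < r \<longrightarrow> \<bar>f y - f x\<bar> \<le> e * \<bar>y - x\<bar>" if "x \<in> {c..d} - N" for x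
    proof -
      have "(f has_derivative (\<lambda>h. 0)) (at x within {c..d})"
        using der[OF that] by (simp add: has_field_derivative_def lambda_zero)
      then show ?thesis
        using e unfolding has_derivative_within_alt by (auto simp: real_norm_def)
    qed
    then obtain r where r: "\<And>x. x \<in> {c..d} - N \<Longrightarrow> r x > 0"
      "\<And>x y. x \<in> {c..d} - N \<Longrightarrow> y \<in> {c..d} \<Longrightarrow> \<bar>y - x\<bar> < r x \<Longrightarrow> \<bar>f y - f x\<bar> \<le> e * \<bar>y - x\<bar>"
      by metis
    define \<gamma> where "\<gamma> x = (if x \<in> N then T else if x \<in> {c..d} then ball x (r x) else UNIV)" for x
    have "gauge \<gamma>" using T(1,2) r(1) by (auto simp: gauge_def \<gamma>_def)
    then obtain p where p: "p tagged_division_of {c..d}" and fine: "\<gamma> fine p"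
      by (rule fine_division_exists_real)
    note pD = tagged_division_ofD[OF p]
    \<comment> \<open>\<open>Sup {}\<close> and \<open>Inf {}\<close> are unspecified, so the empty interval needs a value of its own.\<close>
    define F where "F k = (if k = {} then 0 else f (Sup k) - f (Inf k))" for k :: "real set"
    define p1 where "p1 = {z\<in>p. fst z \<in> N}"
    have fin: "finite p" "finite p1" using pD(1) by (auto simp: p1_def)
    have box: "\<exists>a b. k = {a..b} \<and> a \<le> b \<and> x \<in> {a..b} \<and> {a..b} \<subseteq> {c..d} \<and> Inf k = a \<and> Sup k = b"
      if xk: "(x, k) \<in> p" for x k
    proof -
      obtain a b where ab: "k = cbox a b" using pD(4)[OF xk] by blast
      have "x \<in> k" "k \<subseteq> {c..d}" using pD(2,3)[OF xk] by auto
      then show ?thesis using ab by (intro exI[of _ a] exI[of _ b]) auto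
    qed
    have "f d - f c = (\<Sum>(x, k)\<in>p. f (Sup k) - f (Inf k))"
      using additive_tagged_division_1[OF cd p, of f] by simp
    also have "\<dots> = (\<Sum>(x, k)\<in>p. F k)"
      using pD(2) by (intro sum.cong) (fastforce simp: F_def)+
    also have "\<dots> = (\<Sum>(x, k)\<in>p - p1. F k) + (\<Sum>(x, k)\<in>p1. F k)"
      using fin by (intro sum.subset_diff) (auto simp: p1_def)
    finally have split: "f d - f c = (\<Sum>(x, k)\<in>p - p1. F k) + (\<Sum>(x, k)\<in>p1. F k)" .
    have good: "\<bar>\<Sum>(x, k)\<in>p - p1. F k\<bar> \<le> e * (d - c)"
    proof -
      have "\<bar>\<Sum>(x, k)\<in>p - p1. F k\<bar> \<le> (\<Sum>(x, k)\<in>p - p1. e * measure lborel k)"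
        unfolding case_prod_unfold
      proof (rule order_trans[OF sum_abs sum_mono])
        fix z assume z: "z \<in> p - p1"
        obtain x k where xk: "z = (x, k)" by fastforce
        obtain a b where ab: "k = {a..b}" "a \<le> b" "x \<in> {a..b}" "{a..b} \<subseteq> {c..d}" "Inf k = a" "Sup k = b"
          using box z xk by blast
        have xN: "x \<in> {c..d} - N" using z xk ab by (auto simp: p1_def)
        have "k \<subseteq> \<gamma> x" using fine z xk unfolding fine_def by blast
        then have "k \<subseteq> ball x (r x)" using xN by (simp add: \<gamma>_def)
        moreover have "a \<in> k" "b \<in> k" using ab by auto
        ultimately have "\<bar>a - x\<bar> < r x" "\<bar>b - x\<bar> < r x"
          by (metis abs_minus_commute dist_real_def mem_ball subsetD)+
        then have "\<bar>f a - f x\<bar> \<le> e * \<bar>a - x\<bar>" "\<bar>f b - f x\<bar> \<le> e * \<bar>b - x\<bar>"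
          using r(2)[OF xN, of a] r(2)[OF xN, of b] ab(2-4) subsetD[OF ab(4), of a] subsetD[OF ab(4), of b]
          by (metis atLeastAtMost_iff order_refl)+
        then have "\<bar>f b - f a\<bar> \<le> e * \<bar>a - x\<bar> + e * \<bar>b - x\<bar>" by linarith
        also have "\<dots> = e * (b - a)" using ab by (simp add: algebra_simps)
        finally show "\<bar>F (snd z)\<bar> \<le> e * measure lborel (snd z)" using xk ab by (simp add: F_def)
      qed
      also have "\<dots> \<le> (\<Sum>(x, k)\<in>p. e * measure lborel k)"
        using fin e by (intro sum_mono2) (auto)
      also have "\<dots> = e * (d - c)"
        using additive_content_tagged_division[of p c d] p cd
        by (simp add: sum_distrib_left[symmetric] case_prod_unfold)
      finally show ?thesis .
    qed
    have bad: "\<bar>\<Sum>(x, k)\<in>p1. F k\<bar> \<le> e"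
    proof -
      have p1p: "p1 tagged_partial_division_of {c..d}"
        using p tagged_partial_division_subset[of p _ p1]
        by (auto simp: tagged_division_of_def p1_def)
      note p1t = tagged_partial_division_of_Union_self[OF p1p]
      define Q where "Q = snd ` p1"
      have Qd: "Q division_of \<Union>Q" unfolding Q_def by (rule division_of_tagged_division[OF p1t])
      have finQ: "finite Q" using fin by (simp add: Q_def)
      define Q1 where "Q1 = {k\<in>Q. Inf k < Sup k}"
      have Qbox: "k = {Inf k..Sup k} \<and> Inf k \<le> Sup k \<and> k \<subseteq> {c..d}" if kQ: "k \<in> Q" for k
      proof -
        obtain x where "(x, k) \<in> p" using kQ by (force simp: Q_def p1_def)
        from box[OF this] show ?thesis by metis
      qed
      have "(\<Sum>(x, k)\<in>p1. \<bar>F k\<bar>) = (\<Sum>k\<in>Q. \<bar>F k\<bar>)"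
        unfolding Q_def
        by (rule sum.over_tagged_division_lemma[OF p1t])
           (auto simp: F_def)
      also have "\<dots> = (\<Sum>k\<in>Q1. \<bar>F k\<bar>)"
        using finQ Qbox by (intro sum.mono_neutral_right) (force simp: Q1_def F_def)+
      also have "\<dots> = (\<Sum>(a, b)\<in>(\<lambda>k. (Inf k, Sup k)) ` Q1. \<bar>f b - f a\<bar>)"
      proof (subst sum.reindex)
        show "inj_on (\<lambda>k. (Inf k, Sup k)) Q1"
          using Qbox unfolding inj_on_def Q1_def by (metis (no_types, lifting) Pair_inject mem_Collect_eq)
        have "k \<noteq> {}" if "k \<in> Q1" for k using Qbox[of k] that unfolding Q1_def by (metis (no_types, lifting) atLeastatMost_empty_iff mem_Collect_eq)
        then show "(\<Sum>k\<in>Q1. \<bar>F k\<bar>) = sum ((\<lambda>(a, b). \<bar>f b - f a\<bar>) \<circ> (\<lambda>k. (Inf k, Sup k))) Q1"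
          by (intro sum.cong) (auto simp: F_def)
      qed
      also have "\<dots> < e"
      proof (rule D, unfold interval_family_def, intro conjI)
        show "finite ((\<lambda>k. (Inf k, Sup k)) ` Q1)" using finQ by (simp add: Q1_def)
        show "\<forall>(a, b)\<in>(\<lambda>k. (Inf k, Sup k)) ` Q1. a < b \<and> {a..b} \<subseteq> {c..d}"
        proof -
          have "Inf k < Sup k \<and> {Inf k..Sup k} \<subseteq> {c..d}" if "k \<in> Q1" for k
            using that Qbox[of k] unfolding Q1_def by auto
          then show ?thesis by auto
        qed
        show "pairwise (\<lambda>(a, b) (c, d). {a<..<b} \<inter> {c<..<d} = {}) ((\<lambda>k. (Inf k, Sup k)) ` Q1)"
        proof -
          have "{Inf k<..<Sup k} \<inter> {Inf k'<..<Sup k'} = {}" if "k \<in> Q1" "k' \<in> Q1" "k \<noteq> k'" for k k'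
          proof -
            have "interior k \<inter> interior k' = {}"
              using division_ofD(5)[OF Qd] that by (auto simp: Q1_def)
            moreover have "interior k = {Inf k<..<Sup k}" "interior k' = {Inf k'<..<Sup k'}"
              using Qbox that interior_atLeastAtMost_real unfolding Q1_def by (metis (no_types, lifting) mem_Collect_eq)+
            ultimately show ?thesis by simp
          qed
          then show ?thesis by (auto simp: pairwise_def)
        qed
        have "(\<Sum>(a, b)\<in>(\<lambda>k. (Inf k, Sup k)) ` Q1. b - a) = (\<Sum>k\<in>Q1. Sup k - Inf k)"
        proof (subst sum.reindex)
          show "inj_on (\<lambda>k. (Inf k, Sup k)) Q1"
            using Qbox unfolding inj_on_def Q1_def by (metis (no_types, lifting) Pair_inject mem_Collect_eq)
        qed simp
        also have "\<dots> = (\<Sum>k\<in>Q1. measure lebesgue k)"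
        proof (rule sum.cong)
          fix k assume "k \<in> Q1"
          then show "Sup k - Inf k = measure lebesgue k"
            using Qbox[of k] by (metis (no_types, lifting) Q1_def content_real mem_Collect_eq measure_completion sets_lborel borel_closed closed_atLeastAtMost)
        qed simp
        also have "\<dots> \<le> (\<Sum>k\<in>Q. measure lebesgue k)"
          using finQ by (intro sum_mono2) (auto simp: Q1_def)
        also have "\<dots> = measure lebesgue (\<Union>Q)" by (rule content_division[OF Qd])
        also have "\<dots> \<le> measure lebesgue T"
        proof (rule measure_mono_fmeasurable)
          have "k \<subseteq> T" if "(x, k) \<in> p1" for x k
          proof -
            have "k \<subseteq> \<gamma> x" using fine that unfolding fine_def p1_def by blast
            then show ?thesis using that by (simp add: \<gamma>_def p1_def)
          qed
          then show "\<Union>Q \<subseteq> T" unfolding Q_def by fastforce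
          show "\<Union>Q \<in> sets lebesgue" using lmeasurable_division[OF Qd] by auto
        qed (rule T(3))
        finally show "(\<Sum>(a, b)\<in>(\<lambda>k. (Inf k, Sup k)) ` Q1. b - a) < \<delta>" using T(4) by linarith
      qed
      finally have "(\<Sum>(x, k)\<in>p1. \<bar>F k\<bar>) < e" .
      moreover have "\<bar>\<Sum>(x, k)\<in>p1. F k\<bar> \<le> (\<Sum>(x, k)\<in>p1. \<bar>F k\<bar>)"
        unfolding case_prod_unfold by (rule sum_abs)
      ultimately show ?thesis by linarith
    qed
    show ?thesis using split good bad by (simp add: algebra_simps)
  qed
  have "\<bar>f d - f c\<bar> \<le> 0"
  proof (rule field_le_epsilon)
    fix e :: real assume "e > 0"
    then show "\<bar>f d - f c\<bar> \<le> 0 + e" using main[of "e / (1 + (d - c))"] cd by simp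
  qed
  then show ?thesis by simp
qed

section \<open>Gronwall uniqueness and linear systems with a parameter\<close>

lemma nondecreasing_within:
  fixes f :: "real \<Rightarrow> real"
  assumes der: "\<And>t. t \<in> {a..b} \<Longrightarrow> (f has_real_derivative f' t) (at t within {a..b})"
    and nn: "\<And>t. t \<in> {a<..<b} \<Longrightarrow> 0 \<le> f' t"
    and st: "a \<le> s" "s \<le> t" "t \<le> b"
  shows "f s \<le> f t"
proof (rule DERIV_nonneg_imp_increasing_open[OF st(2)])
  fix x assume x: "s < x" "x < t"
  have "at x within {a..b} = at x" using x st by (intro at_within_Icc_at) auto
  then show "\<exists>y. (f has_real_derivative y) (at x) \<and> 0 \<le> y"
    using der[of x] nn[of x] x st by auto
next
  have "continuous_on {a..b} f" using der DERIV_continuous_on by blast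
  then show "continuous_on {s..t} f" using continuous_on_subset st by fastforce
qed

text \<open>The square of \<open>d\<close> is monotone up to an exponential factor, nondecreasing after
  multiplication by \<open>exp (2 * K * t)\<close> and nonincreasing after multiplication by
  \<open>exp (- 2 * K * t)\<close>; hence the zero at \<open>c\<close> spreads in both directions.\<close>

lemma gronwall_zero:
  fixes d :: "real \<Rightarrow> real"
  assumes der: "\<And>t. t \<in> {a..b} \<Longrightarrow> (d has_real_derivative d' t) (at t within {a..b})"
    and bd: "\<And>t. t \<in> {a..b} \<Longrightarrow> \<bar>d' t\<bar> \<le> K * \<bar>d t\<bar>"
    and c: "c \<in> {a..b}" "d c = 0" and t: "t \<in> {a..b}"
  shows "d t = 0"
proof -
  have sq: "\<bar>2 * d s * d' s\<bar> \<le> 2 * K * (d s)\<^sup>2" if "s \<in> {a..b}" for s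
    using mult_left_mono[OF bd[OF that], of "2 * \<bar>d s\<bar>"]
    by (simp add: abs_mult power2_eq_square algebra_simps)
  have "(d t)\<^sup>2 * exp (2 * K * t) \<le> 0" if "t \<le> c"
  proof -
    have "(d t)\<^sup>2 * exp (2 * K * t) \<le> (d c)\<^sup>2 * exp (2 * K * c)"
    proof (rule nondecreasing_within[where f = "\<lambda>s. (d s)\<^sup>2 * exp (2 * K * s)" and a = a and b = b
          and f' = "\<lambda>s. (2 * d s * d' s + 2 * K * (d s)\<^sup>2) * exp (2 * K * s)"])
      show "((\<lambda>s. (d s)\<^sup>2 * exp (2 * K * s)) has_real_derivative
              (2 * d s * d' s + 2 * K * (d s)\<^sup>2) * exp (2 * K * s)) (at s within {a..b})"
        if "s \<in> {a..b}" for s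
        by (rule derivative_eq_intros der that refl | simp add: algebra_simps)+
      show "0 \<le> (2 * d s * d' s + 2 * K * (d s)\<^sup>2) * exp (2 * K * s)" if "s \<in> {a<..<b}" for s
        using sq[of s] that by (intro mult_nonneg_nonneg) auto
    qed (use that t c in auto)
    then show ?thesis using c by simp
  qed
  moreover have "(d t)\<^sup>2 * exp (- (2 * K * t)) \<le> 0" if "c \<le> t"
  proof -
    have "- ((d c)\<^sup>2 * exp (- (2 * K * c))) \<le> - ((d t)\<^sup>2 * exp (- (2 * K * t)))"
 proof (rule nondecreasing_within[where f = "\<lambda>s. - ((d s)\<^sup>2 * exp (- (2 * K * s)))" and a = a and b = b
          and f' = "\<lambda>s. (2 * K * (d s)\<^sup>2 - 2 * d s * d' s) * exp (- (2 * K * s))"])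
      show "((\<lambda>s. - ((d s)\<^sup>2 * exp (- (2 * K * s)))) has_real_derivative
              (2 * K * (d s)\<^sup>2 - 2 * d s * d' s) * exp (- (2 * K * s))) (at s within {a..b})"
        if "s \<in> {a..b}" for s
        by (rule derivative_eq_intros der that refl | simp add: algebra_simps)+
      show "0 \<le> (2 * K * (d s)\<^sup>2 - 2 * d s * d' s) * exp (- (2 * K * s))" if "s \<in> {a<..<b}" for s
        using sq[of s] that by (intro mult_nonneg_nonneg) auto
    qed (use that t c in auto)
    then show ?thesis using c by simp
  qed
  ultimately have "(d t)\<^sup>2 \<le> 0"
    by (cases "t \<le> c") (auto simp: mult_le_0_iff not_le)
  then show ?thesis by simp
qed

text \<open>The solution is a power series in the parameter \<open>l\<close>, whose coefficients are the iterated
  integrals of the initial value \<open>(1, 0)\<close>. The \<open>n\<close>-th coefficient is bounded by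
  \<open>C ^ n / fact n\<close>. So the series converges uniformly for bounded \<open>l\<close>, which gives joint
  continuity in \<open>(l, x)\<close>, and it may be differentiated termwise in \<open>x\<close>.\<close>

lemma linear_system_parameter:
  fixes m11 m12 m21 m22 :: "real \<Rightarrow> real"
  assumes cont: "continuous_on {0..1} m11" "continuous_on {0..1} m12"
    "continuous_on {0..1} m21" "continuous_on {0..1} m22"
  obtains A B :: "real \<Rightarrow> real \<Rightarrow> real" where
    "\<And>l. A l 0 = 1" "\<And>l. B l 0 = 0"
    "\<And>l x. x \<in> {0..1} \<Longrightarrow>
       (A l has_real_derivative l * (m11 x * A l x + m12 x * B l x)) (at x within {0..1})"
    "\<And>l x. x \<in> {0..1} \<Longrightarrow>
       (B l has_real_derivative l * (m21 x * A l x + m22 x * B l x)) (at x within {0..1})"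
    "\<And>k. continuous_on ({-k..k} \<times> {0..1}) (\<lambda>(l, x). A l x)"
    "\<And>k. continuous_on ({-k..k} \<times> {0..1}) (\<lambda>(l, x). B l x)"
proof -
  have "\<exists>M. \<forall>x\<in>{0..1}. \<bar>m x\<bar> \<le> M" if "continuous_on {0..1} m" for m :: "real \<Rightarrow> real"
    using compact_imp_bounded[OF compact_continuous_image[OF that compact_Icc]]
    by (auto simp: bounded_iff)
  then obtain M1 M2 M3 M4 where
    "\<forall>x\<in>{0..1}. \<bar>m11 x\<bar> \<le> M1" "\<forall>x\<in>{0..1}. \<bar>m12 x\<bar> \<le> M2"
    "\<forall>x\<in>{0..1}. \<bar>m21 x\<bar> \<le> M3" "\<forall>x\<in>{0..1}. \<bar>m22 x\<bar> \<le> M4"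
    using cont by metis
  note Mi = this
  define M where "M = max (max M1 M2) (max M3 M4)"
  have M: "\<bar>m11 x\<bar> \<le> M \<and> \<bar>m12 x\<bar> \<le> M \<and> \<bar>m21 x\<bar> \<le> M \<and> \<bar>m22 x\<bar> \<le> M" if "x \<in> {0..1}" for x
    using Mi[rule_format, OF that] by (simp add: M_def le_max_iff_disj)
  have M0: "0 \<le> M" using M[of 0] by auto
  define C where "C = 2 * M"
  have C0: "0 \<le> C" using M0 by (simp add: C_def)
  define ab where "ab = rec_nat ((\<lambda>x::real. 1::real), (\<lambda>x::real. 0::real))
    (\<lambda>_ (a, b). ((\<lambda>x. integral {0..x} (\<lambda>s. m11 s * a s + m12 s * b s)),
                  (\<lambda>x. integral {0..x} (\<lambda>s. m21 s * a s + m22 s * b s))))"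
  define a where "a n = fst (ab n)" for n
  define b where "b n = snd (ab n)" for n
  have a0: "a 0 = (\<lambda>x. 1)" and b0: "b 0 = (\<lambda>x. 0)" by (simp_all add: a_def b_def ab_def)
  have aS: "a (Suc n) = (\<lambda>x. integral {0..x} (\<lambda>s. m11 s * a n s + m12 s * b n s))"
    and bS: "b (Suc n) = (\<lambda>x. integral {0..x} (\<lambda>s. m21 s * a n s + m22 s * b n s))" for n
    by (simp_all add: a_def b_def ab_def case_prod_unfold)
  have derI: "((\<lambda>x. integral {0..x} f) has_real_derivative f x) (at x within {0..1})"
    if "continuous_on {0..1} f" "x \<in> {0..1}" for f :: "real \<Rightarrow> real" and x
    using integral_has_real_derivative[OF that] .
  have contab: "continuous_on {0..1} (a n) \<and> continuous_on {0..1} (b n)" for n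
  proof (induction n)
    case 0
    then show ?case by (simp add: a0 b0)
  next
    case (Suc n)
    have "continuous_on {0..1} (\<lambda>s. m11 s * a n s + m12 s * b n s)"
      "continuous_on {0..1} (\<lambda>s. m21 s * a n s + m22 s * b n s)"
      using Suc cont by (auto intro!: continuous_intros)
    then show ?case unfolding aS bS
      by (intro conjI; intro DERIV_continuous_on[OF derI])
  qed
  have cont1: "continuous_on {0..1} (\<lambda>s. m11 s * a n s + m12 s * b n s)"
    and cont2: "continuous_on {0..1} (\<lambda>s. m21 s * a n s + m22 s * b n s)" for n
    using contab[of n] cont by (auto intro!: continuous_intros)
  have derS: "(a (Suc n) has_real_derivative m11 x * a n x + m12 x * b n x) (at x within {0..1})"
    "(b (Suc n) has_real_derivative m21 x * a n x + m22 x * b n x) (at x within {0..1})"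
    if "x \<in> {0..1}" for n x
    unfolding aS bS using derI[OF cont1 that] derI[OF cont2 that] by auto
  have step: "\<bar>p * u + q * v\<bar> \<le> C * w" if "\<bar>p\<bar> \<le> M" "\<bar>q\<bar> \<le> M" "\<bar>u\<bar> \<le> w" "\<bar>v\<bar> \<le> w" for p q u v w
  proof -
    have "\<bar>p * u + q * v\<bar> \<le> \<bar>p\<bar> * \<bar>u\<bar> + \<bar>q\<bar> * \<bar>v\<bar>" by (metis abs_mult abs_triangle_ineq)
    also have "\<dots> \<le> M * w + M * w" using that M0 by (intro add_mono mult_mono) auto
    finally show ?thesis by (simp add: C_def)
  qed
  have bound: "\<forall>x\<in>{0..1}. \<bar>a n x\<bar> \<le> (C * x) ^ n / fact n \<and> \<bar>b n x\<bar> \<le> (C * x) ^ n / fact n" for n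
  proof (induction n)
    case 0
    then show ?case by (simp add: a0 b0)
  next
    case (Suc n)
    have *: "\<bar>integral {0..x} f\<bar> \<le> (C * x) ^ Suc n / fact (Suc n)"
      if x: "x \<in> {0..1}" and f: "continuous_on {0..1} f"
        and fb: "\<And>s. s \<in> {0..1} \<Longrightarrow> \<bar>f s\<bar> \<le> C * ((C * s) ^ n / fact n)" for f x
    proof -
      have hi: "((\<lambda>s. C * ((C * s) ^ n / fact n)) has_integral
              ((C * x) ^ Suc n / fact (Suc n) - (C * 0) ^ Suc n / fact (Suc n))) {0..x}"
      proof (rule fundamental_theorem_of_calculus)
        show "0 \<le> x" using x by simp
        fix s assume "s \<in> {0..x}"
        show "((\<lambda>s. (C * s) ^ Suc n / fact (Suc n)) has_vector_derivative C * ((C * s) ^ n / fact n))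
                (at s within {0..x})"
          unfolding has_real_derivative_iff_has_vector_derivative[symmetric]
          by (rule derivative_eq_intros refl | simp add: field_simps del: of_nat_Suc)+
      qed
      have "norm (integral {0..x} f) \<le> integral {0..x} (\<lambda>s. C * ((C * s) ^ n / fact n))"
      proof (rule integral_norm_bound_integral)
        show "f integrable_on {0..x}"
          using x by (intro integrable_continuous_real continuous_on_subset[OF f]) auto
        show "(\<lambda>s. C * ((C * s) ^ n / fact n)) integrable_on {0..x}" using hi by blast
        show "norm (f s) \<le> C * ((C * s) ^ n / fact n)" if "s \<in> {0..x}" for s
          using fb[of s] that x by auto
      qed
      also have "\<dots> = (C * x) ^ Suc n / fact (Suc n)" using integral_unique[OF hi] by simp
      finally show ?thesis by simp
    qed
    have "\<bar>m11 s * a n s + m12 s * b n s\<bar> \<le> C * ((C * s) ^ n / fact n)"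
      "\<bar>m21 s * a n s + m22 s * b n s\<bar> \<le> C * ((C * s) ^ n / fact n)" if "s \<in> {0..1}" for s
      using Suc that M[OF that] by (intro step; blast)+
    then show ?case unfolding aS bS by (intro ballI conjI *[OF _ cont1] *[OF _ cont2])
  qed
  have bound': "\<bar>a n x\<bar> \<le> C ^ n / fact n" "\<bar>b n x\<bar> \<le> C ^ n / fact n" if x: "x \<in> {0..1}" for n x
  proof -
    have "(C * x) ^ n / fact n \<le> C ^ n / fact n"
      using x C0 by (intro divide_right_mono power_mono mult_left_le) auto
    then show "\<bar>a n x\<bar> \<le> C ^ n / fact n" "\<bar>b n x\<bar> \<le> C ^ n / fact n"
      using bound[of n] x by force+
  qed
  have sumC: "summable (\<lambda>n. c * (k ^ n * (C ^ n / fact n)))" for c k :: real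
    using summable_exp[of "k * C"] by (intro summable_mult) (simp add: power_mult_distrib field_simps)
  have pw: "\<bar>l ^ n * u\<bar> \<le> k ^ n * w" if "\<bar>l\<bar> \<le> k" "\<bar>u\<bar> \<le> w" for l k u w :: real and n
    unfolding abs_mult power_abs using that by (intro mult_mono power_mono) auto
  define A where "A l x = (\<Sum>n. l ^ n * a n x)" for l x
  define B where "B l x = (\<Sum>n. l ^ n * b n x)" for l x
  have summ: "summable (\<lambda>n. l ^ n * a n x)" "summable (\<lambda>n. l ^ n * b n x)" if x: "x \<in> {0..1}" for l x
    by (rule summable_comparison_test'[OF sumC[of 1 "\<bar>l\<bar>"], of 0],
        simp only: real_norm_def mult_1, rule pw[OF order_refl bound'(1)[OF x]],
        rule summable_comparison_test'[OF sumC[of 1 "\<bar>l\<bar>"], of 0],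
        simp only: real_norm_def mult_1, rule pw[OF order_refl bound'(2)[OF x]])
  have unif: "uniform_limit ({-k..k} \<times> {0..1}) (\<lambda>n z. \<Sum>i<n. fst z ^ i * h i (snd z))
       (\<lambda>z. \<Sum>i. fst z ^ i * h i (snd z)) sequentially"
    if "\<And>n x. x \<in> {0..1} \<Longrightarrow> \<bar>h n x\<bar> \<le> C ^ n / fact n" for h :: "nat \<Rightarrow> real \<Rightarrow> real" and k
  proof (rule Weierstrass_m_test[OF _ sumC[of 1 k]])
    fix n and z :: "real \<times> real" assume "z \<in> {-k..k} \<times> {0..1}"
    then have "\<bar>fst z\<bar> \<le> k" "snd z \<in> {0..1}" by auto
    then show "norm (fst z ^ n * h n (snd z)) \<le> 1 * (k ^ n * (C ^ n / fact n))"
      unfolding real_norm_def mult_1 by (intro pw that)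
  qed
  have jc: "continuous_on ({-k..k} \<times> {0..1}) (\<lambda>z. \<Sum>i. fst z ^ i * h i (snd z))"
    if h: "\<And>n x. x \<in> {0..1} \<Longrightarrow> \<bar>h n x\<bar> \<le> C ^ n / fact n" and hc: "\<And>n. continuous_on {0..1} (h n)"
    for h :: "nat \<Rightarrow> real \<Rightarrow> real" and k
  proof (rule uniform_limit_theorem[OF _ unif[where h = h and k = k, OF h]])
    have "continuous_on ({-k..k} \<times> {0..1}) (\<lambda>z. h i (snd z))" for i
      by (rule continuous_on_compose2[OF hc]) (auto intro!: continuous_intros)
    then show "\<forall>\<^sub>F n in sequentially. continuous_on ({-k..k} \<times> {0..1}) (\<lambda>z. \<Sum>i<n. fst z ^ i * h i (snd z))"
      by (intro always_eventually allI continuous_intros)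
  qed auto
  have termwise: "((\<lambda>x. \<Sum>n. l ^ n * h n x) has_real_derivative l * (p x * A l x + q x * B l x)) (at x within {0..1})"
    if hS: "\<And>n x. x \<in> {0..1} \<Longrightarrow> (h (Suc n) has_real_derivative p x * a n x + q x * b n x) (at x within {0..1})"
      and pq: "\<And>x. x \<in> {0..1} \<Longrightarrow> \<bar>p x\<bar> \<le> M \<and> \<bar>q x\<bar> \<le> M" and h0: "h 0 = (\<lambda>x. h00)"
      and sh: "\<And>x. x \<in> {0..1} \<Longrightarrow> summable (\<lambda>n. l ^ n * h n x)" and x: "x \<in> {0..1}"
    for h :: "nat \<Rightarrow> real \<Rightarrow> real" and p q :: "real \<Rightarrow> real" and l x h00
  proof -
    have ul: "uniform_limit {0..1} (\<lambda>n x. \<Sum>i<n. l ^ Suc i * (p x * a i x + q x * b i x))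
        (\<lambda>x. \<Sum>i. l ^ Suc i * (p x * a i x + q x * b i x)) sequentially"
    proof (rule Weierstrass_m_test[OF _ sumC[of "\<bar>l\<bar> * C" "\<bar>l\<bar>"]])
      fix n x :: real and i :: nat assume x: "x \<in> {0..1}"
      have "\<bar>p x * a i x + q x * b i x\<bar> \<le> C * (C ^ i / fact i)"
        using pq[OF x] bound'[OF x] by (intro step) auto
      then have "\<bar>l ^ Suc i * (p x * a i x + q x * b i x)\<bar> \<le> \<bar>l\<bar> ^ Suc i * (C * (C ^ i / fact i))"
        by (intro pw) auto
      then show "norm (l ^ Suc i * (p x * a i x + q x * b i x)) \<le> \<bar>l\<bar> * C * (\<bar>l\<bar> ^ i * (C ^ i / fact i))"
        by (simp add: mult_ac)
    qed
    have "\<exists>g. \<forall>x\<in>{0..1}. (\<lambda>n. l ^ Suc n * h (Suc n) x) sums g x \<and>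
        (g has_field_derivative (\<Sum>i. l ^ Suc i * (p x * a i x + q x * b i x))) (at x within {0..1})"
    proof (rule has_field_derivative_series[OF _ _ ul])
      show "((\<lambda>x. l ^ Suc n * h (Suc n) x) has_real_derivative l ^ Suc n * (p x * a n x + q x * b n x)) (at x within {0..1})"
        if "x \<in> {0..1}" for n x by (rule DERIV_cmult[OF hS[OF that]])
      show "(0::real) \<in> {0..1}" by simp
      show "summable (\<lambda>n. l ^ Suc n * h (Suc n) 0)"
        using sh[of 0] summable_Suc_iff[of "\<lambda>n. l ^ n * h n 0"] by simp
    qed auto
    then obtain g where g: "\<And>x. x \<in> {0..1} \<Longrightarrow> (\<lambda>n. l ^ Suc n * h (Suc n) x) sums g x"
      "\<And>x. x \<in> {0..1} \<Longrightarrow> (g has_field_derivative (\<Sum>i. l ^ Suc i * (p x * a i x + q x * b i x))) (at x within {0..1})"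
      by blast
    have eq: "(\<Sum>n. l ^ n * h n x) = h00 + g x" if "x \<in> {0..1}" for x
      using suminf_split_head[OF sh[OF that]] sums_unique[OF g(1)[OF that]] h0 by simp
    have sm: "(\<Sum>i. l ^ Suc i * (p x * a i x + q x * b i x)) = l * (p x * A l x + q x * B l x)"
    proof -
      have "(\<lambda>i. l * (p x * (l ^ i * a i x) + q x * (l ^ i * b i x))) sums (l * (p x * A l x + q x * B l x))"
        unfolding A_def B_def
        by (intro sums_mult sums_add summable_sums summ x)
      then show ?thesis by (simp add: sums_iff algebra_simps)
    qed
    have "((\<lambda>x. h00 + g x) has_real_derivative l * (p x * A l x + q x * B l x)) (at x within {0..1})"
      using g(2)[OF x] unfolding sm by (auto intro!: derivative_eq_intros)
    then show ?thesis
      using eq x by (subst has_field_derivative_cong_eventually[where g = "\<lambda>x. h00 + g x"])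
        (auto simp: eventually_at_filter)
  qed
  show ?thesis
  proof (rule that[of A B])
    have z: "a (Suc n) 0 = 0" "b (Suc n) 0 = 0" for n by (simp_all add: aS bS)
    show "A l 0 = 1" for l
      using suminf_split_head[OF summ(1)[of 0 l]] by (simp add: A_def z a0)
    show "B l 0 = 0" for l
      using suminf_split_head[OF summ(2)[of 0 l]] by (simp add: B_def z b0)
    show "(A l has_real_derivative l * (m11 x * A l x + m12 x * B l x)) (at x within {0..1})"
      if "x \<in> {0..1}" for l x
    proof -
      have eq: "(\<lambda>x. \<Sum>n. l ^ n * a n x) = A l" by (simp add: A_def fun_eq_iff)
      have "((\<lambda>x. \<Sum>n. l ^ n * a n x) has_real_derivative l * (m11 x * A l x + m12 x * B l x))
          (at x within {0..1})"
        by (rule termwise[OF derS(1) _ a0 summ(1) that]) (use M in auto)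
      then show ?thesis unfolding eq .
    qed
    show "(B l has_real_derivative l * (m21 x * A l x + m22 x * B l x)) (at x within {0..1})"
      if "x \<in> {0..1}" for l x
    proof -
      have eq: "(\<lambda>x. \<Sum>n. l ^ n * b n x) = B l" by (simp add: B_def fun_eq_iff)
      have "((\<lambda>x. \<Sum>n. l ^ n * b n x) has_real_derivative l * (m21 x * A l x + m22 x * B l x))
          (at x within {0..1})"
        by (rule termwise[OF derS(2) _ b0 summ(2) that]) (use M in auto)
      then show ?thesis unfolding eq .
    qed
    show "continuous_on ({-k..k} \<times> {0..1}) (\<lambda>(l, x). A l x)" for k
      unfolding A_def case_prod_unfold by (rule jc[where h = a, OF bound'(1)]) (use contab in auto)
    show "continuous_on ({-k..k} \<times> {0..1}) (\<lambda>(l, x). B l x)" for k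
      unfolding B_def case_prod_unfold by (rule jc[where h = b, OF bound'(2)]) (use contab in auto)
  qed
qed

section \<open>The Wronskian and the fundamental pair\<close>

text \<open>The derivatives are parameters instead of being written \<open>deriv L\<close> and \<open>deriv R\<close> because they
  are also needed at the end points, where \<open>deriv\<close> carries no information.\<close>

locale fundamental_pair =
  fixes q L R L' R' :: "real \<Rightarrow> real"
  assumes solL: "regular_solution q L" and solR: "regular_solution q R"
    and L0: "L 0 = 0" and R1: "R 1 = 0"
    and derL: "x \<in> {0..1} \<Longrightarrow> (L has_real_derivative L' x) (at x within {0..1})"
    and derR: "x \<in> {0..1} \<Longrightarrow> (R has_real_derivative R' x) (at x within {0..1})"
    and wronskian: "x \<in> {0..1} \<Longrightarrow> L x * R' x - L' x * R x = -1"
    and L'0: "L' 0 > 0" and R'1: "R' 1 < 0"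

lemma normalized_pair_fundamental:
  assumes "normalized_pair q L R"
  obtains L' R' where "fundamental_pair q L R L' R'"
  using assms unfolding normalized_pair_def fundamental_pair_def by metis

lemma consecutive_unit: "consecutive {0, 1} a b \<longleftrightarrow> a = 0 \<and> b = 1"
  by (auto simp: consecutive_def)

lemma regular_solution_iff:
  "regular_solution q y \<longleftrightarrow>
     abs_continuous_on {0..1} y \<and> y differentiable (at_right 0) \<and> y differentiable (at_left 1) \<and>
     (\<forall>x\<in>{0<..<1}. y differentiable (at x)) \<and> abs_continuous_on {0<..<1} (deriv y) \<and>
     (AE x in lebesgue. x \<in> {0<..<1} \<longrightarrow>
       (\<exists>d. (deriv y has_real_derivative d) (at x) \<and> - d + q x * y x = 0))"
  by (simp add: delta_solution_def consecutive_unit)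

lemma at_within_unit: "x \<in> {0<..<1} \<Longrightarrow> at x within {0..1} = at (x::real)"
  by (intro at_within_Icc_at) auto

lemma has_derivative_cong_open:
  fixes f g :: "real \<Rightarrow> real"
  assumes "(f has_real_derivative d) (at x)" "x \<in> {a<..<b}" "\<And>y. y \<in> {a<..<b} \<Longrightarrow> f y = g y"
  shows "(g has_real_derivative d) (at x)"
  using assms(1)
proof (rule DERIV_cong_ev[THEN iffD1, rotated 3])
  show "\<forall>\<^sub>F y in nhds x. f y = g y"
    using assms(2,3) eventually_nhds_in_open[OF open_greaterThanLessThan, of x a b]
    by (auto elim: eventually_mono)
qed auto

lemma abs_continuous_on_cong:
  assumes "abs_continuous_on S f" "\<And>x. x \<in> S \<Longrightarrow> f x = g x"
  shows "abs_continuous_on S g"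
proof (rule abs_continuous_on_dominated[OF assms(1) assms(1), of _ 1])
  fix a b :: real assume "a < b" "{a..b} \<subseteq> S"
  then have "a \<in> S" "b \<in> S" by auto
  then show "\<bar>g b - g a\<bar> \<le> 1 * (\<bar>f b - f a\<bar> + \<bar>f b - f a\<bar>)" using assms(2)[of a] assms(2)[of b] by simp
qed

text \<open>The Wronskian has derivative zero almost everywhere, since both functions satisfy
  \<open>y'' = q * y\<close>. It is constant because it is absolutely continuous on compact subintervals;
  without absolute continuity of the derivatives this conclusion would fail.\<close>

lemma wronskian_constant:
  fixes y z y' z' q :: "real \<Rightarrow> real"
  assumes ac: "abs_continuous_on {a<..<b} y" "abs_continuous_on {a<..<b} z"
      "abs_continuous_on {a<..<b} y'" "abs_continuous_on {a<..<b} z'"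
    and dy: "\<And>x. x \<in> {a<..<b} \<Longrightarrow> (y has_real_derivative y' x) (at x)"
    and dz: "\<And>x. x \<in> {a<..<b} \<Longrightarrow> (z has_real_derivative z' x) (at x)"
    and ddy: "AE x in lebesgue. x \<in> {a<..<b} \<longrightarrow> (y' has_real_derivative q x * y x) (at x)"
    and ddz: "AE x in lebesgue. x \<in> {a<..<b} \<longrightarrow> (z' has_real_derivative q x * z x) (at x)"
    and s: "s \<in> {a<..<b}" and t: "t \<in> {a<..<b}"
  shows "y s * z' s - y' s * z s = y t * z' t - y' t * z t"
proof -
  have main: "y t * z' t - y' t * z t = y s * z' s - y' s * z s"
    if s: "s \<in> {a<..<b}" and t: "t \<in> {a<..<b}" and "s \<le> t" for s t
  proof -
    have sub: "{s..t} \<subseteq> {a<..<b}" using s t by auto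
    have ac': "abs_continuous_on {s..t} y" "abs_continuous_on {s..t} z"
      "abs_continuous_on {s..t} y'" "abs_continuous_on {s..t} z'"
      using ac abs_continuous_on_subset sub by blast+
    have bd: "bounded (f ` {s..t})" if "abs_continuous_on {s..t} f" for f :: "real \<Rightarrow> real"
      using that by (rule abs_continuous_on_imp_bounded) (auto simp: is_interval_cc)
    have "AE x in lebesgue. x \<in> {a<..<b} \<longrightarrow> (y' has_real_derivative q x * y x) (at x) \<and>
            (z' has_real_derivative q x * z x) (at x)"
      using ddy ddz by eventually_elim auto
    then obtain N where N: "negligible N"
      "{x. \<not> (x \<in> {a<..<b} \<longrightarrow> (y' has_real_derivative q x * y x) (at x) \<and>
            (z' has_real_derivative q x * z x) (at x))} \<subseteq> N"
      unfolding eventually_ae_filter_negligible by blast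
    show ?thesis
    proof (rule abs_continuous_on_deriv_zero[where f = "\<lambda>x. y x * z' x - y' x * z x", OF _ that(3) N(1)])
      show "abs_continuous_on {s..t} (\<lambda>x. y x * z' x - y' x * z x)"
        by (intro abs_continuous_on_diff abs_continuous_on_mult ac' bd)
      fix x assume x: "x \<in> {s..t} - N"
      then have xab: "x \<in> {a<..<b}" using sub by auto
      have d2: "(y' has_real_derivative q x * y x) (at x)" "(z' has_real_derivative q x * z x) (at x)"
        using N(2) x xab by auto
      have "((\<lambda>x. y x * z' x - y' x * z x) has_real_derivative 0) (at x)"
        by (rule derivative_eq_intros dy[OF xab] dz[OF xab] d2 refl | simp add: algebra_simps)+
      then show "((\<lambda>x. y x * z' x - y' x * z x) has_real_derivative 0) (at x within {s..t})"
        by (rule has_field_derivative_at_within)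
    qed
  qed
  show ?thesis using main[OF s t] main[OF t s] by linarith
qed

lemma regular_solution_second_derivative:
  assumes sol: "regular_solution q y" and y': "\<And>x. x \<in> {0<..<1} \<Longrightarrow> deriv y x = y' x"
  shows "AE x in lebesgue. x \<in> {0<..<1} \<longrightarrow> (y' has_real_derivative q x * y x) (at x)"
proof -
  have "AE x in lebesgue. x \<in> {0<..<1} \<longrightarrow> (\<exists>d. (deriv y has_real_derivative d) (at x) \<and> - d + q x * y x = 0)"
    using sol by (simp add: regular_solution_iff)
  then show ?thesis
  proof eventually_elim
    case (elim x)
    show ?case
    proof
      assume x: "x \<in> {0<..<1}"
      then obtain d where d: "(deriv y has_real_derivative d) (at x)" "- d + q x * y x = 0" using elim by blast
      have "(y' has_real_derivative d) (at x)" by (rule has_derivative_cong_open[OF d(1) x y'])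
      then show "(y' has_real_derivative q x * y x) (at x)" using d(2) by simp
    qed
  qed
qed

context fundamental_pair
begin

lemma contL: "continuous_on {0..1} L" and contR: "continuous_on {0..1} R"
  using DERIV_continuous_on[OF derL] DERIV_continuous_on[OF derR] by auto

lemma derL_at: "x \<in> {0<..<1} \<Longrightarrow> (L has_real_derivative L' x) (at x)"
  and derR_at: "x \<in> {0<..<1} \<Longrightarrow> (R has_real_derivative R' x) (at x)"
  using derL[of x] derR[of x] at_within_unit[of x] by auto

lemma derivL: "x \<in> {0<..<1} \<Longrightarrow> deriv L x = L' x"
  and derivR: "x \<in> {0<..<1} \<Longrightarrow> deriv R x = R' x"
  using derL_at derR_at DERIV_imp_deriv by blast+

lemma acL: "abs_continuous_on {0..1} L" and acR: "abs_continuous_on {0..1} R"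
  using solL solR by (auto simp: regular_solution_iff)

lemma acL': "abs_continuous_on {0<..<1} L'"
  and acR': "abs_continuous_on {0<..<1} R'"
  using solL solR abs_continuous_on_cong[of "{0<..<1}" "deriv L" L', OF _ derivL]
    abs_continuous_on_cong[of "{0<..<1}" "deriv R" R', OF _ derivR]
  unfolding regular_solution_iff by blast+

lemma second_derivatives:
  "AE x in lebesgue. x \<in> {0<..<1} \<longrightarrow> (L' has_real_derivative q x * L x) (at x)"
  "AE x in lebesgue. x \<in> {0<..<1} \<longrightarrow> (R' has_real_derivative q x * R x) (at x)"
  by (rule regular_solution_second_derivative[OF solL derivL], assumption)
     (rule regular_solution_second_derivative[OF solR derivR], assumption)

lemma R0_pos: "R 0 > 0"
proof -
  have "L' 0 * R 0 = 1" using wronskian[of 0] L0 by simp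
  then show ?thesis using L'0 by (metis zero_less_mult_pos zero_less_one)
qed

lemma pair_nonzero:
  assumes x: "x \<in> {0..1}" and "a * L x + b * R x = 0" "a * L' x + b * R' x = 0"
  shows "a = 0" "b = 0"
proof -
  have "a * (L x * R' x - L' x * R x) = (a * L x + b * R x) * R' x - (a * L' x + b * R' x) * R x"
    "b * (L x * R' x - L' x * R x) = (a * L' x + b * R' x) * L x - (a * L x + b * R x) * L' x"
    by (simp_all add: algebra_simps)
  then show "a = 0" "b = 0" unfolding wronskian[OF x] assms(2,3) by simp_all
qed

text \<open>The Wronskians of \<open>y\<close> with \<open>R\<close> and with \<open>L\<close> are constant on \<open>{a<..<b}\<close>. Because of the
  normalization they are, up to sign, the coefficients of \<open>y\<close>. This takes the place of a
  uniqueness theorem for initial value problems.\<close>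

lemma solution_is_combination:
  assumes ab: "{a<..<b} \<subseteq> {0<..<1}" "a < b" and acy: "abs_continuous_on {0..1} y"
    and dy: "\<forall>x\<in>{a<..<b}. y differentiable (at x)"
    and acdy: "abs_continuous_on {a<..<b} (deriv y)"
    and ddy: "AE x in lebesgue. x \<in> {a<..<b} \<longrightarrow>
           (\<exists>d. (deriv y has_real_derivative d) (at x) \<and> - d + q x * y x = 0)"
  obtains c d where "\<And>x. x \<in> {a<..<b} \<Longrightarrow> y x = c * L x + d * R x \<and> deriv y x = c * L' x + d * R' x"
proof -
  have sub: "{a<..<b} \<subseteq> {0..1}" using ab(1) by force
  have dy': "(y has_real_derivative deriv y x) (at x)" if "x \<in> {a<..<b}" for x
    using dy that DERIV_deriv_iff_real_differentiable by blast
  have ddy': "AE x in lebesgue. x \<in> {a<..<b} \<longrightarrow> (deriv y has_real_derivative q x * y x) (at x)"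
    using ddy by eventually_elim (auto simp: algebra_simps)
  have ddL: "AE x in lebesgue. x \<in> {a<..<b} \<longrightarrow> (L' has_real_derivative q x * L x) (at x)"
    using second_derivatives(1) by eventually_elim (use ab in blast)
  have ddR: "AE x in lebesgue. x \<in> {a<..<b} \<longrightarrow> (R' has_real_derivative q x * R x) (at x)"
    using second_derivatives(2) by eventually_elim (use ab in blast)
  define m where "m = (a + b) / 2"
  have m: "m \<in> {a<..<b}" using ab(2) by (auto simp: m_def field_simps)
  have wR: "y x * R' x - deriv y x * R x = y m * R' m - deriv y m * R m" if "x \<in> {a<..<b}" for x
    by (rule wronskian_constant[OF _ _ acdy _ dy' _ ddy' ddR that m])
       (use abs_continuous_on_subset[OF acy sub] abs_continuous_on_subset[OF acR sub]
         abs_continuous_on_subset[OF acR' ab(1)] derR_at ab(1) in auto)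
  have wL: "y x * L' x - deriv y x * L x = y m * L' m - deriv y m * L m" if "x \<in> {a<..<b}" for x
    by (rule wronskian_constant[OF _ _ acdy _ dy' _ ddy' ddL that m])
       (use abs_continuous_on_subset[OF acy sub] abs_continuous_on_subset[OF acL sub]
         abs_continuous_on_subset[OF acL' ab(1)] derL_at ab(1) in auto)
  define c where "c = - (y m * R' m - deriv y m * R m)"
  define d where "d = y m * L' m - deriv y m * L m"
  have "y x = c * L x + d * R x \<and> deriv y x = c * L' x + d * R' x" if x: "x \<in> {a<..<b}" for x
  proof -
    have c: "c = - (y x * R' x - deriv y x * R x)" using wR[OF x] by (simp add: c_def)
    have d: "d = y x * L' x - deriv y x * L x" using wL[OF x] by (simp add: d_def)
    have "c * L x + d * R x = - (y x * (L x * R' x - L' x * R x))"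
      "c * L' x + d * R' x = - (deriv y x * (L x * R' x - L' x * R x))"
      unfolding c d by (simp_all add: algebra_simps)
    then show ?thesis using wronskian x sub by (auto simp: subset_iff)
  qed
  then show ?thesis using that by blast
qed

end

section \<open>Positivity of the fundamental pair\<close>

lemma continuous_on_unit_bounded:
  fixes f :: "real \<Rightarrow> real"
  assumes "continuous_on {0..1} f"
  obtains K where "\<And>x. x \<in> {0..1} \<Longrightarrow> \<bar>f x\<bar> \<le> K"
proof -
  have "bounded (f ` {0..1})"
    by (rule compact_imp_bounded[OF compact_continuous_image[OF assms compact_Icc]])
  then obtain K where "\<forall>x\<in>f ` {0..1}. norm x \<le> K" unfolding bounded_iff by blast
  then show ?thesis by (intro that[of K]) auto
qed

lemma abs_continuous_on_C1:
  fixes f f' :: "real \<Rightarrow> real"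
  assumes der: "\<And>x. x \<in> {0..1} \<Longrightarrow> (f has_real_derivative f' x) (at x within {0..1})"
    and cont: "continuous_on {0..1} f'"
  shows "abs_continuous_on {0..1} f"
proof -
  obtain K where K: "\<And>x. x \<in> {0..1} \<Longrightarrow> \<bar>f' x\<bar> \<le> K"
    by (rule continuous_on_unit_bounded[OF cont]) blast
  show ?thesis
  proof (rule abs_continuous_on_lipschitz)
    fix a b :: real assume "a \<in> {0..1}" "b \<in> {0..1}" "a < b"
    then show "\<bar>f b - f a\<bar> \<le> K * (b - a)"
      using field_differentiable_bound[of "{0..1}" f f' K b a] der K by simp
  qed
qed

context fundamental_pair
begin

text \<open>In the ansatz \<open>y = A * L + B * R\<close> the equation \<open>-y'' + q * y = l * y\<close> becomes a first-order
  system for \<open>A\<close> and \<open>B\<close> with continuous coefficients, in which \<open>q\<close> does not occur. The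
  almost everywhere differentiability of \<open>y'\<close> is inherited from \<open>L'\<close> and \<open>R'\<close>.\<close>

lemma variation_of_parameters:
  assumes dA: "\<And>x. x \<in> {0..1} \<Longrightarrow> (A has_real_derivative - l * R x * (A x * L x + B x * R x)) (at x within {0..1})"
    and dB: "\<And>x. x \<in> {0..1} \<Longrightarrow> (B has_real_derivative l * L x * (A x * L x + B x * R x)) (at x within {0..1})"
  defines "y \<equiv> \<lambda>x. A x * L x + B x * R x"
  shows "x \<in> {0..1} \<Longrightarrow> (y has_real_derivative A x * L' x + B x * R' x) (at x within {0..1})"
    and "regular_solution (\<lambda>x. q x - l) y"
proof -
  show der: "(y has_real_derivative A x * L' x + B x * R' x) (at x within {0..1})" if "x \<in> {0..1}" for x
    unfolding y_def
    by (rule derivative_eq_intros derL derR dA dB that refl | simp add: algebra_simps)+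
  have der_at: "(y has_real_derivative A x * L' x + B x * R' x) (at x)" if "x \<in> {0<..<1}" for x
    using der[of x] that at_within_unit[OF that] by auto
  have cA: "continuous_on {0..1} A" and cB: "continuous_on {0..1} B"
    using DERIV_continuous_on[OF dA] DERIV_continuous_on[OF dB] by auto
  have acA: "abs_continuous_on {0..1} A"
    by (rule abs_continuous_on_C1[OF dA]) (auto intro!: continuous_intros cA cB contL contR)
  have acB: "abs_continuous_on {0..1} B"
    by (rule abs_continuous_on_C1[OF dB]) (auto intro!: continuous_intros cA cB contL contR)
  have sub: "{0<..<1::real} \<subseteq> {0..1}" by auto
  have bd: "bounded (f ` {0..1})" if "abs_continuous_on {0..1} f" for f :: "real \<Rightarrow> real"
    using that by (rule abs_continuous_on_imp_bounded) (auto simp: is_interval_cc)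
  have bd': "bounded (f ` {0<..<1})" if "abs_continuous_on {0<..<1} f" for f :: "real \<Rightarrow> real"
    using that by (rule abs_continuous_on_imp_bounded) (auto simp: is_interval_oo)
  have dy: "deriv y x = A x * L' x + B x * R' x" if "x \<in> {0<..<1}" for x
    using der_at[OF that] by (rule DERIV_imp_deriv)
  have acdy: "abs_continuous_on {0<..<1} (\<lambda>x. A x * L' x + B x * R' x)"
    using abs_continuous_on_subset[OF acA sub] abs_continuous_on_subset[OF acB sub]
    by (intro abs_continuous_on_add abs_continuous_on_mult acL' acR' bd')
  show "regular_solution (\<lambda>x. q x - l) y"
    unfolding regular_solution_iff
  proof (intro conjI ballI)
    show "abs_continuous_on {0..1} y" unfolding y_def
      by (intro abs_continuous_on_add abs_continuous_on_mult acA acB acL acR bd)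
    show "y differentiable at_right 0"
      using der[of 0] by (auto simp: real_differentiable_def at_within_Icc_at_right)
    show "y differentiable at_left 1"
      using der[of 1] by (auto simp: real_differentiable_def at_within_Icc_at_left)
    show "y differentiable (at x)" if "x \<in> {0<..<1}" for x
      using der_at[OF that] real_differentiable_def by blast
    show "abs_continuous_on {0<..<1} (deriv y)"
      by (rule abs_continuous_on_cong[OF acdy]) (simp add: dy)
    show "AE x in lebesgue. x \<in> {0<..<1} \<longrightarrow>
       (\<exists>d. (deriv y has_real_derivative d) (at x) \<and> - d + (q x - l) * y x = 0)"
      using second_derivatives
    proof eventually_elim
      case (elim x)
      show ?case
      proof (intro impI exI conjI)
        assume x: "x \<in> {0<..<1}"
        then have xc: "x \<in> {0..1}" by auto
        have dA': "(A has_real_derivative - l * R x * y x) (at x)"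
          and dB': "(B has_real_derivative l * L x * y x) (at x)"
          using dA[OF xc] dB[OF xc] at_within_unit[OF x] by (auto simp: y_def)
        have "((\<lambda>x. A x * L' x + B x * R' x) has_real_derivative
            (- l * R x * y x) * L' x + A x * (q x * L x) + ((l * L x * y x) * R' x + B x * (q x * R x))) (at x)"
          using elim x by (auto intro!: derivative_eq_intros dA' dB')
        moreover have "(- l * R x * y x) * L' x + A x * (q x * L x) + ((l * L x * y x) * R' x + B x * (q x * R x))
            = l * y x * (L x * R' x - L' x * R x) + q x * y x"
          by (simp add: y_def algebra_simps)
        moreover have "l * y x * (L x * R' x - L' x * R x) + q x * y x = (q x - l) * y x"
          unfolding wronskian[OF xc] by (simp add: algebra_simps)
        ultimately have "((\<lambda>x. A x * L' x + B x * R' x) has_real_derivative (q x - l) * y x) (at x)"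
          by (simp only:)
        then show "(deriv y has_real_derivative (q x - l) * y x) (at x)"
          by (rule has_derivative_cong_open[OF _ x]) (simp add: dy)
      qed simp
    qed
  qed
qed

end

text \<open>The family of solutions of \<open>-y'' + q * y = l * y\<close> that start at \<open>0\<close> like \<open>L\<close>, given by their
  coefficients with respect to \<open>L\<close> and \<open>R\<close>.\<close>

locale spectral_family = fundamental_pair +
  fixes A B :: "real \<Rightarrow> real \<Rightarrow> real"
  assumes A0: "A l 0 = 1" and B0: "B l 0 = 0"
    and dA: "x \<in> {0..1} \<Longrightarrow>
      (A l has_real_derivative - l * R x * (A l x * L x + B l x * R x)) (at x within {0..1})"
    and dB: "x \<in> {0..1} \<Longrightarrow>
      (B l has_real_derivative l * L x * (A l x * L x + B l x * R x)) (at x within {0..1})"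
    and cA: "continuous_on ({-k..k} \<times> {0..1}) (\<lambda>(l, x). A l x)"
    and cB: "continuous_on ({-k..k} \<times> {0..1}) (\<lambda>(l, x). B l x)"

lemma (in fundamental_pair) spectral_family_exists:
  obtains A B where "spectral_family q L R L' R' A B"
proof -
  obtain A B :: "real \<Rightarrow> real \<Rightarrow> real" where AB: "\<And>l. A l 0 = 1" "\<And>l. B l 0 = 0"
    and dA0: "\<And>l x. x \<in> {0..1} \<Longrightarrow>
       (A l has_real_derivative l * ((- (R x * L x)) * A l x + (- (R x * R x)) * B l x)) (at x within {0..1})"
    and dB0: "\<And>l x. x \<in> {0..1} \<Longrightarrow>
       (B l has_real_derivative l * ((L x * L x) * A l x + (L x * R x) * B l x)) (at x within {0..1})"
    and c: "\<And>k. continuous_on ({-k..k} \<times> {0..1}) (\<lambda>(l, x). A l x)"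
      "\<And>k. continuous_on ({-k..k} \<times> {0..1}) (\<lambda>(l, x). B l x)"
    by (rule linear_system_parameter[of "\<lambda>x. - (R x * L x)" "\<lambda>x. - (R x * R x)" "\<lambda>x. L x * L x" "\<lambda>x. L x * R x"])
       (auto intro!: continuous_intros contL contR)
  have "(A l has_real_derivative - l * R x * (A l x * L x + B l x * R x)) (at x within {0..1})"
    "(B l has_real_derivative l * L x * (A l x * L x + B l x * R x)) (at x within {0..1})"
    if "x \<in> {0..1}" for l x
    using dA0[OF that, of l] dB0[OF that, of l] by (simp_all add: algebra_simps)
  then show ?thesis using AB c
    by (intro that[of A B] spectral_family.intro spectral_family_axioms.intro fundamental_pair_axioms)
qed

context spectral_family
begin

definition y where "y l x = A l x * L x + B l x * R x"
text \<open>\<open>N\<close> plays the role of the derivative of \<open>y\<close>: if \<open>G = L\<^sup>2 + R\<^sup>2\<close>, then the derivative of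
  \<open>y / sqrt G\<close> is \<open>N / (G * sqrt G)\<close>. Together with \<open>y\<close> it determines \<open>A\<close> and \<open>B\<close>, and it
  does not involve \<open>L'\<close> and \<open>R'\<close>.\<close>

definition N where "N l x = A l x * R x - B l x * L x"

lemma dy: "x \<in> {0..1} \<Longrightarrow> (y l has_real_derivative A l x * L' x + B l x * R' x) (at x within {0..1})"
  using variation_of_parameters(1)[OF dA dB, of x l] by (simp add: y_def[abs_def])

lemma y_solution: "regular_solution (\<lambda>x. q x - l) (y l)"
  using variation_of_parameters(2)[OF dA dB, of l] by (simp add: y_def[abs_def])

lemma y0: "y l 0 = 0" by (simp add: y_def L0 B0)

lemma y_continuous: "continuous_on {0..1} (y l)"
  using DERIV_continuous_on[OF dy] by auto

lemma y_jointly_continuous: "continuous_on ({-k..k} \<times> {0..1}) (\<lambda>(l, x). y l x)"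
proof -
  have "continuous_on ({-k..k} \<times> {0..1::real}) (\<lambda>z. L (snd z))"
    "continuous_on ({-k..k} \<times> {0..1::real}) (\<lambda>z. R (snd z))"
    by (rule continuous_on_compose2[OF contL] continuous_on_compose2[OF contR]; auto intro!: continuous_intros)+
  then show ?thesis using cA[of k] cB[of k] unfolding y_def case_prod_unfold
    by (intro continuous_intros)
qed

text \<open>Near \<open>0\<close> the functions \<open>R\<close> and \<open>A l\<close> are positive, uniformly for \<open>l\<close> near \<open>l0\<close>. The
  derivative of \<open>y l / R\<close> is \<open>A l / R\<^sup>2\<close>, so this quotient increases from the value \<open>0\<close>.\<close>

lemma positive_near_zero: "\<exists>\<delta>>0. \<exists>e>0. \<delta> \<le> 1 \<and> (\<forall>l. \<bar>l - l0\<bar> < e \<longrightarrow> (\<forall>x\<in>{0<..\<delta>}. y l x > 0))"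
proof -
  have "(0::real) \<in> {0..1}" by simp
  from contR[unfolded continuous_on_iff, rule_format, OF this R0_pos]
  obtain d1 where d1: "d1 > 0" "\<And>x. x \<in> {0..1} \<Longrightarrow> dist x 0 < d1 \<Longrightarrow> dist (R x) (R 0) < R 0"
    by auto
  define k where "k = \<bar>l0\<bar> + 1"
  have "(l0, 0) \<in> {-k..k} \<times> {0..1::real}" by (auto simp: k_def)
  from cA[of k, unfolded continuous_on_iff, rule_format, OF this zero_less_one]
  obtain d2 where d2: "d2 > 0" "\<And>z. z \<in> {-k..k} \<times> {0..1} \<Longrightarrow> dist z (l0, 0) < d2 \<Longrightarrow>
      dist (case z of (l, x) \<Rightarrow> A l x) (A l0 0) < 1" by auto
  define \<delta> where "\<delta> = Min {d1 / 2, d2 / 2, 1}"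
  define e where "e = min (d2 / 2) 1"
  have \<delta>: "\<delta> > 0" "\<delta> \<le> d1 / 2" "\<delta> \<le> d2 / 2" "\<delta> \<le> 1" and e: "e > 0" "e \<le> d2 / 2" "e \<le> 1"
    using d1(1) d2(1) by (auto simp: \<delta>_def e_def)
  have "y l x > 0" if l: "\<bar>l - l0\<bar> < e" and x: "x \<in> {0<..\<delta>}" for l x
  proof -
    have Rp: "R s > 0" if "s \<in> {0..x}" for s
    proof -
      have "\<bar>R s - R 0\<bar> < R 0" using d1(2)[of s] that x \<delta> d1(1) by (simp add: dist_real_def)
      then show ?thesis by linarith
    qed
    have Ap: "A l s > 0" if "s \<in> {0..x}" for s
    proof -
      have "dist (l, s) (l0, 0) \<le> \<bar>l - l0\<bar> + \<bar>s - 0\<bar>"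
        using sqrt_sum_squares_le_sum_abs[of "l - l0" s] by (simp add: dist_Pair_Pair dist_real_def)
      also have "\<dots> < d2" using l that x \<delta> e by auto
      finally have "dist (l, s) (l0, 0) < d2" .
      have "\<bar>A l s - A l0 0\<bar> < 1"
      proof -
        have "\<bar>l\<bar> \<le> k" using l e unfolding k_def by linarith
        then have "(l, s) \<in> {-k..k} \<times> {0..1}" using that x \<delta> by auto
        then show ?thesis using d2(2)[of "(l, s)"] \<open>dist (l, s) (l0, 0) < d2\<close> by (simp add: dist_real_def)
      qed
      then show "A l s > 0" using A0[of l0] by linarith
    qed
    have "y l 0 / R 0 < y l x / R x"
    proof (rule DERIV_pos_imp_increasing_open[where f = "\<lambda>s. y l s / R s"])
      show "0 < x" using x by simp
      fix s assume s: "0 < s" "s < x"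
      then have s01: "s \<in> {0<..<1}" using x \<delta> by auto
      have "(y l has_real_derivative A l s * L' s + B l s * R' s) (at s)"
        using dy[of s l] s01 at_within_unit[OF s01] by auto
      then have "((\<lambda>x. y l x / R x) has_real_derivative
          ((A l s * L' s + B l s * R' s) * R s - y l s * R' s) / (R s * R s)) (at s)"
        using Rp[of s] s by (intro DERIV_divide derR_at s01) auto
      moreover have "(A l s * L' s + B l s * R' s) * R s - y l s * R' s = - A l s * (L s * R' s - L' s * R s)"
        by (simp add: y_def algebra_simps)
      ultimately have "((\<lambda>x. y l x / R x) has_real_derivative A l s / (R s * R s)) (at s)"
        using wronskian[of s] s01 by simp
      moreover have "A l s / (R s * R s) > 0" using Ap[of s] Rp[of s] s by simp
      ultimately show "\<exists>d. ((\<lambda>x. y l x / R x) has_real_derivative d) (at s) \<and> 0 < d" by blast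
    next
      have sub: "{0..x} \<subseteq> {0..1}" using x \<delta> by auto
      show "continuous_on {0..x} (\<lambda>x. y l x / R x)"
        using Rp by (intro continuous_intros continuous_on_subset[OF y_continuous sub] continuous_on_subset[OF contR sub]) force
    qed
    then show ?thesis using y0[of l] Rp[of x] x by (simp add: zero_less_divide_iff)
  qed
  then show ?thesis using \<delta> e by blast
qed

lemma y_not_identically_zero:
  assumes that: "z > 0"
  shows "\<not> (\<forall>s\<in>{0..z}. y l s = 0)"
proof
  assume z: "\<forall>s\<in>{0..z}. y l s = 0"
  obtain \<delta> where "\<delta> > 0" "\<forall>x\<in>{0<..\<delta>}. y l x > 0" using positive_near_zero[of l] by force
  then show False using z that by (auto dest!: bspec[of _ _ "min \<delta> z"])
qed

text \<open>Otherwise \<open>y l\<close> is nonnegative and has a zero \<open>z\<close>. If \<open>z = 1\<close>, then \<open>l\<close> is a Dirichlet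
  eigenvalue, and \<open>l \<le> 0\<close> contradicts left-definiteness. If \<open>z < 1\<close>, then \<open>z\<close> is an interior
  minimum, so \<open>y l\<close> and its derivative vanish there; then \<open>A l\<close> and \<open>B l\<close> vanish at \<open>z\<close>, and
  by Gronwall everywhere.\<close>

lemma zero_implies_negative_value:
  assumes ld: "left_definite q" and l: "l \<le> 0" and np: "\<exists>x\<in>{0<..1}. y l x \<le> 0"
  shows "\<exists>x\<in>{0<..1}. y l x < 0"
proof (rule ccontr)
  assume "\<not> ?thesis"
  then have nn1: "\<forall>x\<in>{0<..1}. y l x \<ge> 0" by (meson not_less)
  have nn: "y l x \<ge> 0" if "x \<in> {0..1}" for x
  proof (cases "x = 0")
    case False
    then show ?thesis using nn1 that by auto
  qed (simp add: y0)
  obtain z where z: "z \<in> {0<..1}" "y l z = 0"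
  proof -
    obtain z where z: "z \<in> {0<..1}" "y l z \<le> 0" using np by blast
    then show ?thesis using that[of z] nn[of z] by auto
  qed
  show False
  proof (cases "z = 1")
    case True
    have "dirichlet_nontrivial (y l)"
      using z True y0[of l] y_not_identically_zero[of 1 l] by (auto simp: dirichlet_nontrivial_def)
    then have "l > 0" using ld y_solution[of l] unfolding left_definite_def by blast
    then show False using l by simp
  next
    case False
    then have zi: "z \<in> {0<..<1}" and zc: "z \<in> {0..1}" using z by auto
    have d: "(y l has_real_derivative A l z * L' z + B l z * R' z) (at z)"
      using dy[OF zc, of l] at_within_unit[OF zi] by simp
    have "A l z * L' z + B l z * R' z = 0"
    proof (rule DERIV_local_min[OF d, of "min z (1 - z)"])
      show "0 < min z (1 - z)" using zi by auto
      show "\<forall>t. \<bar>z - t\<bar> < min z (1 - z) \<longrightarrow> y l z \<le> y l t"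
      proof (intro allI impI)
        fix t assume "\<bar>z - t\<bar> < min z (1 - z)"
        then have "t \<in> {0..1}" unfolding abs_less_iff by auto
        then show "y l z \<le> y l t" using nn z(2) by simp
      qed
    qed
    moreover have "A l z * L z + B l z * R z = 0" using z(2) by (simp only: y_def)
    ultimately have AB: "A l z = 0" "B l z = 0" using pair_nonzero[OF zc] by blast+
    obtain M where M: "\<And>x. x \<in> {0..1} \<Longrightarrow> \<bar>L x\<bar> \<le> M \<and> \<bar>R x\<bar> \<le> M"
    proof -
      obtain M1 where M1: "\<And>x. x \<in> {0..1} \<Longrightarrow> \<bar>L x\<bar> \<le> M1" by (rule continuous_on_unit_bounded[OF contL]) blast
      obtain M2 where M2: "\<And>x. x \<in> {0..1} \<Longrightarrow> \<bar>R x\<bar> \<le> M2" by (rule continuous_on_unit_bounded[OF contR]) blast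
      show ?thesis using that[of "max M1 M2"] M1 M2 by (simp add: le_max_iff_disj)
    qed
    have "(A l 0)\<^sup>2 + (B l 0)\<^sup>2 = 0"
    proof (rule gronwall_zero[where d = "\<lambda>x. (A l x)\<^sup>2 + (B l x)\<^sup>2" and a = 0 and b = 1 and c = z
          and K = "4 * \<bar>l\<bar> * M\<^sup>2" and d' = "\<lambda>x. 2 * l * y l x * (B l x * L x - A l x * R x)"])
      fix x :: real assume x: "x \<in> {0..1}"
      show "((\<lambda>x. (A l x)\<^sup>2 + (B l x)\<^sup>2) has_real_derivative 2 * l * y l x * (B l x * L x - A l x * R x))
          (at x within {0..1})"
      proof -
        have "((\<lambda>x. (A l x)\<^sup>2 + (B l x)\<^sup>2) has_real_derivative
            2 * A l x * (- l * R x * (A l x * L x + B l x * R x)) + 2 * B l x * (l * L x * (A l x * L x + B l x * R x)))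
            (at x within {0..1})"
          by (auto intro!: derivative_eq_intros dA[OF x] dB[OF x])
        moreover have "2 * A l x * (- l * R x * (A l x * L x + B l x * R x)) + 2 * B l x * (l * L x * (A l x * L x + B l x * R x))
            = 2 * l * y l x * (B l x * L x - A l x * R x)"
          by (simp add: y_def algebra_simps)
        ultimately show ?thesis by (simp only:)
      qed
      have M0: "0 \<le> M" using M[OF x] by auto
      have s1: "\<bar>u * p + v * w\<bar> \<le> M * (\<bar>u\<bar> + \<bar>v\<bar>)" if "\<bar>p\<bar> \<le> M" "\<bar>w\<bar> \<le> M" for u v p w :: real
      proof -
        have "\<bar>u * p + v * w\<bar> \<le> \<bar>u\<bar> * \<bar>p\<bar> + \<bar>v\<bar> * \<bar>w\<bar>" by (metis abs_mult abs_triangle_ineq)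
        also have "\<dots> \<le> \<bar>u\<bar> * M + \<bar>v\<bar> * M" using that by (intro add_mono mult_left_mono) auto
        finally show ?thesis by (simp add: algebra_simps)
      qed
      have "\<bar>y l x\<bar> \<le> M * (\<bar>A l x\<bar> + \<bar>B l x\<bar>)" unfolding y_def using M[OF x] by (intro s1) auto
      moreover have "\<bar>B l x * L x - A l x * R x\<bar> \<le> M * (\<bar>A l x\<bar> + \<bar>B l x\<bar>)"
        using s1[of "L x" "- R x" "B l x" "A l x"] M[OF x] by (simp add: algebra_simps)
      ultimately have "\<bar>y l x\<bar> * \<bar>B l x * L x - A l x * R x\<bar> \<le> (M * (\<bar>A l x\<bar> + \<bar>B l x\<bar>)) * (M * (\<bar>A l x\<bar> + \<bar>B l x\<bar>))"
        using M0 by (intro mult_mono) auto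
      also have "\<dots> = M\<^sup>2 * (\<bar>A l x\<bar> + \<bar>B l x\<bar>)\<^sup>2" by (simp add: power2_eq_square)
      also have "\<dots> \<le> M\<^sup>2 * (2 * ((A l x)\<^sup>2 + (B l x)\<^sup>2))"
      proof -
        have "(\<bar>A l x\<bar> + \<bar>B l x\<bar>)\<^sup>2 \<le> 2 * ((A l x)\<^sup>2 + (B l x)\<^sup>2)"
          using sum_squares_bound[of "\<bar>A l x\<bar>" "\<bar>B l x\<bar>"] by (simp add: power2_sum)
        then show ?thesis by (intro mult_left_mono) auto
      qed
      finally have "2 * \<bar>l\<bar> * (\<bar>y l x\<bar> * \<bar>B l x * L x - A l x * R x\<bar>) \<le> 2 * \<bar>l\<bar> * (M\<^sup>2 * (2 * ((A l x)\<^sup>2 + (B l x)\<^sup>2)))"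
        by (intro mult_left_mono) auto
      moreover have "2 * \<bar>l\<bar> * (\<bar>y l x\<bar> * \<bar>B l x * L x - A l x * R x\<bar>) = \<bar>2 * l * y l x * (B l x * L x - A l x * R x)\<bar>"
        by (simp add: abs_mult)
      moreover have "2 * \<bar>l\<bar> * (M\<^sup>2 * (2 * ((A l x)\<^sup>2 + (B l x)\<^sup>2))) = 4 * \<bar>l\<bar> * M\<^sup>2 * \<bar>(A l x)\<^sup>2 + (B l x)\<^sup>2\<bar>"
        by simp
      ultimately show "\<bar>2 * l * y l x * (B l x * L x - A l x * R x)\<bar> \<le> 4 * \<bar>l\<bar> * M\<^sup>2 * \<bar>(A l x)\<^sup>2 + (B l x)\<^sup>2\<bar>"
        by (simp only:)
    qed (use AB zc in auto)
    then show False using A0[of l] B0[of l] by simp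
  qed
qed

text \<open>Division by \<open>sqrt G\<close>, where \<open>G = L\<^sup>2 + R\<^sup>2\<close>, removes the potential: for \<open>l = -k\<close> the
  function \<open>u = y / sqrt G\<close> satisfies \<open>(G * u')' = (k * G - 1 / G) * u\<close>. If \<open>k \<ge> 1 / G\<^sup>2\<close> on
  the whole interval, the coefficient on the right is nonnegative, and then \<open>u * (G * u')\<close>
  and \<open>u\<^sup>2\<close> are nondecreasing. These two functions are called \<open>Q\<close> and \<open>E\<close> below. As \<open>u\<close> is
  positive near \<open>0\<close>, it has no zero in \<open>{0<..1}\<close>.\<close>

lemma positive_for_some_negative_parameter: "\<exists>k>0. \<forall>x\<in>{0<..1}. y (-k) x > 0"
proof -
  define G where "G x = (L x)\<^sup>2 + (R x)\<^sup>2" for x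
  have Gpos: "G x > 0" if "x \<in> {0..1}" for x
    using wronskian[OF that] by (auto simp: G_def sum_power2_gt_zero_iff)
  have cG: "continuous_on {0..1} G" unfolding G_def by (intro continuous_intros contL contR)
  obtain x0 where x0: "x0 \<in> {0..1}" "\<And>x. x \<in> {0..1} \<Longrightarrow> G x0 \<le> G x"
    using continuous_attains_inf[OF compact_Icc _ cG] by auto
  \<comment> \<open>\<open>G x0\<close> is the minimum, so this is the largest value of \<open>1 / G\<^sup>2\<close>\<close>
  define k where "k = 1 / (G x0)\<^sup>2"
  have k: "k > 0" using Gpos[OF x0(1)] by (simp add: k_def)
  have kG: "k \<ge> 1 / (G x)\<^sup>2" if "x \<in> {0..1}" for x
    unfolding k_def using x0 Gpos that by (intro divide_left_mono power_mono mult_pos_pos zero_less_power) (auto intro: less_imp_le)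

  have "y (-k) x > 0" if x: "x \<in> {0<..1}" for x
  proof -
    let ?l = "-k"
    define Q where "Q x = y ?l x * N ?l x / G x" for x
    have dG: "(G has_real_derivative 2 * (L x * L' x + R x * R' x)) (at x within {0..1})" if "x \<in> {0..1}" for x
      unfolding G_def by (rule derivative_eq_intros derL derR that refl | simp add: algebra_simps)+
    have dN: "(N ?l has_real_derivative A ?l x * R' x - B ?l x * L' x + k * y ?l x * G x) (at x within {0..1})"
      if "x \<in> {0..1}" for x
      unfolding N_def
      by (rule derivative_eq_intros derL derR dA dB that refl | simp add: y_def G_def algebra_simps power2_eq_square)+
    have W: "L' x * R x - L x * R' x = 1" if "x \<in> {0..1}" for x using wronskian[OF that] by simp
    have id1: "(A ?l x * L' x + B ?l x * R' x) * G x - y ?l x * (L x * L' x + R x * R' x) = N ?l x"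
      if "x \<in> {0..1}" for x
    proof -
      have "(A ?l x * L' x + B ?l x * R' x) * G x - y ?l x * (L x * L' x + R x * R' x)
          = N ?l x * (L' x * R x - L x * R' x)"
        by (simp add: y_def N_def G_def algebra_simps power2_eq_square)
      then show ?thesis using W[OF that] by simp
    qed
    have id2: "(A ?l x * R' x - B ?l x * L' x) * G x - N ?l x * (L x * L' x + R x * R' x) = - y ?l x"
      if "x \<in> {0..1}" for x
    proof -
      have "(A ?l x * R' x - B ?l x * L' x) * G x - N ?l x * (L x * L' x + R x * R' x)
          = - y ?l x * (L' x * R x - L x * R' x)"
        by (simp add: y_def N_def G_def algebra_simps power2_eq_square)
      then show ?thesis using W[OF that] by simp
    qed
    have dQ: "(Q has_real_derivative ((N ?l x)\<^sup>2 + (k * (G x)\<^sup>2 - 1) * (y ?l x)\<^sup>2) / (G x)\<^sup>2) (at x within {0..1})"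
      if x: "x \<in> {0..1}" for x
    proof -
      let ?y' = "A ?l x * L' x + B ?l x * R' x"
      let ?N' = "A ?l x * R' x - B ?l x * L' x + k * y ?l x * G x"
      let ?S = "L x * L' x + R x * R' x"
      have "(Q has_real_derivative ((?y' * N ?l x + ?N' * y ?l x) * G x - y ?l x * N ?l x * (2 * ?S)) / (G x * G x))
          (at x within {0..1})"
        unfolding Q_def using Gpos[OF x] by (intro DERIV_divide DERIV_mult dy dN dG x) auto
      moreover have "(?y' * N ?l x + ?N' * y ?l x) * G x - y ?l x * N ?l x * (2 * ?S)
          = N ?l x * (?y' * G x - y ?l x * ?S) + y ?l x * ((A ?l x * R' x - B ?l x * L' x) * G x - N ?l x * ?S)
            + k * (G x)\<^sup>2 * (y ?l x)\<^sup>2"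
        by (simp add: algebra_simps power2_eq_square)
      moreover have "N ?l x * N ?l x + y ?l x * (- y ?l x) + k * (G x)\<^sup>2 * (y ?l x)\<^sup>2
          = (N ?l x)\<^sup>2 + (k * (G x)\<^sup>2 - 1) * (y ?l x)\<^sup>2"
        by (simp add: algebra_simps power2_eq_square)
      ultimately show ?thesis
        unfolding id1[OF x] id2[OF x] power2_eq_square[of "G x", symmetric] by (simp only:)
    qed
    have Qnn: "Q x \<ge> 0" if x: "x \<in> {0..1}" for x
    proof -
      have "Q 0 \<le> Q x"
      proof (rule nondecreasing_within[OF dQ])
        fix t :: real assume t: "t \<in> {0<..<1}"
        then have t': "t \<in> {0..1}" by auto
        have "k * (G t)\<^sup>2 \<ge> 1" using kG[OF t'] Gpos[OF t'] by (simp add: field_simps)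
        then show "0 \<le> ((N ?l t)\<^sup>2 + (k * (G t)\<^sup>2 - 1) * (y ?l t)\<^sup>2) / (G t)\<^sup>2" by simp
      qed (use x in auto)
      then show ?thesis using y0 by (simp add: Q_def)
    qed
    define E where "E x = (y ?l x)\<^sup>2 / G x" for x
    have dE: "(E has_real_derivative 2 * Q x / G x) (at x within {0..1})" if x: "x \<in> {0..1}" for x
    proof -
      let ?y' = "A ?l x * L' x + B ?l x * R' x"
      let ?S = "L x * L' x + R x * R' x"
      have "((\<lambda>x. (y ?l x)\<^sup>2) has_real_derivative 2 * y ?l x * ?y') (at x within {0..1})"
        by (rule derivative_eq_intros dy x refl | simp)+
      then have "(E has_real_derivative ((2 * y ?l x * ?y') * G x - (y ?l x)\<^sup>2 * (2 * ?S)) / (G x * G x))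
          (at x within {0..1})"
        unfolding E_def using Gpos[OF x] by (intro DERIV_divide dG x) auto
      moreover have "(2 * y ?l x * ?y') * G x - (y ?l x)\<^sup>2 * (2 * ?S) = 2 * y ?l x * (?y' * G x - y ?l x * ?S)"
        by (simp add: algebra_simps power2_eq_square)
      ultimately show ?thesis unfolding id1[OF x] by (simp add: Q_def mult.assoc)
    qed
    have nz: "y ?l z \<noteq> 0" if z: "z \<in> {0<..1}" for z
    proof
      assume yz: "y ?l z = 0"
      have "y ?l s = 0" if s: "s \<in> {0..z}" for s
      proof -
        have "E s \<le> E z"
          by (rule nondecreasing_within[OF dE]) (use s z Qnn Gpos in \<open>auto intro!: divide_nonneg_nonneg less_imp_le[OF Gpos]\<close>)
        then have "(y ?l s)\<^sup>2 / G s \<le> 0" by (simp add: E_def yz)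
        then show ?thesis using Gpos[of s] s z by (simp add: divide_le_0_iff)
      qed
      then show False using y_not_identically_zero[of z ?l] z by auto
    qed
    obtain \<delta> where \<delta>: "\<delta> > 0" "\<forall>x\<in>{0<..\<delta>}. y ?l x > 0" using positive_near_zero[of ?l] by force
    show ?thesis
    proof (rule ccontr)
      assume "\<not> y ?l x > 0"
      then have yx: "y ?l x \<le> 0" by simp
      define a where "a = min \<delta> x"
      have a: "0 < a" "a \<le> x" "y ?l a > 0" using \<delta> x by (auto simp: a_def)
      have "\<exists>z\<ge>a. z \<le> x \<and> y ?l z = 0"
        using a yx x by (intro IVT2' continuous_on_subset[OF y_continuous]) auto
      then show False using nz a x by force
    qed
  qed

  then show ?thesis using k by blast
qed

text \<open>Among the parameters \<open>l \<in> {-k..0}\<close> those for which \<open>y l\<close> is positive on \<open>{0<..1}\<close> form a set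
  that is open, by uniform continuity and the uniform positivity near \<open>0\<close>, and whose
  complement is open as well, because a solution that fails to be positive has a strictly
  negative value. By connectedness the property passes from \<open>-k\<close> to \<open>0\<close>, and \<open>y 0 = L\<close>.\<close>

lemma left_definite_imp_pos:
  assumes ld: "left_definite q" and x: "x \<in> {0<..1}"
  shows "L x > 0"
proof -
  obtain k where k: "k > 0" and large: "\<And>x. x \<in> {0<..1} \<Longrightarrow> y (-k) x > 0" using positive_for_some_negative_parameter by blast
  have "(\<forall>x\<in>{0<..1}. y (-k) x > 0) = (\<forall>x\<in>{0<..1}. y 0 x > 0)"
  proof (rule connected_local_const[where f = "\<lambda>l. \<forall>x\<in>{0<..1}. y l x > 0" and A = "{-k..0}"])
    show "\<forall>a\<in>{-k..0}. \<forall>\<^sub>F b in at a within {-k..0}.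
        (\<forall>x\<in>{0<..1}. y a x > 0) = (\<forall>x\<in>{0<..1}. y b x > 0)"
    proof
      fix a assume a: "a \<in> {-k..0}"
      have sub: "{-k..0} \<subseteq> {-k..k}" using k by auto
      show "\<forall>\<^sub>F b in at a within {-k..0}. (\<forall>x\<in>{0<..1}. y a x > 0) = (\<forall>x\<in>{0<..1}. y b x > 0)"
      proof (cases "\<forall>x\<in>{0<..1}. y a x > 0")
        case True
        obtain \<delta> e where \<delta>: "\<delta> > 0" "e > 0" "\<delta> \<le> 1" "\<And>l x. \<bar>l - a\<bar> < e \<Longrightarrow> x \<in> {0<..\<delta>} \<Longrightarrow> y l x > 0"
          using positive_near_zero[of a] by metis
        have "continuous_on {\<delta>..1} (y a)" using \<delta> by (intro continuous_on_subset[OF y_continuous]) auto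
        then obtain z where z: "z \<in> {\<delta>..1}" "\<And>x. x \<in> {\<delta>..1} \<Longrightarrow> y a z \<le> y a x"
          using continuous_attains_inf[OF compact_Icc, of \<delta> 1 "y a"] \<delta> by auto
        have m: "y a z > 0" using True z \<delta> by auto
        have "uniformly_continuous_on ({-k..k} \<times> {0..1}) (\<lambda>(l, x). y l x)"
          by (intro compact_uniformly_continuous y_jointly_continuous compact_Times compact_Icc)
        from this[unfolded uniformly_continuous_on_def, rule_format, OF m]
        obtain d where d: "d > 0" "\<And>u v. u \<in> {-k..k} \<times> {0..1} \<Longrightarrow> v \<in> {-k..k} \<times> {0..1} \<Longrightarrow> dist u v < d \<Longrightarrow>
            dist (case u of (l, x) \<Rightarrow> y l x) (case v of (l, x) \<Rightarrow> y l x) < y a z"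
          by blast
        have "y b x > 0" if b: "b \<in> {-k..0}" "dist b a < min d e" and x: "x \<in> {0<..1}" for b x
        proof (cases "x \<le> \<delta>")
          case True
          then show ?thesis using \<delta>(4)[of b x] b x by (auto simp: dist_real_def)
        next
          case False
          have "dist (y b x) (y a x) < y a z"
            using d(2)[of "(b, x)" "(a, x)"] b a x sub by (auto simp: dist_Pair_Pair)
          moreover have "y a z \<le> y a x" using z(2)[of x] False x by auto
          ultimately show ?thesis by (auto simp: dist_real_def)
        qed
        then show ?thesis using True d(1) \<delta>(2)
          unfolding eventually_at by (intro exI[of _ "min d e"]) auto
      next
        case False
        then obtain x where x: "x \<in> {0<..1}" "y a x < 0" using zero_implies_negative_value[OF ld, of a] a by force
        have "continuous_on {-k..k} (\<lambda>l. y l x)"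
          using continuous_on_compose2[OF y_jointly_continuous[of k], of "{-k..k}" "\<lambda>l. (l, x)"] x
          by (simp add: continuous_on_Pair image_subset_iff)
        from this[unfolded continuous_on_iff, rule_format, of a "- y a x"]
        obtain d where d: "d > 0" "\<And>b. b \<in> {-k..k} \<Longrightarrow> dist b a < d \<Longrightarrow> dist (y b x) (y a x) < - y a x"
          using x(2) a sub by auto
        have "y b x < 0" if "b \<in> {-k..0}" "dist b a < d" for b
          using d(2)[of b] that sub by (auto simp: dist_real_def)
        then have "\<not> (\<forall>x\<in>{0<..1}. y b x > 0)" if "b \<in> {-k..0}" "dist b a < d" for b
          using that x(1) by (metis less_asym)
        then show ?thesis using False d(1) unfolding eventually_at by (intro exI[of _ d]) blast
      qed
    qed
  qed (use k in auto)
  then have "y 0 x > 0" using large x by blast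
  moreover have "y 0 x = L x"
  proof -
    have "\<And>t. t \<in> {0..1} \<Longrightarrow> (A 0 has_real_derivative 0) (at t within {0..1})"
      "\<And>t. t \<in> {0..1} \<Longrightarrow> (B 0 has_real_derivative 0) (at t within {0..1})"
      using dA[where l = 0] dB[where l = 0] by auto
    then obtain c d where "\<And>t. t \<in> {0..1} \<Longrightarrow> A 0 t = c" "\<And>t. t \<in> {0..1} \<Longrightarrow> B 0 t = d"
      using has_field_derivative_zero_constant[of "{0..1::real}" "A 0"] has_field_derivative_zero_constant[of "{0..1::real}" "B 0"]
      by auto
    then have "A 0 x = A 0 0" "B 0 x = B 0 0" using x by auto
    then show ?thesis by (simp add: y_def A0 B0)
  qed
  ultimately show ?thesis by simp
qed

end

context fundamental_pair
begin

lemma left_definite_imp_L_pos: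
  assumes "left_definite q" "x \<in> {0<..1}"
  shows "L x > 0"
proof -
  obtain A B where "spectral_family q L R L' R' A B" by (rule spectral_family_exists)
  then interpret spectral_family q L R L' R' A B .
  show ?thesis by (rule left_definite_imp_pos[OF assms])
qed

text \<open>The quotient \<open>R / L\<close> has the derivative \<open>-1 / L\<^sup>2\<close> and the value \<open>0\<close> at \<open>1\<close>.\<close>

lemma left_definite_imp_R_pos:
  assumes ld: "left_definite q" and x: "x \<in> {0..<1}"
  shows "R x > 0"
proof (cases "x = 0")
  case True
  then show ?thesis using R0_pos by simp
next
  case False
  then have x01: "0 < x" "x < 1" using x by auto
  have Lp: "L s > 0" if "s \<in> {x..1}" for s using left_definite_imp_L_pos[OF ld, of s] that x01 by auto
  have "- (R x / L x) < - (R 1 / L 1)"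
  proof (rule DERIV_pos_imp_increasing_open[OF x01(2)])
    fix s assume s: "x < s" "s < 1"
    then have s01: "s \<in> {0<..<1}" using x01 by auto
    have "((\<lambda>s. - (R s / L s)) has_real_derivative - ((R' s * L s - R s * L' s) / (L s * L s))) (at s)"
      using Lp[of s] s by (intro DERIV_minus DERIV_divide derR_at derL_at s01) auto
    moreover have "R' s * L s - R s * L' s = -1" using wronskian[of s] s01 by (simp add: algebra_simps)
    ultimately have "((\<lambda>s. - (R s / L s)) has_real_derivative 1 / (L s * L s)) (at s)" by simp
    then show "\<exists>d. ((\<lambda>s. - (R s / L s)) has_real_derivative d) (at s) \<and> 0 < d"
      using Lp[of s] s by (intro exI[of _ "1 / (L s * L s)"]) auto
  next
    have sub: "{x..1} \<subseteq> {0..1}" using x01 by auto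
    show "continuous_on {x..1} (\<lambda>s. - (R s / L s))"
      using Lp by (intro continuous_intros continuous_on_subset[OF contL sub] continuous_on_subset[OF contR sub]) force
  qed
  then show ?thesis using R1 Lp[of x] x01 by (simp add: zero_less_divide_iff)
qed

end

section \<open>Green's function and point masses\<close>

lemma abs_continuous_on_sum:
  assumes "finite P" "\<And>s. s \<in> P \<Longrightarrow> abs_continuous_on S (f s)"
  shows "abs_continuous_on S (\<lambda>x. \<Sum>s\<in>P. k s * f s x)"
  using assms
proof (induction P)
  case empty
  show ?case by (rule abs_continuous_on_lipschitz[of _ _ 0]) simp
next
  case (insert p P)
  have "abs_continuous_on S (\<lambda>x. k p * f p x)"
  proof (rule abs_continuous_on_dominated[of S "f p" "f p" _ "\<bar>k p\<bar>"])
    fix a b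
    show "\<bar>k p * f p b - k p * f p a\<bar> \<le> \<bar>k p\<bar> * (\<bar>f p b - f p a\<bar> + \<bar>f p b - f p a\<bar>)"
      unfolding right_diff_distrib[symmetric] abs_mult by (intro mult_left_mono) auto
  qed (use insert in auto)
  then show ?case using insert by (auto intro!: abs_continuous_on_add)
qed

lemma consecutive_below:
  fixes x :: real
  assumes "finite Q" "a \<in> Q" "a < x"
  obtains p where "p \<in> Q" "p < x" "{p<..<x} \<inter> Q = {}"
proof -
  define p where "p = Max {p\<in>Q. p < x}"
  have fin: "finite {p\<in>Q. p < x}" "{p\<in>Q. p < x} \<noteq> {}" using assms by auto
  have p: "p \<in> Q" "p < x" using Max_in[OF fin] unfolding p_def by auto
  have "y \<le> p" if "y \<in> Q" "y < x" for y using Max_ge[OF fin(1), of y] that unfolding p_def by auto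
  then have "{p<..<x} \<inter> Q = {}" by fastforce
  then show ?thesis using that p by blast
qed

lemma consecutive_above:
  fixes x :: real
  assumes "finite Q" "b \<in> Q" "x < b"
  obtains p where "p \<in> Q" "x < p" "{x<..<p} \<inter> Q = {}"
proof -
  define p where "p = Min {p\<in>Q. x < p}"
  have fin: "finite {p\<in>Q. x < p}" "{p\<in>Q. x < p} \<noteq> {}" using assms by auto
  have p: "p \<in> Q" "x < p" using Min_in[OF fin] unfolding p_def by auto
  have "p \<le> y" if "y \<in> Q" "x < y" for y using Min_le[OF fin(1), of y] that unfolding p_def by auto
  then have "{x<..<p} \<inter> Q = {}" by fastforce
  then show ?thesis using that p by blast
qed

lemma consecutive_avoid: "consecutive Q a b \<Longrightarrow> s \<in> Q \<Longrightarrow> s \<le> a \<or> b \<le> s"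
  by (force simp: consecutive_def)

text \<open>Because of the normalization of the Wronskian this is Green's function of \<open>-y'' + q * y\<close>
  with Dirichlet conditions.\<close>

definition Green :: "(real \<Rightarrow> real) \<Rightarrow> (real \<Rightarrow> real) \<Rightarrow> real \<Rightarrow> real \<Rightarrow> real" where
  "Green L R s x = L (min s x) * R (max s x)"

context fundamental_pair
begin

abbreviation "G \<equiv> Green L R"

lemma combination_derivative:
  "x \<in> {0..1} \<Longrightarrow> ((\<lambda>x. c * L x + d * R x) has_real_derivative c * L' x + d * R' x) (at x within {0..1})"
  by (auto intro!: derivative_eq_intros derL derR)

lemma combination_derivative_left:
  assumes "0 \<le> a" "a < x" "x \<le> 1" "\<And>t. t \<in> {a..x} \<Longrightarrow> y t = c * L t + d * R t"
  shows "(y has_real_derivative c * L' x + d * R' x) (at_left x)"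
proof -
  have "((\<lambda>x. c * L x + d * R x) has_real_derivative c * L' x + d * R' x) (at x within {a..x})"
    using assms by (intro DERIV_subset[OF combination_derivative]) auto
  then have "(y has_real_derivative c * L' x + d * R' x) (at x within {a..x})"
    by (rule has_field_derivative_transform_within[of _ _ _ _ 1]) (use assms in auto)
  then show ?thesis using assms by (simp add: at_within_Icc_at_left)
qed

lemma combination_derivative_right:
  assumes "0 \<le> x" "x < b" "b \<le> 1" "\<And>t. t \<in> {x..b} \<Longrightarrow> y t = c * L t + d * R t"
  shows "(y has_real_derivative c * L' x + d * R' x) (at_right x)"
proof -
  have "((\<lambda>x. c * L x + d * R x) has_real_derivative c * L' x + d * R' x) (at x within {x..b})"
    using assms by (intro DERIV_subset[OF combination_derivative]) auto
  then have "(y has_real_derivative c * L' x + d * R' x) (at x within {x..b})"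
    by (rule has_field_derivative_transform_within[of _ _ _ _ 1]) (use assms in auto)
  then show ?thesis using assms by (simp add: at_within_Icc_at_right)
qed

lemma combination_unique:
  assumes "0 \<le> a" "a < b" "b \<le> 1" "\<And>x. x \<in> {a..b} \<Longrightarrow> c * L x + d * R x = c' * L x + d' * R x"
  shows "c = c'" "d = d'"
proof -
  have x: "b \<in> {0..1}" using assms by auto
  have "((\<lambda>x. c * L x + d * R x) has_real_derivative c' * L' b + d' * R' b) (at_left b)"
    by (rule combination_derivative_left[of a]) (use assms in auto)
  moreover have "((\<lambda>x. c * L x + d * R x) has_real_derivative c * L' b + d * R' b) (at_left b)"
    by (rule combination_derivative_left[of a]) (use assms in auto)
  ultimately have "c' * L' b + d' * R' b = c * L' b + d * R' b"
    using vector_derivative_unique_within[OF trivial_limit_at_left_real]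
    by (metis has_real_derivative_iff_has_vector_derivative)
  moreover have "c * L b + d * R b = c' * L b + d' * R b" using assms by auto
  ultimately show "c = c'" "d = d'"
    using pair_nonzero[OF x, of "c - c'" "d - d'"] by (auto simp: algebra_simps)
qed

text \<open>Behind the point mass \<open>y\<close> differs from its continuation by \<open>-K\<close> times the solution
  \<open>R x * L - L x * R\<close>, which vanishes at \<open>x\<close> and has slope \<open>1\<close> there.\<close>

lemma jump_relation:
  assumes a: "0 \<le> a" "a < x" "x < b" "b \<le> 1"
    and left: "\<And>t. t \<in> {a..x} \<Longrightarrow> y t = c * L t + d * R t"
    and right: "\<And>t. t \<in> {x..b} \<Longrightarrow> y t = c' * L t + d' * R t"
    and jump: "(y has_real_derivative dl) (at_left x)" "(y has_real_derivative dr) (at_right x)" "dl - dr = K"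
  shows "c' = c - K * R x" "d' = d + K * L x"
proof -
  have x: "x \<in> {0..1}" using a by auto
  have "(y has_real_derivative c * L' x + d * R' x) (at_left x)"
    by (rule combination_derivative_left[of a]) (use a left in auto)
  then have dl: "dl = c * L' x + d * R' x"
    using jump(1) vector_derivative_unique_within[OF trivial_limit_at_left_real]
    by (metis has_real_derivative_iff_has_vector_derivative)
  have "(y has_real_derivative c' * L' x + d' * R' x) (at_right x)"
    by (rule combination_derivative_right[of _ b]) (use a right in auto)
  then have dr: "dr = c' * L' x + d' * R' x"
    using jump(2) vector_derivative_unique_within[OF trivial_limit_at_right_real]
    by (metis has_real_derivative_iff_has_vector_derivative)
  have "c * L x + d * R x = c' * L x + d' * R x" using left[of x] right[of x] a by auto
  then have e1: "(c - K * R x - c') * L x + (d + K * L x - d') * R x = 0" by (simp add: algebra_simps)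
  have "(c - K * R x - c') * L' x + (d + K * L x - d') * R' x = (dl - dr) + K * (L x * R' x - L' x * R x)"
    unfolding dl dr by (simp add: algebra_simps)
  also have "\<dots> = 0" unfolding wronskian[OF x] jump(3) by simp
  finally show "c' = c - K * R x" "d' = d + K * L x" using pair_nonzero[OF x e1] by auto
qed

lemma solution_piece:
  assumes sol: "delta_solution q P \<kappa> y" and ab: "consecutive (P \<union> {0, 1}) a b" and P: "P \<subseteq> {0<..<1}"
  obtains c d where "\<And>t. t \<in> {a..b} \<Longrightarrow> y t = c * L t + d * R t"
proof -
  have "a \<in> P \<union> {0, 1}" "b \<in> P \<union> {0, 1}" "a < b" using ab by (auto simp: consecutive_def)
  then have ab': "0 \<le> a" "a < b" "b \<le> 1" using P by (auto simp: subset_iff)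
  have ac: "abs_continuous_on {0..1} y" using sol by (simp add: delta_solution_def)
  obtain c d where cd: "\<And>x. x \<in> {a<..<b} \<Longrightarrow> y x = c * L x + d * R x \<and> deriv y x = c * L' x + d * R' x"
  proof (rule solution_is_combination[of a b y])
    show "{a<..<b} \<subseteq> {0<..<1}" using ab' by auto
  qed (use sol ab ab' in \<open>auto simp: delta_solution_def\<close>)
  have cont: "continuous_on {0..1} y"
    using abs_continuous_on_imp_uniformly_continuous[OF ac] uniformly_continuous_imp_continuous
    by (auto simp: is_interval_cc)
  have sub: "{a..b} \<subseteq> {0..1}" using ab' by auto
  have "continuous_on (closure {a<..<b}) (\<lambda>t. y t - (c * L t + d * R t))"
    using ab' by (auto intro!: continuous_intros continuous_on_subset[OF cont sub]
        continuous_on_subset[OF contL sub] continuous_on_subset[OF contR sub])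
  then have "y t - (c * L t + d * R t) = 0" if "t \<in> {a..b}" for t
    using continuous_constant_on_closure[of "{a<..<b}" "\<lambda>t. y t - (c * L t + d * R t)" 0 t] cd that ab' by auto
  then show ?thesis by (intro that[of c d]) (simp add: algebra_simps)
qed

lemma Green_piece:
  assumes "finite P" "\<And>s. s \<in> P \<Longrightarrow> s \<le> a \<or> b \<le> s" and t: "t \<in> {a..b}"
  shows "(\<Sum>s\<in>P. k s * G s t) = (\<Sum>s\<in>{s\<in>P. b \<le> s}. k s * R s) * L t + (\<Sum>s\<in>{s\<in>P. \<not> b \<le> s}. k s * L s) * R t"
proof -
  have "P = {s\<in>P. b \<le> s} \<union> {s\<in>P. \<not> b \<le> s}" by auto
  then have "(\<Sum>s\<in>P. k s * G s t) = (\<Sum>s\<in>{s\<in>P. b \<le> s}. k s * G s t) + (\<Sum>s\<in>{s\<in>P. \<not> b \<le> s}. k s * G s t)"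
    using assms(1) by (metis (no_types, lifting) sum.union_disjoint finite_Un disjoint_iff mem_Collect_eq)
  also have "(\<Sum>s\<in>{s\<in>P. b \<le> s}. k s * G s t) = (\<Sum>s\<in>{s\<in>P. b \<le> s}. k s * R s * L t)"
    using t by (intro sum.cong) (auto simp: Green_def)
  also have "(\<Sum>s\<in>{s\<in>P. \<not> b \<le> s}. k s * G s t) = (\<Sum>s\<in>{s\<in>P. \<not> b \<le> s}. k s * L s * R t)"
    using t assms(2) by (intro sum.cong) (force simp: Green_def)+
  finally show ?thesis by (simp add: sum_distrib_right)
qed

text \<open>Subtract from \<open>y\<close> the Green's functions that carry its jumps. The difference \<open>z\<close> is a
  combination of \<open>L\<close> and \<open>R\<close> on each side of every node, with matching values and
  derivatives. So its two coefficients are locally constant on \<open>{0<..<1}\<close>, hence constant,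
  and the boundary conditions make them vanish.\<close>

lemma Green_representation:
  assumes sol: "delta_solution q P \<kappa> y" and P: "finite P" "P \<subseteq> {0<..<1}"
    and bc: "y 0 = 0" "y 1 = 0" and L1: "L 1 \<noteq> 0" and x: "x \<in> {0..1}"
  shows "y x = (\<Sum>s\<in>P. \<kappa> s * y s * G s x)"
proof -
  define Q where "Q = P \<union> {0, 1}"
  have Q: "finite Q" "0 \<in> Q" "1 \<in> Q" using P by (auto simp: Q_def)
  have Q01: "0 \<le> s \<and> s \<le> 1" if "s \<in> Q" for s using that P(2) by (fastforce simp: Q_def)
  define z where "z x = y x - (\<Sum>s\<in>P. \<kappa> s * y s * G s x)" for x
  have piece: "\<exists>c d. \<forall>t\<in>{a..b}. z t = c * L t + d * R t" if ab: "consecutive Q a b" for a b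
  proof -
    obtain c d where cd: "\<And>t. t \<in> {a..b} \<Longrightarrow> y t = c * L t + d * R t"
      using solution_piece[OF sol ab[unfolded Q_def] P(2)] by blast
    have av: "s \<le> a \<or> b \<le> s" if "s \<in> P" for s using consecutive_avoid[OF ab, of s] that by (auto simp: Q_def)
    have gp: "(\<Sum>s\<in>P. \<kappa> s * y s * G s t) = (\<Sum>s\<in>{s\<in>P. b \<le> s}. \<kappa> s * y s * R s) * L t
        + (\<Sum>s\<in>{s\<in>P. \<not> b \<le> s}. \<kappa> s * y s * L s) * R t" if "t \<in> {a..b}" for t
      by (rule Green_piece[OF P(1) _ that]) (rule av)
    have "z t = (c - (\<Sum>s\<in>{s\<in>P. b \<le> s}. \<kappa> s * y s * R s)) * L t + (d - (\<Sum>s\<in>{s\<in>P. \<not> b \<le> s}. \<kappa> s * y s * L s)) * R t"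
      if "t \<in> {a..b}" for t
      unfolding z_def using cd[OF that] gp[OF that] by (simp add: algebra_simps)
    then show ?thesis by blast
  qed
  have loc: "\<exists>a b c d. 0 \<le> a \<and> a < x \<and> x < b \<and> b \<le> 1 \<and> (\<forall>t\<in>{a..b}. z t = c * L t + d * R t)"
    if x: "x \<in> {0<..<1}" for x
  proof -
    obtain a where a: "a \<in> Q" "a < x" "{a<..<x} \<inter> Q = {}"
      using consecutive_below[OF Q(1,2), of x] x by auto
    obtain b where b: "b \<in> Q" "x < b" "{x<..<b} \<inter> Q = {}"
      using consecutive_above[OF Q(1,3), of x] x by auto
    show ?thesis
    proof (cases "x \<in> Q")
      case False
      have "{a<..<b} = {a<..<x} \<union> {x} \<union> {x<..<b}" using a(2) b(2) by auto
      then have "consecutive Q a b" using a b False by (auto simp: consecutive_def)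
      then show ?thesis using piece[of a b] a b Q01 by meson
    next
      case True
      then have xP: "x \<in> P" using x by (auto simp: Q_def)
      have cax: "consecutive Q a x" and cxb: "consecutive Q x b" using a b True by (auto simp: consecutive_def)
      obtain c1 d1 where cd1: "\<And>t. t \<in> {a..x} \<Longrightarrow> y t = c1 * L t + d1 * R t"
        using solution_piece[OF sol cax[unfolded Q_def] P(2)] by blast
      obtain c2 d2 where cd2: "\<And>t. t \<in> {x..b} \<Longrightarrow> y t = c2 * L t + d2 * R t"
        using solution_piece[OF sol cxb[unfolded Q_def] P(2)] by blast
      obtain dl dr where j: "(y has_real_derivative dl) (at_left x)" "(y has_real_derivative dr) (at_right x)"
        "dl - dr = \<kappa> x * y x"
        using sol xP unfolding delta_solution_def by blast
      have c2: "c2 = c1 - \<kappa> x * y x * R x" and d2: "d2 = d1 + \<kappa> x * y x * L x"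
        using jump_relation[of a x b y c1 d1 c2 d2, OF _ a(2) b(2) _ cd1 cd2 j] Q01 a(1) b(1) by auto
      have av: "s \<le> a \<or> b \<le> s" if "s \<in> P - {x}" for s
        using consecutive_avoid[OF cax, of s] consecutive_avoid[OF cxb, of s] that by (auto simp: Q_def)
      define C where "C = (\<Sum>s\<in>{s\<in>P - {x}. b \<le> s}. \<kappa> s * y s * R s)"
      define D where "D = (\<Sum>s\<in>{s\<in>P - {x}. \<not> b \<le> s}. \<kappa> s * y s * L s)"
      have gp: "(\<Sum>s\<in>P - {x}. \<kappa> s * y s * G s t) = C * L t + D * R t" if "t \<in> {a..b}" for t
        unfolding C_def D_def by (rule Green_piece[OF _ _ that]) (use P av in auto)
      have sm: "(\<Sum>s\<in>P. \<kappa> s * y s * G s t) = \<kappa> x * y x * G x t + (C * L t + D * R t)" if "t \<in> {a..b}" for t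
        unfolding gp[OF that, symmetric] by (rule sum.remove[OF P(1) xP])
      have "z t = (c1 - \<kappa> x * y x * R x - C) * L t + (d1 - D) * R t" if t: "t \<in> {a..b}" for t
      proof (cases "t \<le> x")
        case True
        then have "G x t = L t * R x" by (simp add: Green_def)
        then show ?thesis using cd1[of t] sm[OF t] t True by (simp add: z_def algebra_simps)
      next
        case False
        then have "G x t = L x * R t" by (simp add: Green_def)
        then show ?thesis using cd2[of t] sm[OF t] t False by (simp add: z_def c2 d2 algebra_simps)
      qed
      then show ?thesis using a b Q01 by meson
    qed
  qed
  \<comment> \<open>the coefficients of \<open>z\<close> near \<open>x\<close>, which are unique because \<open>L\<close> and \<open>R\<close> are independent on intervals\<close>
  define f where "f x = (SOME p. \<forall>\<^sub>F t in nhds x. z t = fst p * L t + snd p * R t)" for x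
  have uniq: "p = p'" if "x \<in> {0<..<1}" "\<forall>\<^sub>F t in nhds x. z t = fst p * L t + snd p * R t"
    "\<forall>\<^sub>F t in nhds x. z t = fst p' * L t + snd p' * R t" for x and p p' :: "real \<times> real"
  proof -
    have "\<forall>\<^sub>F t in nhds x. fst p * L t + snd p * R t = fst p' * L t + snd p' * R t"
      using that(2,3) by eventually_elim auto
    then obtain e where e: "e > 0" "\<And>t. dist t x < e \<Longrightarrow> fst p * L t + snd p * R t = fst p' * L t + snd p' * R t"
      unfolding eventually_nhds_metric by blast
    define b where "b = min (x + e / 2) 1"
    have b: "x < b" "b \<le> 1" "b \<le> x + e / 2" using that(1) e(1) by (auto simp: b_def)
    have "dist t x < e" if "t \<in> {x..b}" for t using that b e(1) by (auto simp: dist_real_def)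
    then have "fst p = fst p'" "snd p = snd p'"
      using combination_unique[of x b "fst p" "snd p" "fst p'" "snd p'"] b that(1) e(2) by auto
    then show ?thesis by (simp add: prod_eq_iff)
  qed
  have f_eq: "f x = p" if "x \<in> {0<..<1}" "\<forall>\<^sub>F t in nhds x. z t = fst p * L t + snd p * R t" for x p
    unfolding f_def by (rule uniq[OF that(1) _ that(2)]) (rule someI[of _ p], rule that(2))
  have loc': "\<exists>p. \<forall>\<^sub>F t in nhds x. z t = fst p * L t + snd p * R t" if x: "x \<in> {0<..<1}" for x
  proof -
    obtain a b c d where *: "a < x" "x < b" "\<forall>t\<in>{a..b}. z t = c * L t + d * R t" using loc[OF x] by blast
    have "\<forall>\<^sub>F t in nhds x. t \<in> {a<..<b}" using * by (intro eventually_nhds_in_open) auto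
    then have "\<forall>\<^sub>F t in nhds x. z t = fst (c, d) * L t + snd (c, d) * R t"
      by eventually_elim (use * in auto)
    then show ?thesis by blast
  qed
  have fconst: "f s = f t" if "s \<in> {0<..<1}" "t \<in> {0<..<1}" for s t
  proof (rule connected_local_const[OF _ that])
    show "\<forall>a\<in>{0<..<1}. \<forall>\<^sub>F b in at a within {0<..<1}. f a = f b"
    proof
      fix a :: real assume a: "a \<in> {0<..<1}"
      obtain p where p: "\<forall>\<^sub>F t in nhds a. z t = fst p * L t + snd p * R t" using loc'[OF a] by blast
      have "\<forall>\<^sub>F b in nhds a. b \<in> {0<..<1}" using a by (intro eventually_nhds_in_open) auto
      moreover have "\<forall>\<^sub>F b in nhds a. \<forall>\<^sub>F t in nhds b. z t = fst p * L t + snd p * R t"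
        using p by (simp only: eventually_eventually)
      ultimately have "\<forall>\<^sub>F b in nhds a. f a = f b"
        by eventually_elim (use f_eq[OF a p] f_eq in auto)
      then show "\<forall>\<^sub>F b in at a within {0<..<1}. f a = f b"
        unfolding eventually_at_filter by (rule eventually_mono) simp
    qed
  qed auto
  define p where "p = f (1 / 2)"
  have p: "f s = p" if "s \<in> {0<..<1}" for s using fconst[OF that, of "1 / 2"] by (simp add: p_def)
  have zin: "z s = fst p * L s + snd p * R s" if s: "s \<in> {0<..<1}" for s
  proof -
    obtain p' where p': "\<forall>\<^sub>F t in nhds s. z t = fst p' * L t + snd p' * R t" using loc'[OF s] by blast
    then have "p' = p" using f_eq[OF s p'] p[OF s] by simp
    then show ?thesis using eventually_nhds_x_imp_x[OF p'] by simp
  qed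
  obtain b where b: "b \<in> Q" "0 < b" "{0<..<b} \<inter> Q = {}" using consecutive_above[OF Q(1,3), of 0] by auto
  have c0b: "consecutive Q 0 b" using b Q by (auto simp: consecutive_def)
  obtain a where a: "a \<in> Q" "a < 1" "{a<..<1} \<inter> Q = {}" using consecutive_below[OF Q(1,2), of 1] by auto
  have ca1: "consecutive Q a 1" using a Q by (auto simp: consecutive_def)
  have close: "fst p = c \<and> snd p = d" if "0 \<le> a" "a < b" "b \<le> 1" "\<forall>t\<in>{a..b}. z t = c * L t + d * R t" for a b c d
  proof -
    have "fst p * L t + snd p * R t = c * L t + d * R t" if "t \<in> {(2 * a + b) / 3..(a + 2 * b) / 3}" for t
      using zin[of t] \<open>0 \<le> a\<close> \<open>a < b\<close> \<open>b \<le> 1\<close> \<open>\<forall>t\<in>{a..b}. z t = c * L t + d * R t\<close> that by (auto simp: field_simps)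
    then show ?thesis
      using combination_unique[of "(2 * a + b) / 3" "(a + 2 * b) / 3" "fst p" "snd p" c d] that(1-3) by auto
  qed
  have G0: "G s 0 = 0" "G s 1 = 0" if "s \<in> P" for s
    using that P(2) L0 R1 by (auto simp: Green_def min_def max_def)
  have z0: "z 0 = 0" "z 1 = 0" using bc G0 by (simp_all add: z_def)
  have "snd p = 0"
  proof -
    obtain c d where cd: "\<forall>t\<in>{0..b}. z t = c * L t + d * R t" using piece[OF c0b] by blast
    then have "fst p = c \<and> snd p = d" using close[of 0 b c d] b Q01 by auto
    moreover have "d * R 0 = 0" using bspec[OF cd, of 0] b z0 L0 by simp
    ultimately show ?thesis using R0_pos by simp
  qed
  moreover have "fst p = 0"
  proof -
    obtain c d where cd: "\<forall>t\<in>{a..1}. z t = c * L t + d * R t" using piece[OF ca1] by blast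
    then have "fst p = c \<and> snd p = d" using close[of a 1 c d] a Q01 by auto
    moreover have "c * L 1 = 0" using bspec[OF cd, of 1] a z0 R1 by simp
    ultimately show ?thesis using L1 by simp
  qed
  ultimately have "z x = 0" using zin[of x] z0 x by (cases "x = 0"; cases "x = 1") auto
  then show ?thesis by (simp add: z_def)
qed

lemma lipschitz_pair:
  obtains K where "\<And>a b. a \<in> {0..1} \<Longrightarrow> b \<in> {0..1} \<Longrightarrow> \<bar>L b - L a\<bar> \<le> K * \<bar>b - a\<bar> \<and> \<bar>R b - R a\<bar> \<le> K * \<bar>b - a\<bar>"
proof -
  have bd: "\<exists>K. \<forall>x\<in>{0..1}. \<bar>f x\<bar> \<le> K" if ac: "abs_continuous_on {0<..<1} f" for f :: "real \<Rightarrow> real"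
  proof -
    have "bounded (f ` {0<..<1})" by (rule abs_continuous_on_imp_bounded[OF ac]) (auto simp: is_interval_oo)
    then obtain K where "\<forall>u\<in>f ` {0<..<1}. norm u \<le> K" unfolding bounded_iff by blast
    then have K: "\<And>x. x \<in> {0<..<1} \<Longrightarrow> \<bar>f x\<bar> \<le> K" by auto
    have "\<bar>f x\<bar> \<le> \<bar>K\<bar> + \<bar>f 0\<bar> + \<bar>f 1\<bar>" if "x \<in> {0..1}" for x
      using K[of x] that by (cases "x = 0"; cases "x = 1") auto
    then show ?thesis by blast
  qed
  obtain K1 where K1: "\<And>x. x \<in> {0..1} \<Longrightarrow> \<bar>L' x\<bar> \<le> K1" using bd[OF acL'] by blast
  obtain K2 where K2: "\<And>x. x \<in> {0..1} \<Longrightarrow> \<bar>R' x\<bar> \<le> K2" using bd[OF acR'] by blast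
  have "\<bar>L b - L a\<bar> \<le> max K1 K2 * \<bar>b - a\<bar> \<and> \<bar>R b - R a\<bar> \<le> max K1 K2 * \<bar>b - a\<bar>"
    if "a \<in> {0..1}" "b \<in> {0..1}" for a b
    using field_differentiable_bound[of "{0..1}" L L' "max K1 K2" b a]
      field_differentiable_bound[of "{0..1}" R R' "max K1 K2" b a] derL derR K1 K2 that
    by (auto simp: le_max_iff_disj)
  then show ?thesis using that by blast
qed

text \<open>The kinks of \<open>min s\<close> and \<open>max s\<close> are harmless: both are Lipschitz, and so are \<open>L\<close> and \<open>R\<close>.\<close>

lemma ac_Green:
  assumes s: "s \<in> {0<..<1}"
  shows "abs_continuous_on {0..1} (G s)"
proof -
  obtain K where K: "\<And>a b. a \<in> {0..1} \<Longrightarrow> b \<in> {0..1} \<Longrightarrow> \<bar>L b - L a\<bar> \<le> K * \<bar>b - a\<bar> \<and> \<bar>R b - R a\<bar> \<le> K * \<bar>b - a\<bar>"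
    using lipschitz_pair by blast
  have K0: "K \<ge> 0" using K[of 0 1] by auto
  have acmin: "abs_continuous_on {0..1} (\<lambda>x. L (min s x))"
  proof (rule abs_continuous_on_lipschitz[of _ _ K])
    fix a b :: real assume ab: "a \<in> {0..1}" "b \<in> {0..1}" "a < b"
    have "\<bar>L (min s b) - L (min s a)\<bar> \<le> K * \<bar>min s b - min s a\<bar>" using K[of "min s a" "min s b"] ab s by auto
    also have "\<dots> \<le> K * (b - a)" using ab K0 by (intro mult_left_mono) auto
    finally show "\<bar>L (min s b) - L (min s a)\<bar> \<le> K * (b - a)" .
  qed
  have acmax: "abs_continuous_on {0..1} (\<lambda>x. R (max s x))"
  proof (rule abs_continuous_on_lipschitz[of _ _ K])
    fix a b :: real assume ab: "a \<in> {0..1}" "b \<in> {0..1}" "a < b"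
    have "\<bar>R (max s b) - R (max s a)\<bar> \<le> K * \<bar>max s b - max s a\<bar>" using K[of "max s a" "max s b"] ab s by auto
    also have "\<dots> \<le> K * (b - a)" using ab K0 by (intro mult_left_mono) auto
    finally show "\<bar>R (max s b) - R (max s a)\<bar> \<le> K * (b - a)" .
  qed
  have "abs_continuous_on {0..1} (\<lambda>x. L (min s x) * R (max s x))"
    by (intro abs_continuous_on_mult acmin acmax abs_continuous_on_imp_bounded[OF acmin]
        abs_continuous_on_imp_bounded[OF acmax]) (auto simp: is_interval_cc)
  then show ?thesis by (simp add: Green_def[abs_def])
qed

text \<open>The converse of the representation: the derivative of \<open>G s\<close> drops by \<open>1\<close> at \<open>s\<close>, so the
  derivative of \<open>y\<close> drops by \<open>k s\<close>.\<close>

lemma Green_solution: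
  assumes P: "finite P" "P \<subseteq> {0<..<1}" and y: "\<And>x. x \<in> {0..1} \<Longrightarrow> y x = (\<Sum>s\<in>P. k s * G s x)"
    and k: "\<And>s. s \<in> P \<Longrightarrow> k s = \<kappa> s * y s"
  shows "delta_solution q P \<kappa> y"
proof -
  define Q where "Q = P \<union> {0, 1}"
  have Q: "finite Q" "0 \<in> Q" "1 \<in> Q" using P by (auto simp: Q_def)
  have Q01: "0 \<le> s \<and> s \<le> 1" if "s \<in> Q" for s using that P(2) by (fastforce simp: Q_def)
  have sub: "{0<..<1::real} \<subseteq> {0..1}" by auto
  show ?thesis
    unfolding delta_solution_def Q_def[symmetric]
  proof (intro conjI allI impI ballI)
    show "abs_continuous_on {0..1} y"
      by (rule abs_continuous_on_cong[OF abs_continuous_on_sum[OF P(1) ac_Green]]) (use P y in auto)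
  next
    fix a b assume ab: "consecutive Q a b"
    then have ab': "0 \<le> a" "a < b" "b \<le> 1" using Q01 by (auto simp: consecutive_def)
    have av: "s \<le> a \<or> b \<le> s" if "s \<in> P" for s using consecutive_avoid[OF ab, of s] that by (auto simp: Q_def)
    define c where "c = (\<Sum>s\<in>{s\<in>P. b \<le> s}. k s * R s)"
    define d where "d = (\<Sum>s\<in>{s\<in>P. \<not> b \<le> s}. k s * L s)"
    have cd: "y t = c * L t + d * R t" if t: "t \<in> {a..b}" for t
    proof -
      have "(\<Sum>s\<in>P. k s * G s t) = c * L t + d * R t"
        unfolding c_def d_def by (rule Green_piece[OF P(1) _ t]) (rule av)
      then show ?thesis using y[of t] t ab' by simp
    qed
    have dat: "(y has_real_derivative c * L' x + d * R' x) (at x)" if "x \<in> {a<..<b}" for x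
    proof -
      have x: "x \<in> {0<..<1}" using that ab' by auto
      have "((\<lambda>x. c * L x + d * R x) has_real_derivative c * L' x + d * R' x) (at x)"
        by (auto intro!: derivative_eq_intros derL_at[OF x] derR_at[OF x])
      then show ?thesis by (rule has_derivative_cong_open[OF _ that]) (simp add: cd)
    qed
    show "y differentiable at_right a"
      using combination_derivative_right[OF ab' cd] real_differentiable_def by blast
    show "y differentiable at_left b"
      using combination_derivative_left[OF ab' cd] real_differentiable_def by blast
    show "y differentiable at x" if "x \<in> {a<..<b}" for x
      using dat[OF that] real_differentiable_def by blast
    have dy: "deriv y x = c * L' x + d * R' x" if "x \<in> {a<..<b}" for x
      using dat[OF that] by (rule DERIV_imp_deriv)
    have sab: "{a<..<b} \<subseteq> {0<..<1}" using ab' by auto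
    have "abs_continuous_on {a<..<b} (\<lambda>x. c * L' x + d * R' x)"
    proof (rule abs_continuous_on_dominated[of _ L' R' _ "\<bar>c\<bar> + \<bar>d\<bar>"])
      show "abs_continuous_on {a<..<b} L'" "abs_continuous_on {a<..<b} R'"
        using acL' acR' abs_continuous_on_subset sab by blast+
      fix u v
      have "\<bar>c * L' v + d * R' v - (c * L' u + d * R' u)\<bar> = \<bar>c * (L' v - L' u) + d * (R' v - R' u)\<bar>"
        by (simp add: algebra_simps)
      also have "\<dots> \<le> \<bar>c\<bar> * \<bar>L' v - L' u\<bar> + \<bar>d\<bar> * \<bar>R' v - R' u\<bar>"
        by (metis abs_mult abs_triangle_ineq)
      also have "\<dots> \<le> (\<bar>c\<bar> + \<bar>d\<bar>) * (\<bar>L' v - L' u\<bar> + \<bar>R' v - R' u\<bar>)"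
        by (simp add: algebra_simps)
      finally show "\<bar>c * L' v + d * R' v - (c * L' u + d * R' u)\<bar> \<le> (\<bar>c\<bar> + \<bar>d\<bar>) * (\<bar>L' v - L' u\<bar> + \<bar>R' v - R' u\<bar>)" .
    qed
    then show "abs_continuous_on {a<..<b} (deriv y)"
      by (rule abs_continuous_on_cong) (simp add: dy)
    show "AE x in lebesgue. x \<in> {a<..<b} \<longrightarrow> (\<exists>d. (deriv y has_real_derivative d) (at x) \<and> - d + q x * y x = 0)"
      using second_derivatives
    proof eventually_elim
      case (elim x)
      show ?case
      proof (intro impI exI conjI)
        assume x: "x \<in> {a<..<b}"
        then have x1: "x \<in> {0<..<1}" using sab by blast
        have "((\<lambda>x. c * L' x + d * R' x) has_real_derivative c * (q x * L x) + d * (q x * R x)) (at x)"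
          using elim x1 by (auto intro!: derivative_eq_intros)
        then show "(deriv y has_real_derivative c * (q x * L x) + d * (q x * R x)) (at x)"
          by (rule has_derivative_cong_open[OF _ x]) (simp add: dy)
        show "- (c * (q x * L x) + d * (q x * R x)) + q x * y x = 0"
          using cd[of x] x by (simp add: algebra_simps)
      qed
    qed
  next
    fix x assume xP: "x \<in> P"
    then have x: "x \<in> {0<..<1}" "x \<in> {0..1}" using P by auto
    obtain a where a: "a \<in> Q" "a < x" "{a<..<x} \<inter> Q = {}" using consecutive_below[OF Q(1,2), of x] x by auto
    obtain b where b: "b \<in> Q" "x < b" "{x<..<b} \<inter> Q = {}" using consecutive_above[OF Q(1,3), of x] x by auto
    have xQ: "x \<in> Q" using xP by (simp add: Q_def)
    have cax: "consecutive Q a x" and cxb: "consecutive Q x b" using a b xQ by (auto simp: consecutive_def)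
    have av: "s \<le> a \<or> b \<le> s" if "s \<in> P - {x}" for s
      using consecutive_avoid[OF cax, of s] consecutive_avoid[OF cxb, of s] that by (auto simp: Q_def)
    define C where "C = (\<Sum>s\<in>{s\<in>P - {x}. b \<le> s}. k s * R s)"
    define D where "D = (\<Sum>s\<in>{s\<in>P - {x}. \<not> b \<le> s}. k s * L s)"
    have ab: "0 \<le> a" "b \<le> 1" using a b Q01 by auto
    have yt: "y t = k x * G x t + (C * L t + D * R t)" if t: "t \<in> {a..b}" for t
    proof -
      have "(\<Sum>s\<in>P - {x}. k s * G s t) = C * L t + D * R t"
        unfolding C_def D_def by (rule Green_piece[OF _ _ t]) (use P av in auto)
      moreover have "(\<Sum>s\<in>P. k s * G s t) = k x * G x t + (\<Sum>s\<in>P - {x}. k s * G s t)"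
        by (rule sum.remove[OF P(1) xP])
      ultimately show ?thesis using y[of t] t ab by simp
    qed
    have l: "y t = (C + k x * R x) * L t + D * R t" if "t \<in> {a..x}" for t
      using yt[of t] that b by (simp add: Green_def algebra_simps)
    have r: "y t = C * L t + (D + k x * L x) * R t" if "t \<in> {x..b}" for t
      using yt[of t] that a by (simp add: Green_def max_def min_def algebra_simps)
    have "((C + k x * R x) * L' x + D * R' x) - (C * L' x + (D + k x * L x) * R' x) = - k x * (L x * R' x - L' x * R x)"
      by (simp add: algebra_simps)
    also have "\<dots> = \<kappa> x * y x" unfolding wronskian[OF x(2)] using k[OF xP] by simp
    finally show "\<exists>dl dr. (y has_real_derivative dl) (at_left x) \<and> (y has_real_derivative dr) (at_right x) \<and> dl - dr = \<kappa> x * y x"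
      using combination_derivative_left[OF ab(1) a(2) _ l] combination_derivative_right[OF _ b(2) ab(2) r] x by auto
  qed
qed

end

section \<open>Algebra and uniqueness for the Cauchy problems\<close>

text \<open>For \<open>Z1 = m1 * X1\<close>, \<open>Z2 = m2 * X2\<close>, \<open>Z3 = m1 * m2 * X3\<close> this is the coefficient \<open>\<alpha>\<^sub>3\<close>, whose
  zeros are the eigenvalues of the problem without the \<open>r\<close>-term.\<close>

definition char_poly :: "real \<Rightarrow> real \<Rightarrow> real \<Rightarrow> real \<Rightarrow> real" where
  "char_poly Z1 Z2 Z3 l = 1 - l * (Z1 + Z2) + l\<^sup>2 * Z3"

text \<open>At \<open>v = V t\<close> with \<open>t \<in> {x1..x2}\<close> the two factors are \<open>\<phi>(t) R\<^sub>1 / (L\<^sub>1 R(t))\<close> and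
  \<open>\<psi>(t) / R(t)\<close>.\<close>

definition riccati_rhs :: "real \<Rightarrow> real \<Rightarrow> real \<Rightarrow> real \<Rightarrow> real \<Rightarrow> real" where
  "riccati_rhs Z1 Z2 Z3 l v =
     ((1 - l * Z1) * v + l * Z1) * (l * ((Z1 * Z2 - Z3) / Z1) * v + (1 - l * Z2))"

text \<open>The coefficients of the Cauchy problems as functions of \<open>l\<close>: the potential enters only
  through the three numbers \<open>Z1\<close>, \<open>Z2\<close>, \<open>Z3\<close>.\<close>

definition model_coeffs :: "real \<Rightarrow> real \<Rightarrow> real \<Rightarrow> nat \<Rightarrow> real \<Rightarrow> real \<times> real \<times> real \<times> real" where
  "model_coeffs Z1 Z2 Z3 j l =
     (let E = char_poly Z1 Z2 Z3 l in
      if j = 1 then (1, 0, l * ((Z1 * Z2 - Z3) / Z1 + Z1 - l * Z3) / E, 1)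
      else if j = 2 then ((1 - l * Z1) / E, l * Z1 / E, l * ((Z1 * Z2 - Z3) / Z1), 1 - l * Z2)
      else (-1, 0, l * ((Z1 * Z2 - Z3) / Z2 + Z2 - l * Z3) / E, 1))"

lemma char_poly_eq: "char_poly Z1 Z2 Z3 l = (1 - l * Z1) * (1 - l * Z2) - l\<^sup>2 * (Z1 * Z2 - Z3)"
  by (simp add: char_poly_def algebra_simps power2_eq_square)

text \<open>The polynomial is negative at \<open>1 / Z1\<close> and at \<open>1 / Z2\<close>, and it has the value \<open>1\<close> at \<open>0\<close> and
  at \<open>(Z1 + Z2) / Z3\<close>, which is larger than both.\<close>

lemma char_poly_roots:
  assumes Z: "Z1 > 0" "Z2 > 0" "Z3 > 0" "Z3 < Z1 * Z2"
  shows "\<exists>l>0. char_poly Z1 Z2 Z3 l = 0 \<and> l * Z1 < 1 \<and> l * Z2 < 1"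
    and "\<exists>l>0. char_poly Z1 Z2 Z3 l = 0 \<and> 1 < l * Z1 \<and> 1 < l * Z2"
proof -
  have cont: "continuous_on S (char_poly Z1 Z2 Z3)" for S
    unfolding char_poly_def by (intro continuous_intros)
  have neg: "char_poly Z1 Z2 Z3 (1 / Z1) < 0" "char_poly Z1 Z2 Z3 (1 / Z2) < 0"
    using Z by (auto simp: char_poly_eq power2_eq_square zero_less_divide_iff)
  define a where "a = min (1 / Z1) (1 / Z2)"
  define b where "b = max (1 / Z1) (1 / Z2)"
  define c where "c = (Z1 + Z2) / Z3"
  have ab: "0 < a" "char_poly Z1 Z2 Z3 a < 0" "char_poly Z1 Z2 Z3 b < 0" "a \<le> 1 / Z1" "a \<le> 1 / Z2" "1 / Z1 \<le> b" "1 / Z2 \<le> b"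
    using Z neg by (auto simp: a_def b_def min_def max_def)
  have cE: "char_poly Z1 Z2 Z3 c = 1" using Z by (simp add: char_poly_def c_def power2_eq_square field_simps)
  have bc: "b \<le> c"
  proof -
    have "1 / Z1 \<le> c" "1 / Z2 \<le> c"
      using Z by (simp_all add: c_def field_simps) (smt (verit) mult_pos_pos)+
    then show ?thesis by (simp add: b_def)
  qed
  have "\<exists>l\<ge>0. l \<le> a \<and> char_poly Z1 Z2 Z3 l = 0"
    using ab by (intro IVT2' cont) (auto simp: char_poly_def)
  then obtain l where l: "0 \<le> l" "l \<le> a" "char_poly Z1 Z2 Z3 l = 0" by blast
  have "l \<noteq> 0" "l \<noteq> a" using l ab by (auto simp: char_poly_def)
  then have "0 < l" "l < 1 / Z1" "l < 1 / Z2" using l ab by auto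
  then show "\<exists>l>0. char_poly Z1 Z2 Z3 l = 0 \<and> l * Z1 < 1 \<and> l * Z2 < 1"
    using l Z by (intro exI[of _ l]) (auto simp: field_simps)
  have "\<exists>l\<ge>b. l \<le> c \<and> char_poly Z1 Z2 Z3 l = 0"
    using ab cE bc by (intro IVT' cont) auto
  then obtain k where k: "b \<le> k" "k \<le> c" "char_poly Z1 Z2 Z3 k = 0" by blast
  have "k \<noteq> b" using k ab by auto
  then have "1 / Z1 < k" "1 / Z2 < k" using k ab by auto
  then show "\<exists>l>0. char_poly Z1 Z2 Z3 l = 0 \<and> 1 < l * Z1 \<and> 1 < l * Z2"
    using k Z ab(1) by (intro exI[of _ k]) (auto simp: field_simps intro: less_trans[of 0 "1 / Z1"])
qed

lemma char_poly_root_pos: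
  assumes Z: "Z1 > 0" "Z2 > 0" "Z3 > 0" and E: "char_poly Z1 Z2 Z3 l = 0"
  shows "l > 0"
proof (rule ccontr)
  assume "\<not> l > 0"
  then have "l * (Z1 + Z2) \<le> 0" using Z by (simp add: mult_le_0_iff)
  moreover have "l\<^sup>2 * Z3 \<ge> 0" using Z by simp
  ultimately show False using E by (simp add: char_poly_def)
qed

text \<open>The expression is \<open>\<mu>\<^sub>1 L\<^sub>1 / R\<^sub>1\<close>, and \<open>char_poly\<close> is \<open>\<gamma>\<^sub>1\<close>. They have no common zero
  because \<open>\<psi>\<close> does not vanish identically.\<close>

lemma slope_nonzero:
  assumes Z: "Z1 > 0" "Z2 > 0" "Z3 > 0" "Z3 < Z1 * Z2" and e: "char_poly Z1 Z2 Z3 l = 0"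
  shows "l * ((Z1 * Z2 - Z3) / Z1 + Z1 - l * Z3) \<noteq> 0"
proof
  define a where "a = (Z1 * Z2 - Z3) / Z1"
  have a: "a > 0" "Z1 * Z2 - Z3 = Z1 * a" using Z by (auto simp: a_def)
  have l: "l > 0" by (rule char_poly_root_pos[OF Z(1-3) e])
  assume "l * ((Z1 * Z2 - Z3) / Z1 + Z1 - l * Z3) = 0"
  then have "l * a + l * Z1 - l\<^sup>2 * Z3 = 0" by (simp add: a_def algebra_simps power2_eq_square)
  then have s: "1 - l * Z2 = - (l * a)" using e by (simp add: char_poly_def algebra_simps)
  have "(1 - l * Z1) * (1 - l * Z2) = l\<^sup>2 * (Z1 * a)" using e by (simp add: char_poly_eq a)
  then have "l * a = 0" unfolding s by (simp add: algebra_simps power2_eq_square)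
  then show False using l a by simp
qed

text \<open>At a common zero \<open>l\<close> is an eigenvalue of the problem without the \<open>r\<close>-term, and its
  eigenfunction vanishes where \<open>V\<close> has the value \<open>v\<close>. For the smaller root both factors of
  \<open>riccati_rhs\<close> are positive, which reflects that a first eigenfunction has no zero. So \<open>l\<close>
  is the larger root, and there the two factors, being proportional to \<open>\<phi>\<close> and \<open>\<psi>\<close>, vanish
  at the same single \<open>v\<close>.\<close>

lemma common_zero_unique:
  assumes Z: "Z1 > 0" "Z2 > 0" "Z3 > 0" "Z3 < Z1 * Z2"
    and 1: "v > 0" "char_poly Z1 Z2 Z3 l = 0" "riccati_rhs Z1 Z2 Z3 l v = 0"
    and 2: "v' > 0" "char_poly Z1 Z2 Z3 l' = 0" "riccati_rhs Z1 Z2 Z3 l' v' = 0"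
  shows "v = v'"
proof -
  define a where "a = (Z1 * Z2 - Z3) / Z1"
  have a: "a > 0" "Z1 * Z2 - Z3 = Z1 * a" using Z by (auto simp: a_def)
  have key: "l > 0 \<and> 1 - l * Z1 < 0 \<and> (1 - l * Z1) * v + l * Z1 = 0"
    if v: "v > 0" and E: "char_poly Z1 Z2 Z3 l = 0" and g: "riccati_rhs Z1 Z2 Z3 l v = 0" for l v
  proof -
    have l: "l > 0" by (rule char_poly_root_pos[OF Z(1-3) E])
    have ps: "(1 - l * Z1) * (1 - l * Z2) = l\<^sup>2 * (Z1 * a)" using E by (simp add: char_poly_eq a)
    then have psp: "(1 - l * Z1) * (1 - l * Z2) > 0" using l a Z by simp
    have g': "(1 - l * Z1) * v + l * Z1 = 0 \<or> l * a * v + (1 - l * Z2) = 0"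
      using g by (simp add: riccati_rhs_def a_def)
    have neg: "1 - l * Z1 < 0"
    proof (rule ccontr)
      assume "\<not> 1 - l * Z1 < 0"
      then have pos: "1 - l * Z1 > 0" "1 - l * Z2 > 0" using psp by (auto simp: zero_less_mult_iff)
      have "(1 - l * Z1) * v + l * Z1 > 0" using pos v l Z by (simp add: add_pos_pos)
      moreover have "l * a * v + (1 - l * Z2) > 0" using pos v l a by (intro add_pos_pos) auto
      ultimately show False using g' by linarith
    qed
    have "(1 - l * Z1) * v + l * Z1 = 0" if h: "l * a * v + (1 - l * Z2) = 0"
    proof -
      have "l * a * ((1 - l * Z1) * v + l * Z1) = (1 - l * Z1) * (l * a * v + (1 - l * Z2))
          + (l\<^sup>2 * (Z1 * a) - (1 - l * Z1) * (1 - l * Z2))"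
        by (simp add: algebra_simps power2_eq_square)
      then show ?thesis using h ps l a by simp
    qed
    then show ?thesis using l neg g' by blast
  qed
  note k1 = key[OF 1] and k2 = key[OF 2]
  have "l = l'"
  proof (rule ccontr)
    assume ne: "l \<noteq> l'"
    have "char_poly Z1 Z2 Z3 l - char_poly Z1 Z2 Z3 l' = (l - l') * ((l + l') * Z3 - (Z1 + Z2))"
      by (simp add: char_poly_def algebra_simps power2_eq_square)
    then have s: "(l + l') * Z3 = Z1 + Z2" using 1 2 ne by simp
    have "l' * char_poly Z1 Z2 Z3 l - l * char_poly Z1 Z2 Z3 l' = (l' - l) * (1 - l * l' * Z3)"
      by (simp add: char_poly_def algebra_simps power2_eq_square)
    then have p: "l * l' * Z3 = 1" using 1 2 ne by simp
    have "Z3 * ((1 - l * Z1) * (1 - l' * Z1)) = Z3 - Z1 * ((l + l') * Z3) + Z1\<^sup>2 * (l * l' * Z3)"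
      by (simp add: algebra_simps power2_eq_square)
    also have "\<dots> = Z3 - Z1 * Z2" unfolding s p by (simp add: algebra_simps power2_eq_square)
    finally have "Z3 * ((1 - l * Z1) * (1 - l' * Z1)) < 0" using Z by simp
    moreover have "Z3 * ((1 - l * Z1) * (1 - l' * Z1)) > 0"
      using k1 k2 Z by (intro mult_pos_pos mult_neg_neg) auto
    ultimately show False by linarith
  qed
  then have "(1 - l * Z1) * (v - v') = 0" using k1 k2 by (simp add: algebra_simps)
  then show ?thesis using k1 by simp
qed

text \<open>Think of three points \<open>(a i, b i)\<close> on the hyperbola \<open>1 - a * Z1 - b * Z2 + a * b * Z3 = 0\<close>,
  which is nondegenerate as \<open>Z1 * Z2 \<noteq> Z3\<close>. The difference \<open>w\<close> of two solutions of the three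
  linear equations satisfies \<open>a * w1 + b * w2 = a * b * w3\<close> at the three points. Eliminating
  \<open>b\<close> by means of the hyperbola leaves a quadratic polynomial in \<open>a\<close> with three distinct
  roots, so its coefficients vanish, and this forces \<open>w = 0\<close>.\<close>

lemma hyperbola_determined:
  fixes a b :: "nat \<Rightarrow> real"
  assumes nd: "Z1 * Z2 \<noteq> Z3"
    and distinct: "a 0 \<noteq> a 1 \<or> b 0 \<noteq> b 1" "a 0 \<noteq> a 2 \<or> b 0 \<noteq> b 2" "a 1 \<noteq> a 2 \<or> b 1 \<noteq> b 2"
    and Z: "\<And>i. i \<in> {0, 1, 2} \<Longrightarrow> 1 - a i * Z1 - b i * Z2 + a i * b i * Z3 = 0"
    and Y: "\<And>i. i \<in> {0, 1, 2} \<Longrightarrow> 1 - a i * Y1 - b i * Y2 + a i * b i * Y3 = 0"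
  shows "Y1 = Z1 \<and> Y2 = Z2 \<and> Y3 = Z3"
proof -
  define w1 w2 w3 where "w1 = Y1 - Z1" and "w2 = Y2 - Z2" and "w3 = Y3 - Z3"
  have quad: "(w3 * Z1 - w1 * Z3) * (a i)\<^sup>2 + (w1 * Z2 - Z1 * w2 - w3) * a i + w2 = 0" if i: "i \<in> {0, 1, 2}" for i
  proof -
    have b: "b i * (Z2 - a i * Z3) = 1 - a i * Z1" using Z[OF i] by (simp add: algebra_simps)
    have "a i * w1 + b i * w2 - a i * b i * w3 = 0"
      using Z[OF i] Y[OF i] by (simp add: w1_def w2_def w3_def algebra_simps)
    then have "0 = (a i * w1 + b i * w2 - a i * b i * w3) * (Z2 - a i * Z3)" by simp
    also have "\<dots> = a i * w1 * (Z2 - a i * Z3) + (b i * (Z2 - a i * Z3)) * (w2 - a i * w3)"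
      by (simp add: algebra_simps)
    finally show ?thesis unfolding b by (simp add: algebra_simps power2_eq_square)
  qed
  have inj: "a i \<noteq> a j" if "i \<in> {0, 1, 2}" "j \<in> {0, 1, 2}" "a i \<noteq> a j \<or> b i \<noteq> b j" for i j
  proof
    assume eq: "a i = a j"
    then have ne: "b i \<noteq> b j" using that(3) by simp
    have "(b i - b j) * (Z2 - a i * Z3) = 0" using Z[OF that(1)] Z[OF that(2)] eq by (simp add: algebra_simps)
    then have z2: "Z2 = a i * Z3" using ne by simp
    then have "a i * Z1 = 1" using Z[OF that(1)] by (simp add: algebra_simps)
    then have "Z1 * Z2 = Z3" using z2 by (simp add: algebra_simps)
    then show False using nd by simp
  qed
  have zero: "c2 = 0 \<and> c1 = 0 \<and> c0 = 0"
    if q: "c2 * x\<^sup>2 + c1 * x + c0 = 0" "c2 * y\<^sup>2 + c1 * y + c0 = 0" "c2 * z\<^sup>2 + c1 * z + c0 = 0"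
      and ne: "x \<noteq> y" "x \<noteq> z" "y \<noteq> z" for c2 c1 c0 x y z :: real
  proof -
    have "(x - y) * (c2 * (x + y) + c1) = 0" "(x - z) * (c2 * (x + z) + c1) = 0"
      using q by (simp_all add: algebra_simps power2_eq_square)
    then have e: "c2 * (x + y) + c1 = 0" "c2 * (x + z) + c1 = 0" using ne by simp_all
    moreover have "c2 * (y - z) = (c2 * (x + y) + c1) - (c2 * (x + z) + c1)" by (simp add: algebra_simps)
    ultimately have "c2 * (y - z) = 0" by simp
    then have "c2 = 0" using ne by simp
    then show ?thesis using e q by simp
  qed
  have "a 0 \<noteq> a 1" "a 0 \<noteq> a 2" "a 1 \<noteq> a 2" using inj distinct by auto
  then have w: "w3 * Z1 - w1 * Z3 = 0" "w1 * Z2 - Z1 * w2 - w3 = 0" "w2 = 0"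
    using zero[OF quad[of 0] quad[of 1] quad[of 2]] by auto
  then have "w3 = w1 * Z2" by simp
  with w(1) have "w1 * (Z1 * Z2 - Z3) = 0" by (simp add: algebra_simps)
  then have "w1 = 0" using nd by simp
  then show ?thesis using w by (simp add: w1_def w2_def w3_def)
qed

text \<open>The difference \<open>d\<close> of two solutions satisfies \<open>d' = r * (Q / char_poly) * d\<close> with a
  polynomial \<open>Q\<close> of degree two in \<open>l = lam t\<close>, and Gronwall's lemma applies once this
  quotient is bounded. Nothing prevents \<open>lam t\<close> from being large, so \<open>l\<close> is replaced by a
  point \<open>(x, y)\<close> of the unit circle with \<open>l = y / x\<close>, and all polynomials in \<open>l\<close> by their
  homogeneous versions. The set \<open>C\<close> of all \<open>(t, x, y)\<close> compatible with the equation for \<open>V1\<close>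
  is then compact. The homogeneous \<open>char_poly\<close> has no zero on it: not for \<open>x = 0\<close>, as
  \<open>Z3 > 0\<close>, and not elsewhere, as \<open>V1\<close> avoids the exceptional value.\<close>

lemma riccati_unique:
  fixes V1 V2 V1' V2' lam :: "real \<Rightarrow> real"
  assumes Z: "Z3 > 0" and r: "r > 0" and cd: "c \<in> {a..b}"
    and d1: "\<And>t. t \<in> {a..b} \<Longrightarrow> (V1 has_real_derivative V1' t) (at t within {a..b})"
    and d2: "\<And>t. t \<in> {a..b} \<Longrightarrow> (V2 has_real_derivative V2' t) (at t within {a..b})"
    and cont: "continuous_on {a..b} V1'"
    and e1: "\<And>t. t \<in> {a..b} \<Longrightarrow> char_poly Z1 Z2 Z3 (lam t) * V1' t = r * riccati_rhs Z1 Z2 Z3 (lam t) (V1 t)"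
    and e2: "\<And>t. t \<in> {a..b} \<Longrightarrow> char_poly Z1 Z2 Z3 (lam t) * V2' t = r * riccati_rhs Z1 Z2 Z3 (lam t) (V2 t)"
    and avoid: "\<And>t l. t \<in> {a..b} \<Longrightarrow> char_poly Z1 Z2 Z3 l = 0 \<Longrightarrow> riccati_rhs Z1 Z2 Z3 l (V1 t) \<noteq> 0"
    and init: "V1 c = V2 c" and t: "t \<in> {a..b}"
  shows "V1 t = V2 t"
proof -
  define A where "A = (Z1 * Z2 - Z3) / Z1"
  define eh where "eh x y = x\<^sup>2 - x * y * (Z1 + Z2) + y\<^sup>2 * Z3" for x y
  define gh where "gh x y v = ((x - y * Z1) * v + y * Z1) * (y * A * v + (x - y * Z2))" for x y v
  have hom: "char_poly Z1 Z2 Z3 l * s\<^sup>2 = eh s (l * s)" "riccati_rhs Z1 Z2 Z3 l v * s\<^sup>2 = gh s (l * s) v" for l s v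
    by (simp_all add: char_poly_def riccati_rhs_def eh_def gh_def A_def[symmetric] algebra_simps power2_eq_square)
  have cV1: "continuous_on {a..b} V1" and cV2: "continuous_on {a..b} V2"
    using DERIV_continuous_on[OF d1] DERIV_continuous_on[OF d2] by auto
  define C where "C = {z \<in> {a..b} \<times> sphere (0 :: real \<times> real) 1.
      eh (fst (snd z)) (snd (snd z)) * V1' (fst z) - r * gh (fst (snd z)) (snd (snd z)) (V1 (fst z)) = 0}"
  have cmp: "compact ({a..b} \<times> sphere (0 :: real \<times> real) 1)" by (intro compact_Times compact_Icc compact_sphere)
  have f1: "continuous_on ({a..b} \<times> sphere (0 :: real \<times> real) 1) (\<lambda>z. V1 (fst z))"
    by (rule continuous_on_compose2[OF cV1]) (auto intro!: continuous_intros)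
  have f2: "continuous_on ({a..b} \<times> sphere (0 :: real \<times> real) 1) (\<lambda>z. V1' (fst z))"
    by (rule continuous_on_compose2[OF cont]) (auto intro!: continuous_intros)
  have cC: "compact C"
  proof -
    have "continuous_on ({a..b} \<times> sphere (0 :: real \<times> real) 1)
        (\<lambda>z. eh (fst (snd z)) (snd (snd z)) * V1' (fst z) - r * gh (fst (snd z)) (snd (snd z)) (V1 (fst z)))"
      unfolding eh_def gh_def by (intro continuous_intros f1 f2)
    from continuous_closedin_preimage_constant[OF this, of 0]
    have "closedin (top_of_set ({a..b} \<times> sphere (0 :: real \<times> real) 1)) C"
      unfolding C_def by simp
    then show ?thesis using closedin_compact[OF cmp] by blast
  qed
  have nz: "eh (fst (snd z)) (snd (snd z)) \<noteq> 0" if z: "z \<in> C" for z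
  proof
    obtain s x y where zs: "z = (s, x, y)" by (metis surj_pair)
    assume "eh (fst (snd z)) (snd (snd z)) = 0"
    then have e0: "eh x y = 0" by (simp add: zs)
    then have g0: "gh x y (V1 s) = 0" using z r by (simp add: C_def zs)
    have s: "s \<in> {a..b}" and xy: "x\<^sup>2 + y\<^sup>2 = 1" using z by (auto simp: C_def zs norm_Pair)
    show False
    proof (cases "x = 0")
      case True
      then show False using e0 xy Z by (simp add: eh_def)
    next
      case False
      then have "char_poly Z1 Z2 Z3 (y / x) = 0" "riccati_rhs Z1 Z2 Z3 (y / x) (V1 s) = 0"
        using hom(1)[of "y / x" x] hom(2)[of "y / x" "V1 s" x] e0 g0 by auto
      then show False using avoid[OF s] by blast
    qed
  qed
  obtain M where M: "\<And>t. t \<in> {a..b} \<Longrightarrow> \<bar>V1 t + V2 t\<bar> \<le> M"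
  proof -
    have "continuous_on {a..b} (\<lambda>t. V1 t + V2 t)" by (intro continuous_intros cV1 cV2)
    then have "bounded ((\<lambda>t. V1 t + V2 t) ` {a..b})" by (intro compact_imp_bounded compact_continuous_image compact_Icc)
    then obtain M where "\<forall>u\<in>(\<lambda>t. V1 t + V2 t) ` {a..b}. norm u \<le> M" unfolding bounded_iff by blast
    then show ?thesis by (intro that[of M]) auto
  qed
  define Q where "Q l w = (1 - l * Z1) * (l * A) * w + ((1 - l * Z1) * (1 - l * Z2) + l * Z1 * (l * A))" for l w
  define qh where "qh x y w = (x - y * Z1) * (y * A) * w + ((x - y * Z1) * (x - y * Z2) + y * Z1 * (y * A))" for x y w
  have diff: "riccati_rhs Z1 Z2 Z3 l v - riccati_rhs Z1 Z2 Z3 l w = (v - w) * Q l (v + w)" for l v w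
    by (simp add: riccati_rhs_def Q_def A_def[symmetric] algebra_simps)
  have homQ: "Q l w * s\<^sup>2 = qh s (l * s) w" for l s w
    by (simp add: Q_def qh_def algebra_simps power2_eq_square)
  obtain K where K: "\<And>z w. z \<in> C \<Longrightarrow> \<bar>w\<bar> \<le> M \<Longrightarrow>
      \<bar>qh (fst (snd z)) (snd (snd z)) w\<bar> \<le> K * \<bar>eh (fst (snd z)) (snd (snd z))\<bar>"
  proof -
    let ?F = "\<lambda>u. qh (fst (snd (fst u))) (snd (snd (fst u))) (snd u) / eh (fst (snd (fst u))) (snd (snd (fst u)))"
    have "continuous_on (C \<times> {-M..M}) ?F"
      using nz unfolding qh_def eh_def by (intro continuous_intros) auto
    then have "bounded (?F ` (C \<times> {-M..M}))"
      by (intro compact_imp_bounded compact_continuous_image compact_Times cC compact_Icc)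
    then obtain K where K: "\<forall>u\<in>?F ` (C \<times> {-M..M}). norm u \<le> K" unfolding bounded_iff by blast
    have "\<bar>qh (fst (snd z)) (snd (snd z)) w\<bar> \<le> K * \<bar>eh (fst (snd z)) (snd (snd z))\<bar>"
      if "z \<in> C" "\<bar>w\<bar> \<le> M" for z w
    proof -
      have "(z, w) \<in> C \<times> {-M..M}" using that by auto
      then have "norm (?F (z, w)) \<le> K" using K by blast
      then show ?thesis using nz[OF that(1)] by (simp add: abs_divide field_simps)
    qed
    then show ?thesis using that by blast
  qed
  have bound: "char_poly Z1 Z2 Z3 (lam t) \<noteq> 0 \<and> \<bar>Q (lam t) (V1 t + V2 t)\<bar> \<le> K * \<bar>char_poly Z1 Z2 Z3 (lam t)\<bar>"
    if t: "t \<in> {a..b}" for t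
  proof -
    define s where "s = 1 / sqrt (1 + (lam t)\<^sup>2)"
    have pos: "1 + (lam t)\<^sup>2 > 0" by (simp add: add_pos_nonneg)
    have s2: "s\<^sup>2 = 1 / (1 + (lam t)\<^sup>2)" using pos by (simp add: s_def power_divide)
    have "s\<^sup>2 + (lam t * s)\<^sup>2 = s\<^sup>2 * (1 + (lam t)\<^sup>2)" by (simp add: algebra_simps power2_eq_square)
    also have "\<dots> = 1" using s2 pos by simp
    finally have "(t, s, lam t * s) \<in> {a..b} \<times> sphere 0 1" using t by (simp add: norm_Pair)
    moreover have "eh s (lam t * s) * V1' t - r * gh s (lam t * s) (V1 t) = 0"
    proof -
      have "eh s (lam t * s) * V1' t - r * gh s (lam t * s) (V1 t)
          = s\<^sup>2 * (char_poly Z1 Z2 Z3 (lam t) * V1' t - r * riccati_rhs Z1 Z2 Z3 (lam t) (V1 t))"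
        unfolding hom[symmetric] by (simp add: algebra_simps)
      then show ?thesis using e1[OF t] by simp
    qed
    ultimately have inC: "(t, s, lam t * s) \<in> C" by (simp add: C_def)
    have "\<bar>Q (lam t) (V1 t + V2 t) * s\<^sup>2\<bar> \<le> K * \<bar>char_poly Z1 Z2 Z3 (lam t) * s\<^sup>2\<bar>"
      using K[OF inC M[OF t]] by (simp add: hom homQ)
    then have "\<bar>Q (lam t) (V1 t + V2 t)\<bar> * s\<^sup>2 \<le> K * \<bar>char_poly Z1 Z2 Z3 (lam t)\<bar> * s\<^sup>2"
      by (simp add: abs_mult mult.assoc)
    moreover have "s\<^sup>2 > 0" using s2 pos by simp
    ultimately show ?thesis using nz[OF inC] hom(1)[of "lam t" s] by auto
  qed
  have "V1 t - V2 t = 0"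
  proof (rule gronwall_zero[where d = "\<lambda>t. V1 t - V2 t" and a = a and b = b and c = c and K = "r * K"
        and d' = "\<lambda>t. V1' t - V2' t"])
    fix t assume t: "t \<in> {a..b}"
    show "((\<lambda>t. V1 t - V2 t) has_real_derivative V1' t - V2' t) (at t within {a..b})"
      by (intro DERIV_diff d1 d2 t)
    let ?E = "char_poly Z1 Z2 Z3 (lam t)"
    have "?E * (V1' t - V2' t) = r * ((V1 t - V2 t) * Q (lam t) (V1 t + V2 t))"
      unfolding diff[symmetric] using e1[OF t] e2[OF t] by (simp add: algebra_simps)
    then have "\<bar>?E\<bar> * \<bar>V1' t - V2' t\<bar> = r * (\<bar>V1 t - V2 t\<bar> * \<bar>Q (lam t) (V1 t + V2 t)\<bar>)"
      using r by (metis abs_mult abs_of_pos)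
    also have "\<dots> \<le> r * (\<bar>V1 t - V2 t\<bar> * (K * \<bar>?E\<bar>))"
      using r bound[OF t] by (intro mult_left_mono) auto
    finally have "\<bar>?E\<bar> * \<bar>V1' t - V2' t\<bar> \<le> \<bar>?E\<bar> * (r * K * \<bar>V1 t - V2 t\<bar>)" by (simp add: mult_ac)
    then show "\<bar>V1' t - V2' t\<bar> \<le> r * K * \<bar>V1 t - V2 t\<bar>"
      by (rule mult_left_le_imp_le) (use bound[OF t] in simp)
  qed (use cd init t in auto)
  then show ?thesis by simp
qed

text \<open>The reciprocal of a solution satisfies a linear equation, and the coefficient \<open>k\<close> cancels in
  the difference of two reciprocals.\<close>

lemma bernoulli_unique:
  fixes F1 F2 :: "real \<Rightarrow> real"
  assumes cd: "c \<in> {a..b}" and pos: "\<And>t. t \<in> {a..b} \<Longrightarrow> F1 t > 0" "\<And>t. t \<in> {a..b} \<Longrightarrow> F2 t > 0"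
    and d1: "\<And>t. t \<in> {a..b} \<Longrightarrow> (F1 has_real_derivative \<rho> * F1 t * (k t * F1 t + 1)) (at t within {a..b})"
    and d2: "\<And>t. t \<in> {a..b} \<Longrightarrow> (F2 has_real_derivative \<rho> * F2 t * (k t * F2 t + 1)) (at t within {a..b})"
    and init: "F1 c = F2 c" and t: "t \<in> {a..b}"
  shows "F1 t = F2 t"
proof -
  have inv: "((\<lambda>t. 1 / F t) has_real_derivative - \<rho> * k t - \<rho> * (1 / F t)) (at t within {a..b})"
    if "F t > 0" "(F has_real_derivative \<rho> * F t * (k t * F t + 1)) (at t within {a..b})" for F t
  proof -
    have "((\<lambda>t. 1 / F t) has_real_derivative (0 * F t - 1 * (\<rho> * F t * (k t * F t + 1))) / (F t * F t)) (at t within {a..b})"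
      using that by (intro DERIV_divide DERIV_const) auto
    moreover have "(0 * F t - 1 * (\<rho> * F t * (k t * F t + 1))) / (F t * F t) = - \<rho> * k t - \<rho> * (1 / F t)"
      using that(1) by (simp add: field_simps)
    ultimately show ?thesis by (simp only:)
  qed
  have "1 / F1 t - 1 / F2 t = 0"
  proof (rule gronwall_zero[where d = "\<lambda>t. 1 / F1 t - 1 / F2 t" and a = a and b = b and c = c and K = "\<bar>\<rho>\<bar>"
        and d' = "\<lambda>t. - \<rho> * (1 / F1 t - 1 / F2 t)"])
    fix t assume t: "t \<in> {a..b}"
    have "((\<lambda>t. 1 / F1 t - 1 / F2 t) has_real_derivative (- \<rho> * k t - \<rho> * (1 / F1 t)) - (- \<rho> * k t - \<rho> * (1 / F2 t)))
        (at t within {a..b})"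
      by (intro DERIV_diff inv pos d1 d2 t)
    then show "((\<lambda>t. 1 / F1 t - 1 / F2 t) has_real_derivative - \<rho> * (1 / F1 t - 1 / F2 t)) (at t within {a..b})"
      by (simp add: algebra_simps)
    show "\<bar>- \<rho> * (1 / F1 t - 1 / F2 t)\<bar> \<le> \<bar>\<rho>\<bar> * \<bar>1 / F1 t - 1 / F2 t\<bar>" by (simp add: abs_mult)
  qed (use cd init t in auto)
  then show ?thesis using pos[OF t] by simp
qed

section \<open>Eigenvalues of the perturbed problem\<close>

lemma quadratic_form_nonneg:
  fixes \<alpha> :: real
  assumes "\<alpha> > 0" "\<alpha> * \<beta> = \<gamma>\<^sup>2"
  shows "\<alpha> * a\<^sup>2 + \<beta> * b\<^sup>2 - 2 * \<gamma> * a * b \<ge> 0"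
proof -
  have "\<alpha> * (\<alpha> * a\<^sup>2 + \<beta> * b\<^sup>2 - 2 * \<gamma> * a * b) = (\<alpha> * a)\<^sup>2 + (\<alpha> * \<beta>) * b\<^sup>2 - 2 * \<alpha> * \<gamma> * a * b"
    by (simp add: algebra_simps power2_eq_square)
  also have "\<dots> = (\<alpha> * a - \<gamma> * b)\<^sup>2" unfolding assms(2) by (simp add: algebra_simps power2_eq_square)
  finally have "\<alpha> * (\<alpha> * a\<^sup>2 + \<beta> * b\<^sup>2 - 2 * \<gamma> * a * b) \<ge> 0" by simp
  then show ?thesis using assms(1) by (simp add: zero_le_mult_iff)
qed

lemma homogeneous_3x3:
  fixes a11 :: real
  shows "(\<exists>x y z. (x \<noteq> 0 \<or> y \<noteq> 0 \<or> z \<noteq> 0) \<and> a11 * x + a12 * y + a13 * z = 0 \<and>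
       a21 * x + a22 * y + a23 * z = 0 \<and> a31 * x + a32 * y + a33 * z = 0) \<longleftrightarrow>
     a11 * a22 * a33 + a12 * a23 * a31 + a13 * a21 * a32 - a11 * a23 * a32 - a12 * a21 * a33 - a13 * a22 * a31 = 0"
proof -
  define A :: "real^3^3" where "A = vector [vector [a11, a12, a13], vector [a21, a22, a23], vector [a31, a32, a33]]"
  have "det A = 0 \<longleftrightarrow> \<not> invertible A" by (simp add: invertible_det_nz)
  also have "\<dots> \<longleftrightarrow> (\<exists>x. A *v x = 0 \<and> x \<noteq> 0)"
    using matrix_left_invertible_ker[of A] by (auto simp: invertible_left_inverse)
  also have "\<dots> \<longleftrightarrow> (\<exists>x y z. A *v vector [x, y, z] = 0 \<and> (vector [x, y, z] :: real^3) \<noteq> 0)"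
  proof -
    have "x = vector [x $ 1, x $ 2, x $ 3]" for x :: "real^3" by (simp add: vec_eq_iff forall_3)
    then show ?thesis by metis
  qed
  also have "\<dots> \<longleftrightarrow> (\<exists>x y z. (x \<noteq> 0 \<or> y \<noteq> 0 \<or> z \<noteq> 0) \<and> a11 * x + a12 * y + a13 * z = 0 \<and>
       a21 * x + a22 * y + a23 * z = 0 \<and> a31 * x + a32 * y + a33 * z = 0)"
    by (simp add: vec_eq_iff forall_3 A_def matrix_vector_mult_def sum_3) metis
  finally show ?thesis by (simp add: A_def det_3)
qed

locale two_mass = fundamental_pair +
  fixes m1 m2 x1 x2 r :: real
  assumes ld: "left_definite q" and m: "m1 > 0" "m2 > 0" and x: "0 < x1" "x1 < x2" "x2 < 1" and r: "r > 0"
begin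

lemma Lpos: "t \<in> {0<..1} \<Longrightarrow> L t > 0" and Rpos: "t \<in> {0..<1} \<Longrightarrow> R t > 0"
  using left_definite_imp_L_pos[OF ld] left_definite_imp_R_pos[OF ld] by auto

lemma pos12: "L x1 > 0" "L x2 > 0" "R x1 > 0" "R x2 > 0"
  using Lpos Rpos x by auto

definition "Z1 = m1 * X1 x1 L R"
definition "Z2 = m2 * X2 x2 L R"
definition "Z3 = m1 * m2 * X3 x1 x2 L R"

abbreviation "E \<equiv> char_poly Z1 Z2 Z3"

lemma ratio_derivative:
  assumes "t \<in> {0<..<1}"
  shows "((\<lambda>t. L t / R t) has_real_derivative 1 / (R t)\<^sup>2) (at t)"
    and "((\<lambda>t. R t / L t) has_real_derivative - 1 / (L t)\<^sup>2) (at t)"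
proof -
  have p: "L t > 0" "R t > 0" using Lpos Rpos assms by auto
  have w: "L t * R' t - L' t * R t = -1" using wronskian assms by auto
  have "((\<lambda>t. L t / R t) has_real_derivative (L' t * R t - L t * R' t) / (R t * R t)) (at t)"
    using p by (intro DERIV_divide derL_at derR_at assms) auto
  moreover have "L' t * R t - L t * R' t = 1" using w by simp
  ultimately show "((\<lambda>t. L t / R t) has_real_derivative 1 / (R t)\<^sup>2) (at t)" by (simp add: power2_eq_square)
  have "((\<lambda>t. R t / L t) has_real_derivative (R' t * L t - R t * L' t) / (L t * L t)) (at t)"
    using p by (intro DERIV_divide derL_at derR_at assms) auto
  moreover have "R' t * L t - R t * L' t = - 1" using w by (simp add: mult.commute)
  ultimately show "((\<lambda>t. R t / L t) has_real_derivative - 1 / (L t)\<^sup>2) (at t)" by (simp add: power2_eq_square)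
qed

lemma ratio_less:
  assumes "0 < s" "s < t" "t < 1"
  shows "L s / R s < L t / R t"
proof (rule DERIV_pos_imp_increasing[OF assms(2)])
  fix u assume u: "s \<le> u" "u \<le> t"
  then have "u \<in> {0<..<1}" using assms by auto
  then show "\<exists>d. ((\<lambda>u. L u / R u) has_real_derivative d) (at u) \<and> 0 < d"
    using ratio_derivative(1)[of u] Rpos[of u] by (intro exI[of _ "1 / (R u)\<^sup>2"]) auto
qed

lemma X3_pos: "X3 x1 x2 L R > 0"
proof -
  have "L x1 / R x1 < L x2 / R x2" using ratio_less x by auto
  then have "L x1 * R x2 < L x2 * R x1" using pos12 by (simp add: field_simps)
  then show ?thesis unfolding X3_def using pos12 by simp
qed

lemma Z_rel: "Z1 * Z2 - Z3 = m1 * m2 * (L x1 * R x2)\<^sup>2"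
  by (simp add: Z1_def Z2_def Z3_def X1_def X2_def X3_def algebra_simps power2_eq_square)

lemma Z_pos: "Z1 > 0" "Z2 > 0" "Z3 > 0" "Z3 < Z1 * Z2"
proof -
  show "Z1 > 0" "Z2 > 0" "Z3 > 0"
    using m pos12 X3_pos by (simp_all add: Z1_def Z2_def Z3_def X1_def X2_def)
  have "m1 * m2 * (L x1 * R x2)\<^sup>2 > 0" using m pos12 by simp
  then show "Z3 < Z1 * Z2" using Z_rel by linarith
qed

text \<open>This is the product \<open>\<phi>(t, l) \<psi>(t, l)\<close>. Written with Green's function it has the same form
  for all positions of \<open>t\<close> relative to the masses.\<close>

definition Phi :: "real \<Rightarrow> real \<Rightarrow> real" where
  "Phi t l = G t t * E l + l * m1 * (G x1 t)\<^sup>2 * (1 - l * Z2) + l * m2 * (G x2 t)\<^sup>2 * (1 - l * Z1)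
     + 2 * l\<^sup>2 * m1 * m2 * (L x1 * R x2) * G x1 t * G x2 t"

definition char_fun :: "real \<Rightarrow> real \<Rightarrow> real" where
  "char_fun t l = E l - r * Phi t l"

definition weight :: "real \<Rightarrow> real \<Rightarrow> real \<Rightarrow> real" where
  "weight t l s = l * ((if s = x1 then m1 else 0) + (if s = x2 then m2 else 0)) + (if s = t then r else 0)"

text \<open>If \<open>t\<close> coincides with a mass, the set of nodes contains it once and the weights add up; if
  \<open>t\<close> is an end point, it is not a node, but then its Green's function is zero. So the same
  three terms appear in all cases.\<close>

lemma weight_sum:
  assumes u: "u \<in> {0..1}" and t: "t \<in> {0..1}"
  shows "(\<Sum>s\<in>{x1, x2, t} \<inter> {0<..<1}. weight t l s * y s * G s u)
     = l * m1 * y x1 * G x1 u + l * m2 * y x2 * G x2 u + r * y t * G t u"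
proof -
  let ?P = "{x1, x2, t} \<inter> {0<..<1::real}"
  have fin: "finite ?P" by simp
  have "(\<Sum>s\<in>?P. weight t l s * y s * G s u) =
      (\<Sum>s\<in>?P. if s = x1 then l * m1 * y s * G s u else 0) + (\<Sum>s\<in>?P. if s = x2 then l * m2 * y s * G s u else 0)
      + (\<Sum>s\<in>?P. if s = t then r * y s * G s u else 0)"
    unfolding sum.distrib[symmetric] by (intro sum.cong) (auto simp: weight_def algebra_simps)
  also have "\<dots> = l * m1 * y x1 * G x1 u + l * m2 * y x2 * G x2 u + (if t \<in> ?P then r * y t * G t u else 0)"
    using x by (simp add: sum.delta[OF fin])
  also have "(if t \<in> ?P then r * y t * G t u else 0) = r * y t * G t u"
  proof (cases "t \<in> {0<..<1}")
    case False
    then have "t = 0 \<or> t = 1" using t by auto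
    then have "G t u = 0" using u L0 R1 by (auto simp: Green_def min_def max_def)
    then show ?thesis by simp
  qed auto
  finally show ?thesis .
qed

lemma Green_boundary: "s \<in> {0..1} \<Longrightarrow> G s 0 = 0" "s \<in> {0..1} \<Longrightarrow> G s 1 = 0"
  using L0 R1 by (auto simp: Green_def min_def max_def)

text \<open>By the representation with Green's function, a solution amounts to its values \<open>a\<close>, \<open>b\<close>, \<open>c\<close>
  at \<open>x1\<close>, \<open>x2\<close> and \<open>t\<close>.\<close>

lemma perturbed_eigenvalue_iff_system:
  assumes t: "t \<in> {0..1}"
  shows "perturbed_eigenvalue m1 m2 x1 x2 r q t l \<longleftrightarrow>
    (\<exists>a b c. (a \<noteq> 0 \<or> b \<noteq> 0 \<or> c \<noteq> 0) \<and>
       a = l * m1 * a * G x1 x1 + l * m2 * b * G x2 x1 + r * c * G t x1 \<and>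
       b = l * m1 * a * G x1 x2 + l * m2 * b * G x2 x2 + r * c * G t x2 \<and>
       c = l * m1 * a * G x1 t + l * m2 * b * G x2 t + r * c * G t t)" (is "?lhs \<longleftrightarrow> ?rhs")
proof
  let ?P = "{x1, x2, t} \<inter> {0<..<1::real}"
  have P: "finite ?P" "?P \<subseteq> {0<..<1}" by auto
  have xs: "x1 \<in> {0..1}" "x2 \<in> {0..1}" using x by auto
  {
    assume ?lhs
    then obtain y where y: "delta_solution q ?P (weight t l) y" "dirichlet_nontrivial y"
      unfolding perturbed_eigenvalue_def weight_def[abs_def] by blast
    have bc: "y 0 = 0" "y 1 = 0" and nt: "\<exists>u\<in>{0..1}. y u \<noteq> 0" using y(2) by (auto simp: dirichlet_nontrivial_def)
    have L1: "L 1 \<noteq> 0" using Lpos[of 1] by simp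
    have rep: "y u = l * m1 * y x1 * G x1 u + l * m2 * y x2 * G x2 u + r * y t * G t u" if u: "u \<in> {0..1}" for u
      using Green_representation[OF y(1) P bc L1 u] weight_sum[OF u t] by simp
    have "y x1 \<noteq> 0 \<or> y x2 \<noteq> 0 \<or> y t \<noteq> 0"
    proof (rule ccontr)
      assume "\<not> ?thesis"
      then have "y u = 0" if "u \<in> {0..1}" for u using rep[OF that] by simp
      then show False using nt by blast
    qed
    then show ?rhs using rep[OF xs(1)] rep[OF xs(2)] rep[OF t] by blast
  }
  {
    assume ?rhs
    then obtain a b c where abc: "a \<noteq> 0 \<or> b \<noteq> 0 \<or> c \<noteq> 0"
       "a = l * m1 * a * G x1 x1 + l * m2 * b * G x2 x1 + r * c * G t x1"
       "b = l * m1 * a * G x1 x2 + l * m2 * b * G x2 x2 + r * c * G t x2"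
       "c = l * m1 * a * G x1 t + l * m2 * b * G x2 t + r * c * G t t" by blast
    define y where "y u = l * m1 * a * G x1 u + l * m2 * b * G x2 u + r * c * G t u" for u
    have yv: "y x1 = a" "y x2 = b" "y t = c" unfolding y_def using abc(2-4) by simp_all
    have "y u = (\<Sum>s\<in>?P. weight t l s * y s * G s u)" if u: "u \<in> {0..1}" for u
      unfolding weight_sum[OF u t] yv by (simp add: y_def)
    then have "delta_solution q ?P (weight t l) y"
      by (rule Green_solution[OF P]) auto
    moreover have "dirichlet_nontrivial y"
    proof -
      have "y 0 = 0" "y 1 = 0" unfolding y_def using Green_boundary xs t by auto
      moreover have "\<exists>u\<in>{0..1}. y u \<noteq> 0" using abc(1) yv xs t by metis
      ultimately show ?thesis by (simp add: dirichlet_nontrivial_def)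
    qed
    ultimately show ?lhs unfolding perturbed_eigenvalue_def weight_def[abs_def] by blast
  }
qed

lemma Green_sym: "G s t = G t s"
  by (simp add: Green_def min.commute max.commute)

lemma Green_values: "G x1 x1 = L x1 * R x1" "G x2 x2 = L x2 * R x2" "G x1 x2 = L x1 * R x2" "G x2 x1 = L x1 * R x2"
  using x by (simp_all add: Green_def)

lemma perturbed_eigenvalue_iff:
  assumes t: "t \<in> {0..1}"
  shows "perturbed_eigenvalue m1 m2 x1 x2 r q t l \<longleftrightarrow> char_fun t l = 0"
proof -
  define g1 g2 g where "g1 = G x1 t" and "g2 = G x2 t" and "g = G t t"
  have sym: "G t x1 = g1" "G t x2 = g2" by (simp_all add: g1_def g2_def Green_sym)
  define u where "u = L x1 * R x2"
  have "perturbed_eigenvalue m1 m2 x1 x2 r q t l \<longleftrightarrow>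
    (\<exists>a b c. (a \<noteq> 0 \<or> b \<noteq> 0 \<or> c \<noteq> 0) \<and>
       (1 - l * Z1) * a + (- l * m2 * u) * b + (- r * g1) * c = 0 \<and>
       (- l * m1 * u) * a + (1 - l * Z2) * b + (- r * g2) * c = 0 \<and>
       (- l * m1 * g1) * a + (- l * m2 * g2) * b + (1 - r * g) * c = 0)"
    unfolding perturbed_eigenvalue_iff_system[OF t] Green_values sym g1_def[symmetric] g2_def[symmetric]
      g_def[symmetric] u_def[symmetric] Z1_def Z2_def X1_def X2_def
    by (intro ex_cong1 conj_cong refl) (auto simp: algebra_simps)
  also have "\<dots> \<longleftrightarrow> char_fun t l = 0"
    unfolding homogeneous_3x3
  proof -
    have Z3: "Z3 = Z1 * Z2 - m1 * m2 * u\<^sup>2" using Z_rel by (simp add: u_def)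
    have "(1 - l * Z1) * (1 - l * Z2) * (1 - r * g) + (- l * m2 * u) * (- r * g2) * (- l * m1 * g1)
        + (- r * g1) * (- l * m1 * u) * (- l * m2 * g2) - (1 - l * Z1) * (- r * g2) * (- l * m2 * g2)
        - (- l * m2 * u) * (- l * m1 * u) * (1 - r * g) - (- r * g1) * (1 - l * Z2) * (- l * m1 * g1) = char_fun t l"
      unfolding char_fun_def Phi_def g1_def[symmetric] g2_def[symmetric] g_def[symmetric] u_def[symmetric]
        char_poly_def Z3 by (simp add: algebra_simps power2_eq_square)
    then show "((1 - l * Z1) * (1 - l * Z2) * (1 - r * g) + (- l * m2 * u) * (- r * g2) * (- l * m1 * g1)
        + (- r * g1) * (- l * m1 * u) * (- l * m2 * g2) - (1 - l * Z1) * (- r * g2) * (- l * m2 * g2)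
        - (- l * m2 * u) * (- l * m1 * u) * (1 - r * g) - (- r * g1) * (1 - l * Z2) * (- l * m1 * g1) = 0)
        = (char_fun t l = 0)" by (simp only:)
  qed
  finally show ?thesis .
qed

lemma Green_nonneg:
  assumes "s \<in> {0..1}" "t \<in> {0..1}"
  shows "G s t \<ge> 0"
proof -
  have "L u \<ge> 0" if "u \<in> {0..1}" for u
    using Lpos[of u] that L0 by (cases "u = 0") auto
  moreover have "R u \<ge> 0" if "u \<in> {0..1}" for u
    using Rpos[of u] that R1 by (cases "u = 1") auto
  ultimately show ?thesis unfolding Green_def using assms by (simp add: min_def max_def)
qed

text \<open>Here \<open>1 - l * Z1\<close> and \<open>1 - l * Z2\<close> are positive, and Green's function is nonnegative.\<close>

lemma Phi_at_first_root:
  assumes l: "l > 0" "E l = 0" "l * Z1 < 1" "l * Z2 < 1" and t: "t \<in> {0..1}"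
  shows "Phi t l \<ge> 0" "t \<in> {0<..<1} \<Longrightarrow> Phi t l > 0"
proof -
  have xs: "x1 \<in> {0..1}" "x2 \<in> {0..1}" using x by auto
  have n: "l * m2 * (G x2 t)\<^sup>2 * (1 - l * Z1) \<ge> 0" "2 * l\<^sup>2 * m1 * m2 * (L x1 * R x2) * G x1 t * G x2 t \<ge> 0"
    using l m pos12 Green_nonneg[OF xs(1) t] Green_nonneg[OF xs(2) t] by (auto intro!: mult_nonneg_nonneg)
  have "l * m1 * (G x1 t)\<^sup>2 * (1 - l * Z2) \<ge> 0" using l m by (auto intro!: mult_nonneg_nonneg)
  then show "Phi t l \<ge> 0" using n l by (simp add: Phi_def)
  assume "t \<in> {0<..<1}"
  then have "G x1 t > 0" using x Lpos Rpos by (auto simp: Green_def intro!: mult_pos_pos)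
  then have "l * m1 * (G x1 t)\<^sup>2 * (1 - l * Z2) > 0" using l m by (auto intro!: mult_pos_pos)
  then show "Phi t l > 0" using n unfolding Phi_def l(2) by linarith
qed

text \<open>At a zero of \<open>E\<close> the value \<open>Phi t l\<close> is a quadratic form in \<open>G x1 t\<close> and \<open>G x2 t\<close> whose
  discriminant is zero, so it is semidefinite; the signs of \<open>1 - l * Z1\<close> and \<open>1 - l * Z2\<close>
  decide which way.\<close>

lemma Phi_at_second_root:
  assumes l: "l > 0" "E l = 0" "1 < l * Z1" "1 < l * Z2"
  shows "Phi t l \<le> 0"
proof -
  define \<alpha> \<beta> \<gamma> where "\<alpha> = m1 * (l * Z2 - 1)" and "\<beta> = m2 * (l * Z1 - 1)" and "\<gamma> = l * m1 * m2 * (L x1 * R x2)"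
  have "(1 - l * Z1) * (1 - l * Z2) = l\<^sup>2 * (m1 * m2 * (L x1 * R x2)\<^sup>2)"
    using l(2) unfolding char_poly_eq Z_rel by simp
  moreover have "\<alpha> * \<beta> = m1 * m2 * ((1 - l * Z1) * (1 - l * Z2))" by (simp add: \<alpha>_def \<beta>_def algebra_simps)
  ultimately have "\<alpha> * \<beta> = \<gamma>\<^sup>2" by (simp add: \<gamma>_def power2_eq_square mult_ac)
  moreover have "\<alpha> > 0" using l m by (simp add: \<alpha>_def)
  ultimately have q: "\<alpha> * (G x1 t)\<^sup>2 + \<beta> * (G x2 t)\<^sup>2 - 2 * \<gamma> * G x1 t * G x2 t \<ge> 0" by (intro quadratic_form_nonneg)
  have "Phi t l = - l * (\<alpha> * (G x1 t)\<^sup>2 + \<beta> * (G x2 t)\<^sup>2 - 2 * \<gamma> * G x1 t * G x2 t)"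
    unfolding Phi_def l(2) \<alpha>_def \<beta>_def \<gamma>_def by (simp add: algebra_simps power2_eq_square)
  then show ?thesis using q l by (simp add: mult_nonneg_nonneg)
qed

lemma char_fun_quadratic: "\<exists>d0 d1 d2. \<forall>l. char_fun t l = d0 + d1 * l + d2 * l\<^sup>2"
  by (rule exI[of _ "1 - r * G t t"],
      rule exI[of _ "- (Z1 + Z2) - r * (G t t * (- (Z1 + Z2)) + m1 * (G x1 t)\<^sup>2 + m2 * (G x2 t)\<^sup>2)"],
      rule exI[of _ "Z3 - r * (G t t * Z3 - m1 * (G x1 t)\<^sup>2 * Z2 - m2 * (G x2 t)\<^sup>2 * Z1
        + 2 * m1 * m2 * (L x1 * R x2) * G x1 t * G x2 t)"])
     (simp add: char_fun_def Phi_def char_poly_def algebra_simps power2_eq_square)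

text \<open>The function \<open>char_fun t\<close> is nonpositive at the smaller zero of \<open>E\<close> and nonnegative at the
  larger one, so it has a zero. It is a polynomial of degree at most two that does not
  vanish identically, so there is a smallest zero.\<close>

lemma first_eigenvalue_exists:
  assumes t: "t \<in> {0..1}"
  defines "lam \<equiv> first_eigenvalue m1 m2 x1 x2 r q t"
  shows "perturbed_eigenvalue m1 m2 x1 x2 r q t lam"
    and "perturbed_eigenvalue m1 m2 x1 x2 r q t l \<Longrightarrow> lam \<le> l"
proof -
  obtain k1 where k1: "k1 > 0" "E k1 = 0" "k1 * Z1 < 1" "k1 * Z2 < 1" using char_poly_roots(1)[OF Z_pos] by blast
  obtain k2 where k2: "k2 > 0" "E k2 = 0" "1 < k2 * Z1" "1 < k2 * Z2" using char_poly_roots(2)[OF Z_pos] by blast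
  have k12: "k1 \<le> k2"
  proof -
    have "k1 * Z1 < k2 * Z1" using k1 k2 by linarith
    then show ?thesis using Z_pos by simp
  qed
  have c1: "char_fun t k1 \<le> 0" using Phi_at_first_root(1)[OF k1 t] k1 r by (simp add: char_fun_def)
  have c2: "char_fun t k2 \<ge> 0" using Phi_at_second_root[OF k2, of t] k2 r by (simp add: char_fun_def mult_le_0_iff)
  have nz: "\<exists>l. char_fun t l \<noteq> 0"
  proof (cases "t \<in> {0<..<1}")
    case True
    then have "char_fun t k1 < 0" using Phi_at_first_root(2)[OF k1 t] k1 r by (simp add: char_fun_def)
    then show ?thesis by (intro exI[of _ k1]) simp
  next
    case False
    then have "t = 0 \<or> t = 1" using t by auto
    then have "G t t = 0" using L0 R1 by (auto simp: Green_def)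
    then show ?thesis by (intro exI[of _ 0]) (simp add: char_fun_def Phi_def char_poly_def)
  qed
  obtain d0 d1 d2 where d: "\<And>l. char_fun t l = d0 + d1 * l + d2 * l\<^sup>2" using char_fun_quadratic by blast
  have dp: "char_fun t l = poly [:d0, d1, d2:] l" for l by (simp add: d power2_eq_square algebra_simps)
  have "[:d0, d1, d2:] \<noteq> 0" using nz dp by (metis poly_0)
  then have fin: "finite {l. char_fun t l = 0}" using poly_roots_finite[of "[:d0, d1, d2:]"] dp by simp
  have "\<exists>l\<ge>k1. l \<le> k2 \<and> char_fun t l = 0"
    using c1 c2 k12 by (intro IVT') (auto simp: d intro!: continuous_intros)
  then have ne: "{l. char_fun t l = 0} \<noteq> {}" by blast
  have lam: "lam = Min {l. char_fun t l = 0}"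
    unfolding lam_def first_eigenvalue_def perturbed_eigenvalue_iff[OF t]
    by (rule Least_equality) (use Min_in[OF fin ne] Min_le[OF fin] in auto)
  show "perturbed_eigenvalue m1 m2 x1 x2 r q t lam"
    unfolding perturbed_eigenvalue_iff[OF t] lam using Min_in[OF fin ne] by simp
  show "perturbed_eigenvalue m1 m2 x1 x2 r q t l \<Longrightarrow> lam \<le> l"
    unfolding perturbed_eigenvalue_iff[OF t] lam using Min_le[OF fin] by simp
qed

lemma char_fun_first_eigenvalue:
  "t \<in> {0..1} \<Longrightarrow> char_fun t (first_eigenvalue m1 m2 x1 x2 r q t) = 0"
  using first_eigenvalue_exists(1) perturbed_eigenvalue_iff by blast

end

section \<open>Differential equations, determination of the masses, recovery\<close>

text \<open>The product of \<open>\<phi> \<psi>\<close> and \<open>V'\<close> as a polynomial in \<open>V\<close>, for a point to the left of both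
  masses. The exchange of \<open>L\<close> with \<open>R\<close> and of the indices \<open>1\<close> and \<open>2\<close> turns it into the
  corresponding identity for \<open>U\<close> to the right of both masses.\<close>

lemma left_interval_identity:
  fixes L1 R1 L2 R2 Lt Rt m1 m2 l :: real
  assumes nz: "L1 \<noteq> 0" "R1 \<noteq> 0" "Rt \<noteq> 0"
  defines "Z1 \<equiv> m1 * (L1 * R1)" and "Z2 \<equiv> m2 * (L2 * R2)"
  defines "Z3 \<equiv> Z1 * Z2 - m1 * m2 * (L1 * R2)\<^sup>2" and "A \<equiv> m2 * L1 * R2\<^sup>2 / R1" and "V \<equiv> R1 * Lt / (L1 * Rt)"
  shows "(R1 / (L1 * Rt\<^sup>2)) * (Lt * Rt * e + l * m1 * (Lt * R1)\<^sup>2 * (1 - l * Z2) + l * m2 * (Lt * R2)\<^sup>2 * (1 - l * Z1)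
      + 2 * l\<^sup>2 * m1 * m2 * (L1 * R2) * (Lt * R1) * (Lt * R2)) = V * (l * (A + Z1 - l * Z3) * V + e)"
proof -
  have Lt: "Lt = V * (L1 * Rt / R1)" using nz by (simp add: V_def)
  have ZA: "Z1 * A = m1 * m2 * (L1 * R2)\<^sup>2" using nz by (simp add: Z1_def A_def power2_eq_square)
  have a: "(R1 / (L1 * Rt\<^sup>2)) * (Lt * Rt * e) = V * e"
    unfolding Lt using nz by (simp add: power2_eq_square)
  have b: "(R1 / (L1 * Rt\<^sup>2)) * (l * m1 * (Lt * R1)\<^sup>2 * (1 - l * Z2)) = V\<^sup>2 * (l * Z1 * (1 - l * Z2))"
    unfolding Lt using nz by (simp add: power2_eq_square Z1_def)
  have c: "(R1 / (L1 * Rt\<^sup>2)) * (l * m2 * (Lt * R2)\<^sup>2 * (1 - l * Z1)) = V\<^sup>2 * (l * A * (1 - l * Z1))"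
    unfolding Lt A_def using nz by (simp add: power2_eq_square)
  have d: "(R1 / (L1 * Rt\<^sup>2)) * (2 * l\<^sup>2 * m1 * m2 * (L1 * R2) * (Lt * R1) * (Lt * R2)) = V\<^sup>2 * (2 * l\<^sup>2 * (Z1 * A))"
    unfolding Lt ZA using nz by (simp add: power2_eq_square)
  show ?thesis
    unfolding distrib_left a b c d Z3_def ZA[symmetric] by (simp add: algebra_simps power2_eq_square)
qed

lemma middle_interval_identity:
  fixes L1 R1 L2 R2 Lt Rt m1 m2 l :: real
  assumes nz: "L1 \<noteq> 0" "R1 \<noteq> 0" "Rt \<noteq> 0"
  defines "Z1 \<equiv> m1 * (L1 * R1)" and "Z2 \<equiv> m2 * (L2 * R2)"
  defines "A \<equiv> m2 * L1 * R2\<^sup>2 / R1" and "V \<equiv> R1 * Lt / (L1 * Rt)"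
  assumes e: "e = (1 - l * Z1) * (1 - l * Z2) - l\<^sup>2 * (m1 * m2 * (L1 * R2)\<^sup>2)"
  shows "(R1 / (L1 * Rt\<^sup>2)) * (Lt * Rt * e + l * m1 * (L1 * Rt)\<^sup>2 * (1 - l * Z2) + l * m2 * (Lt * R2)\<^sup>2 * (1 - l * Z1)
      + 2 * l\<^sup>2 * m1 * m2 * (L1 * R2) * (L1 * Rt) * (Lt * R2)) = ((1 - l * Z1) * V + l * Z1) * (l * A * V + (1 - l * Z2))"
proof -
  have Lt: "Lt = V * (L1 * Rt / R1)" using nz by (simp add: V_def)
  have ZA: "Z1 * A = m1 * m2 * (L1 * R2)\<^sup>2" using nz by (simp add: Z1_def A_def power2_eq_square)
  have a: "(R1 / (L1 * Rt\<^sup>2)) * (Lt * Rt * e) = V * e"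
    unfolding Lt using nz by (simp add: power2_eq_square)
  have b: "(R1 / (L1 * Rt\<^sup>2)) * (l * m1 * (L1 * Rt)\<^sup>2 * (1 - l * Z2)) = l * Z1 * (1 - l * Z2)"
    using nz by (simp add: power2_eq_square Z1_def)
  have c: "(R1 / (L1 * Rt\<^sup>2)) * (l * m2 * (Lt * R2)\<^sup>2 * (1 - l * Z1)) = V\<^sup>2 * (l * A * (1 - l * Z1))"
    unfolding Lt A_def using nz by (simp add: power2_eq_square)
  have d: "(R1 / (L1 * Rt\<^sup>2)) * (2 * l\<^sup>2 * m1 * m2 * (L1 * R2) * (L1 * Rt) * (Lt * R2)) = V * (2 * l\<^sup>2 * (Z1 * A))"
    unfolding Lt ZA using nz by (simp add: power2_eq_square)
  show ?thesis
    unfolding distrib_left a b c d unfolding e ZA[symmetric] by (simp add: algebra_simps power2_eq_square)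
qed

context two_mass
begin

abbreviation "lam \<equiv> first_eigenvalue m1 m2 x1 x2 r q"

text \<open>Since the derivative of \<open>L / R\<close> is \<open>1 / R\<^sup>2\<close> and that of \<open>R / L\<close> is \<open>-1 / L\<^sup>2\<close>, these are
  closed forms of the integrals \<open>V_fun\<close> and \<open>U_fun\<close>.\<close>

definition V :: "real \<Rightarrow> real" where "V t = R x1 * L t / (L x1 * R t)"
definition U :: "real \<Rightarrow> real" where "U t = L x2 * R t / (R x2 * L t)"
definition V' :: "real \<Rightarrow> real" where "V' t = R x1 / (L x1 * (R t)\<^sup>2)"
definition U' :: "real \<Rightarrow> real" where "U' t = - (L x2 / (R x2 * (L t)\<^sup>2))"

lemma V_values: "V x1 = 1" "V x2 = Z1 * Z2 / (Z1 * Z2 - Z3)" "U x2 = 1"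
proof -
  show "V x1 = 1" "U x2 = 1" using pos12 by (simp_all add: V_def U_def)
  show "V x2 = Z1 * Z2 / (Z1 * Z2 - Z3)"
    unfolding Z_rel unfolding V_def Z1_def Z2_def X1_def X2_def using pos12 m
    by (simp add: field_simps power2_eq_square)
qed

lemma VU_pos: "t \<in> {0<..<1} \<Longrightarrow> V t > 0" "t \<in> {0<..<1} \<Longrightarrow> U t > 0"
  using pos12 Lpos[of t] Rpos[of t] by (simp_all add: V_def U_def)

lemma V'_pos: "t \<in> {0..<1} \<Longrightarrow> V' t > 0"
  and U'_neg: "t \<in> {0<..1} \<Longrightarrow> U' t < 0"
  using pos12 Lpos[of t] Rpos[of t] by (simp_all add: V'_def U'_def)

lemma V_derivative: "t \<in> {0<..<1} \<Longrightarrow> (V has_real_derivative V' t) (at t)"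
  and U_derivative: "t \<in> {0<..<1} \<Longrightarrow> (U has_real_derivative U' t) (at t)"
  using DERIV_cmult[OF ratio_derivative(1), of t "R x1 / L x1"] DERIV_cmult[OF ratio_derivative(2), of t "L x2 / R x2"]
  by (simp_all add: V_def[abs_def] U_def[abs_def] V'_def U'_def)

lemma V_strict_mono: "0 < s \<Longrightarrow> s < t \<Longrightarrow> t < 1 \<Longrightarrow> V s < V t"
  using mult_strict_left_mono[OF ratio_less[of s t], of "R x1 / L x1"] pos12 by (simp add: V_def)

lemma V_fun_eq: "t \<in> {0..<1} \<Longrightarrow> V_fun x1 L R t = V t"
proof -
  assume t: "t \<in> {0..<1}"
  have sub: "{0..t} \<subseteq> {0..1}" using t by auto
  have "((\<lambda>s. 1 / (R s)\<^sup>2) has_integral (L t / R t - L 0 / R 0)) {0..t}"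
  proof (rule fundamental_theorem_of_calculus_interior)
    have "R s \<noteq> 0" if "s \<in> {0..t}" for s using Rpos[of s] that t by auto
    then show "continuous_on {0..t} (\<lambda>s. L s / R s)"
      by (intro continuous_intros continuous_on_subset[OF contL sub] continuous_on_subset[OF contR sub]) blast
    show "((\<lambda>s. L s / R s) has_vector_derivative 1 / (R s)\<^sup>2) (at s)" if "s \<in> {0<..<t}" for s
      using ratio_derivative(1)[of s] that t by (simp add: has_real_derivative_iff_has_vector_derivative)
  qed (use t in auto)
  from integral_unique[OF this] have "integral {0..t} (\<lambda>s. 1 / (R s)\<^sup>2) = L t / R t" using L0 by simp
  then show ?thesis by (simp add: V_fun_def V_def)
qed

lemma U_fun_eq: "t \<in> {0<..1} \<Longrightarrow> U_fun x2 L R t = U t"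
proof -
  assume t: "t \<in> {0<..1}"
  have sub: "{t..1} \<subseteq> {0..1}" using t by auto
  have "((\<lambda>s. 1 / (L s)\<^sup>2) has_integral (- (R 1 / L 1) - - (R t / L t))) {t..1}"
  proof (rule fundamental_theorem_of_calculus_interior)
    have "L s \<noteq> 0" if "s \<in> {t..1}" for s using Lpos[of s] that t by auto
    then show "continuous_on {t..1} (\<lambda>s. - (R s / L s))"
      by (intro continuous_intros continuous_on_subset[OF contL sub] continuous_on_subset[OF contR sub]) blast
    show "((\<lambda>s. - (R s / L s)) has_vector_derivative 1 / (L s)\<^sup>2) (at s)" if "s \<in> {t<..<1}" for s
      using DERIV_minus[OF ratio_derivative(2)[of s]] that t by (simp add: has_real_derivative_iff_has_vector_derivative)
  qed (use t in auto)
  from integral_unique[OF this] have "integral {t..1} (\<lambda>s. 1 / (L s)\<^sup>2) = R t / L t" using R1 by simp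
  then show ?thesis by (simp add: U_fun_def U_def)
qed

lemma A_eqs: "(Z1 * Z2 - Z3) / Z1 = m2 * L x1 * (R x2)\<^sup>2 / R x1" "(Z1 * Z2 - Z3) / Z2 = m1 * R x2 * (L x1)\<^sup>2 / L x2"
  unfolding Z_rel using pos12 m by (simp_all add: Z1_def Z2_def X1_def X2_def power2_eq_square)

lemma Z3_eq: "Z3 = Z1 * Z2 - m1 * m2 * (L x1 * R x2)\<^sup>2"
  using Z_rel by simp

lemma Z12_eq: "Z1 = m1 * (L x1 * R x1)" "Z2 = m2 * (L x2 * R x2)"
  by (simp_all add: Z1_def Z2_def X1_def X2_def)

lemma Phi_left:
  assumes "t \<in> {0<..x1}"
  shows "V' t * Phi t l = V t * (l * ((Z1 * Z2 - Z3) / Z1 + Z1 - l * Z3) * V t + E l)"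
proof -
  have G: "G t t = L t * R t" "G x1 t = L t * R x1" "G x2 t = L t * R x2"
    using assms x by (simp_all add: Green_def)
  have "R t > 0" using Rpos assms x by auto
  then show ?thesis
    using left_interval_identity[of "L x1" "R x1" "R t" "L t" "E l" l m1 m2 "L x2" "R x2"] pos12
    unfolding Phi_def G A_eqs V'_def V_def Z12_eq[symmetric] Z3_eq[symmetric] by simp
qed

lemma Phi_middle:
  assumes "t \<in> {x1..x2}"
  shows "V' t * Phi t l = riccati_rhs Z1 Z2 Z3 l (V t)"
proof -
  have G: "G t t = L t * R t" "G x1 t = L x1 * R t" "G x2 t = L t * R x2"
    using assms x by (auto simp: Green_def min_absorb1 max_absorb2 min_absorb2 max_absorb1)
  have "R t > 0" using Rpos assms x by auto
  then have nz: "L x1 \<noteq> 0" "R x1 \<noteq> 0" "R t \<noteq> 0" using pos12 by auto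
  have e: "E l = (1 - l * (m1 * (L x1 * R x1))) * (1 - l * (m2 * (L x2 * R x2))) - l\<^sup>2 * (m1 * m2 * (L x1 * R x2)\<^sup>2)"
    by (simp only: char_poly_eq Z_rel Z12_eq[symmetric])
  note I = middle_interval_identity[OF nz e, of "L t", unfolded Z12_eq[symmetric]]
  show ?thesis unfolding Phi_def G riccati_rhs_def A_eqs(1) V'_def V_def using I .
qed

lemma Phi_right:
  assumes "t \<in> {x2..<1}"
  shows "- U' t * Phi t l = U t * (l * ((Z1 * Z2 - Z3) / Z2 + Z2 - l * Z3) * U t + E l)"
proof -
  have G: "G t t = R t * L t" "G x1 t = R t * L x1" "G x2 t = R t * L x2"
    using assms x by (auto simp: Green_def min_absorb1 max_absorb2)
  have Lt: "L t > 0" using Lpos assms x by auto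
  have c: "m2 * (R x2 * L x2) = Z2" "m1 * (R x1 * L x1) = Z1" "Z2 * Z1 - m2 * m1 * (R x2 * L x1)\<^sup>2 = Z3"
    by (simp_all add: Z12_eq Z3_eq mult_ac)
  have U: "L x2 * R t / (R x2 * L t) = U t" "L x2 / (R x2 * (L t)\<^sup>2) = - U' t" by (simp_all add: U_def U'_def)
  have Phi: "Phi t l = R t * L t * E l + l * m2 * (R t * L x2)\<^sup>2 * (1 - l * Z1) + l * m1 * (R t * L x1)\<^sup>2 * (1 - l * Z2)
      + 2 * l\<^sup>2 * m2 * m1 * (R x2 * L x1) * (R t * L x2) * (R t * L x1)"
    unfolding Phi_def G by (simp add: algebra_simps)
  have "R x2 \<noteq> 0" "L x2 \<noteq> 0" "L t \<noteq> 0" using pos12 Lt by auto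
  note I = left_interval_identity[OF this, of "R t" "E l" l m2 m1 "R x1" "L x1", unfolded c U]
  show ?thesis unfolding Phi A_eqs(2) using I .
qed

lemma E_lam: "t \<in> {0..1} \<Longrightarrow> E (lam t) = r * Phi t (lam t)"
  using char_fun_first_eigenvalue[of t] by (simp add: char_fun_def)

text \<open>At \<open>l = lam t\<close> the eigenvalue equation \<open>E l = r * Phi t l\<close> turns the identity for
  \<open>V' t * Phi t l\<close> into the differential equation.\<close>

lemma left_ode:
  assumes t: "t \<in> {0<..x1}"
  shows "E (lam t) \<noteq> 0"
    and "l = lam t \<Longrightarrow> V' t = r * V t * (l * ((Z1 * Z2 - Z3) / Z1 + Z1 - l * Z3) / E l * V t + 1)"
proof -
  have t01: "t \<in> {0..1}" "t \<in> {0<..<1}" using t x by auto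
  have "V' t * E (lam t) = r * (V' t * Phi t (lam t))" by (subst E_lam[OF t01(1)]) simp
  then have eq: "V' t * E (lam t) = r * (V t * (lam t * ((Z1 * Z2 - Z3) / Z1 + Z1 - lam t * Z3) * V t + E (lam t)))"
    unfolding Phi_left[OF t] .
  show nz: "E (lam t) \<noteq> 0"
  proof
    assume E0: "E (lam t) = 0"
    then show False using eq r VU_pos(1)[OF t01(2)] slope_nonzero[OF Z_pos E0] by simp
  qed
  assume l: "l = lam t"
  show "V' t = r * V t * (l * ((Z1 * Z2 - Z3) / Z1 + Z1 - l * Z3) / E l * V t + 1)"
    using eq nz unfolding l by (simp add: field_simps)
qed

lemma middle_ode:
  assumes t: "t \<in> {x1..x2}"
  shows "E (lam t) * V' t = r * riccati_rhs Z1 Z2 Z3 (lam t) (V t)"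
  using E_lam[of t] t x unfolding Phi_middle[OF t, symmetric] by simp

lemma right_ode:
  assumes t: "t \<in> {x2..<1}"
  shows "E (lam t) \<noteq> 0"
    and "l = lam t \<Longrightarrow> U' t = - r * U t * (l * ((Z1 * Z2 - Z3) / Z2 + Z2 - l * Z3) / E l * U t + 1)"
proof -
  have t01: "t \<in> {0..1}" "t \<in> {0<..<1}" using t x by auto
  have "- U' t * E (lam t) = r * (- U' t * Phi t (lam t))" by (subst E_lam[OF t01(1)]) simp
  then have eq: "- U' t * E (lam t) = r * (U t * (lam t * ((Z1 * Z2 - Z3) / Z2 + Z2 - lam t * Z3) * U t + E (lam t)))"
    unfolding Phi_right[OF t] .
  have sym: "char_poly Z2 Z1 Z3 = E" by (simp add: char_poly_def fun_eq_iff add.commute)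
  show nz: "E (lam t) \<noteq> 0"
  proof
    assume E0: "E (lam t) = 0"
    have "lam t * ((Z2 * Z1 - Z3) / Z2 + Z2 - lam t * Z3) \<noteq> 0"
      by (rule slope_nonzero) (use Z_pos E0 sym in \<open>auto simp: mult.commute\<close>)
    then show False using eq r VU_pos(2)[OF t01(2)] E0 by (simp add: mult.commute)
  qed
  assume l: "l = lam t"
  have "- U' t = r * U t * (l * ((Z1 * Z2 - Z3) / Z2 + Z2 - l * Z3) / E l * U t + 1)"
    using eq nz unfolding l by (simp add: field_simps)
  then show "U' t = - r * U t * (l * ((Z1 * Z2 - Z3) / Z2 + Z2 - l * Z3) / E l * U t + 1)" by simp
qed

lemma exceptional_point_unique:
  assumes s: "s \<in> {x1..x2}" "E l = 0" "riccati_rhs Z1 Z2 Z3 l (V s) = 0"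
    and t: "t \<in> {x1..x2}" "E k = 0" "riccati_rhs Z1 Z2 Z3 k (V t) = 0"
  shows "s = t"
proof -
  have st: "s \<in> {0<..<1}" "t \<in> {0<..<1}" using s t x by auto
  have "V s = V t"
    using common_zero_unique[OF Z_pos VU_pos(1)[OF st(1)] s(2,3) VU_pos(1)[OF st(2)] t(2,3)] .
  then show ?thesis
    using V_strict_mono[of s t] V_strict_mono[of t s] st by (cases s t rule: linorder_cases) auto
qed

lemma at_most_one_exception:
  assumes s: "s \<in> {x1..x2}" "E (lam s) = 0" and t: "t \<in> {x1..x2}" "E (lam t) = 0"
  shows "s = t"
  using exceptional_point_unique[OF s _ t] middle_ode[OF s(1)] middle_ode[OF t(1)] s(2) t(2) r by simp

text \<open>The eigenvalue equation at \<open>t = 0\<close>, \<open>x1\<close>, \<open>x2\<close>. For \<open>t = x1\<close> the perturbation merges with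
  the first mass, as \<open>l * m1 + r = (l + r / m1) * m1\<close>, and similarly for \<open>t = x2\<close>. So all
  three relations place a point on the same hyperbola: \<open>(a, b) = (lam 0, lam 0)\<close>,
  \<open>(lam x1 + r / m1, lam x1)\<close>, \<open>(lam x2, lam x2 + r / m2)\<close>.\<close>

lemma mass_relations:
  "1 - lam 0 * Z1 - lam 0 * Z2 + lam 0 * lam 0 * Z3 = 0"
  "1 - (lam x1 + r / m1) * Z1 - lam x1 * Z2 + (lam x1 + r / m1) * lam x1 * Z3 = 0"
  "1 - lam x2 * Z1 - (lam x2 + r / m2) * Z2 + lam x2 * (lam x2 + r / m2) * Z3 = 0"
proof -
  have "Phi 0 (lam 0) = 0"
    using Green_boundary[of x1] Green_boundary[of x2] Green_boundary[of 0] x by (simp add: Phi_def)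
  then show "1 - lam 0 * Z1 - lam 0 * Z2 + lam 0 * lam 0 * Z3 = 0"
    using E_lam[of 0] by (simp add: char_poly_def algebra_simps power2_eq_square)
  have a: "V' x1 = m1 / Z1" using m pos12 by (simp add: V'_def Z12_eq power2_eq_square)
  have "E (lam x1) * (m1 / Z1) = r * (lam x1 * ((Z1 * Z2 - Z3) / Z1) + (1 - lam x1 * Z2))"
    using middle_ode[of x1] x unfolding a riccati_rhs_def V_values by simp
  then have "E (lam x1) * m1 = r * (Z1 - lam x1 * Z3)" using Z_pos by (simp add: field_simps)
  then have "E (lam x1) = r / m1 * (Z1 - lam x1 * Z3)" using m by (simp add: field_simps)
  then show "1 - (lam x1 + r / m1) * Z1 - lam x1 * Z2 + (lam x1 + r / m1) * lam x1 * Z3 = 0"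
    by (simp add: char_poly_def algebra_simps power2_eq_square)
  have b: "- U' x2 = m2 / Z2" using m pos12 by (simp add: U'_def Z12_eq power2_eq_square)
  have "Phi x2 (lam x2) * (m2 / Z2) = lam x2 * ((Z1 * Z2 - Z3) / Z2 + Z2 - lam x2 * Z3) + E (lam x2)"
    using Phi_right[of x2 "lam x2"] x unfolding b V_values by (simp add: mult.commute)
  also have "\<dots> = (Z2 - lam x2 * Z3) / Z2"
    using Z_pos by (simp add: char_poly_def field_simps power2_eq_square)
  finally have "Phi x2 (lam x2) * m2 = Z2 - lam x2 * Z3" using Z_pos by (simp add: field_simps)
  then have "Phi x2 (lam x2) = (Z2 - lam x2 * Z3) / m2" using m by (simp add: field_simps)
  then have "E (lam x2) = r / m2 * (Z2 - lam x2 * Z3)" using E_lam[of x2] x by simp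
  then show "1 - lam x2 * Z1 - (lam x2 + r / m2) * Z2 + lam x2 * (lam x2 + r / m2) * Z3 = 0"
    by (simp add: char_poly_def algebra_simps power2_eq_square)
qed

text \<open>The three points on the hyperbola satisfy \<open>a = b\<close>, \<open>a > b\<close> and \<open>a < b\<close>, so they are
  distinct.\<close>

lemma Z_determined:
  assumes Y: "1 - lam 0 * Y1 - lam 0 * Y2 + lam 0 * lam 0 * Y3 = 0"
    "1 - (lam x1 + r / m1) * Y1 - lam x1 * Y2 + (lam x1 + r / m1) * lam x1 * Y3 = 0"
    "1 - lam x2 * Y1 - (lam x2 + r / m2) * Y2 + lam x2 * (lam x2 + r / m2) * Y3 = 0"
  shows "Y1 = Z1 \<and> Y2 = Z2 \<and> Y3 = Z3"
proof (rule hyperbola_determined)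
  define a b where "a i = (if i = (0::nat) then lam 0 else if i = 1 then lam x1 + r / m1 else lam x2)"
    and "b i = (if i = (0::nat) then lam 0 else if i = 1 then lam x1 else lam x2 + r / m2)" for i
  have p: "r / m1 > 0" "r / m2 > 0" using r m by auto
  show "a 0 \<noteq> a 1 \<or> b 0 \<noteq> b 1" "a 0 \<noteq> a 2 \<or> b 0 \<noteq> b 2" "a 1 \<noteq> a 2 \<or> b 1 \<noteq> b 2"
    using p by (auto simp: a_def b_def)
  show "1 - a i * Z1 - b i * Z2 + a i * b i * Z3 = 0" if "i \<in> {0, 1, 2}" for i
    using mass_relations that by (auto simp: a_def b_def)
  show "1 - a i * Y1 - b i * Y2 + a i * b i * Y3 = 0" if "i \<in> {0, 1, 2}" for i
    using Y that by (auto simp: a_def b_def)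
qed (use Z_pos in auto)

text \<open>Start with \<open>\<phi> = L\<close> on the first interval and with \<open>\<psi> = R\<close> on the last one, and cross the
  masses by the jump relation.\<close>

lemma connection_formulas:
  assumes "connection_coeffs m1 m2 x1 x2 q L R \<alpha> \<beta> \<mu> \<gamma>"
  shows "\<alpha> 2 l = 1 - l * Z1" "\<beta> 2 l * R x1 / L x1 = l * Z1" "\<alpha> 3 l = E l"
    "\<beta> 3 l * R x2 / L x2 = l * ((Z1 * Z2 - Z3) / Z2 + Z2 - l * Z3)"
    "\<gamma> 2 l = 1 - l * Z2" "\<mu> 2 l * L x1 / R x1 = l * ((Z1 * Z2 - Z3) / Z1)" "\<gamma> 1 l = E l"
    "\<mu> 1 l * L x1 / R x1 = l * ((Z1 * Z2 - Z3) / Z1 + Z1 - l * Z3)"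
proof -
  let ?\<kappa> = "\<lambda>s. l * (if s = x1 then m1 else m2)"
  obtain \<phi> \<psi> where sol: "delta_solution q {x1, x2} ?\<kappa> \<phi>" "delta_solution q {x1, x2} ?\<kappa> \<psi>"
    and \<phi>0: "\<phi> 0 = 0" "\<exists>d. (\<phi> has_real_derivative d) (at_right 0) \<and> (L has_real_derivative d) (at_right 0)"
    and \<psi>1: "\<psi> 1 = 0" "\<exists>d. (\<psi> has_real_derivative d) (at_left 1) \<and> (R has_real_derivative d) (at_left 1)"
    and rep: "\<And>j t. j \<in> {1, 2, 3} \<Longrightarrow> t \<in> {node x1 x2 (j - 1)..node x1 x2 j} \<Longrightarrow>
        \<phi> t = \<alpha> j l * L t + \<beta> j l * R t \<and> \<psi> t = \<mu> j l * L t + \<gamma> j l * R t"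
    using assms unfolding connection_coeffs_def by meson
  have \<phi>: "\<And>t. t \<in> {0..x1} \<Longrightarrow> \<phi> t = \<alpha> 1 l * L t + \<beta> 1 l * R t"
    "\<And>t. t \<in> {x1..x2} \<Longrightarrow> \<phi> t = \<alpha> 2 l * L t + \<beta> 2 l * R t"
    "\<And>t. t \<in> {x2..1} \<Longrightarrow> \<phi> t = \<alpha> 3 l * L t + \<beta> 3 l * R t"
    using rep[of 1] rep[of 2] rep[of 3] by (simp_all add: node_def)
  have \<psi>: "\<And>t. t \<in> {0..x1} \<Longrightarrow> \<psi> t = \<mu> 1 l * L t + \<gamma> 1 l * R t"
    "\<And>t. t \<in> {x1..x2} \<Longrightarrow> \<psi> t = \<mu> 2 l * L t + \<gamma> 2 l * R t"
    "\<And>t. t \<in> {x2..1} \<Longrightarrow> \<psi> t = \<mu> 3 l * L t + \<gamma> 3 l * R t"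
    using rep[of 1] rep[of 2] rep[of 3] by (simp_all add: node_def)
  have jump: "\<exists>dl dr. (y has_real_derivative dl) (at_left s) \<and> (y has_real_derivative dr) (at_right s) \<and> dl - dr = ?\<kappa> s * y s"
    if "delta_solution q {x1, x2} ?\<kappa> y" "s \<in> {x1, x2}" for y s
    using that unfolding delta_solution_def by blast
  have conn1: "c' = c - l * m1 * y x1 * R x1 \<and> d' = d + l * m1 * y x1 * L x1"
    if y: "delta_solution q {x1, x2} ?\<kappa> y" "\<And>t. t \<in> {0..x1} \<Longrightarrow> y t = c * L t + d * R t"
      "\<And>t. t \<in> {x1..x2} \<Longrightarrow> y t = c' * L t + d' * R t" for y c d c' d'
  proof -
    obtain dl dr where "(y has_real_derivative dl) (at_left x1)" "(y has_real_derivative dr) (at_right x1)"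
      "dl - dr = l * m1 * y x1" using jump[OF y(1), of x1] by auto
    from jump_relation[of 0 x1 x2, OF _ _ _ _ y(2,3) this] show ?thesis using x by auto
  qed
  have conn2: "c' = c - l * m2 * y x2 * R x2 \<and> d' = d + l * m2 * y x2 * L x2"
    if y: "delta_solution q {x1, x2} ?\<kappa> y" "\<And>t. t \<in> {x1..x2} \<Longrightarrow> y t = c * L t + d * R t"
      "\<And>t. t \<in> {x2..1} \<Longrightarrow> y t = c' * L t + d' * R t" for y c d c' d'
  proof -
    obtain dl dr where "(y has_real_derivative dl) (at_left x2)" "(y has_real_derivative dr) (at_right x2)"
      "dl - dr = l * m2 * y x2" using jump[OF y(1), of x2] x by auto
    from jump_relation[of x1 x2 1, OF _ _ _ _ y(2,3) this] show ?thesis using x by auto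
  qed
  have "\<beta> 1 l * R 0 = 0" using \<phi>(1)[of 0] \<phi>0(1) x L0 by simp
  then have \<beta>1: "\<beta> 1 l = 0" using R0_pos by simp
  have \<alpha>1: "\<alpha> 1 l = 1"
  proof -
    obtain d where d: "(\<phi> has_real_derivative d) (at_right 0)" "(L has_real_derivative d) (at_right 0)" using \<phi>0 by blast
    have "(\<phi> has_real_derivative \<alpha> 1 l * L' 0 + \<beta> 1 l * R' 0) (at_right 0)"
      by (rule combination_derivative_right[of 0 x1]) (use x \<phi>(1) in auto)
    moreover have "(L has_real_derivative 1 * L' 0 + 0 * R' 0) (at_right 0)"
      by (rule combination_derivative_right[of 0 x1]) (use x in auto)
    ultimately have "\<alpha> 1 l * L' 0 + \<beta> 1 l * R' 0 = d" "1 * L' 0 + 0 * R' 0 = d"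
      using d vector_derivative_unique_within[OF trivial_limit_at_right_real]
      by (metis has_real_derivative_iff_has_vector_derivative)+
    then show ?thesis using L'0 \<beta>1 by simp
  qed
  have "\<mu> 3 l * L 1 = 0" using \<psi>(3)[of 1] \<psi>1(1) x R1 by simp
  then have \<mu>3: "\<mu> 3 l = 0" using Lpos[of 1] by simp
  have \<gamma>3: "\<gamma> 3 l = 1"
  proof -
    obtain d where d: "(\<psi> has_real_derivative d) (at_left 1)" "(R has_real_derivative d) (at_left 1)" using \<psi>1 by blast
    have "(\<psi> has_real_derivative \<mu> 3 l * L' 1 + \<gamma> 3 l * R' 1) (at_left 1)"
      by (rule combination_derivative_left[of x2 1]) (use x \<psi>(3) in auto)
    moreover have "(R has_real_derivative 0 * L' 1 + 1 * R' 1) (at_left 1)"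
      by (rule combination_derivative_left[of x2 1]) (use x in auto)
    ultimately have "\<mu> 3 l * L' 1 + \<gamma> 3 l * R' 1 = d" "0 * L' 1 + 1 * R' 1 = d"
      using d vector_derivative_unique_within[OF trivial_limit_at_left_real]
      by (metis has_real_derivative_iff_has_vector_derivative)+
    then show ?thesis using R'1 \<mu>3 by simp
  qed
  have \<phi>x1: "\<phi> x1 = L x1" using \<phi>(1)[of x1] x \<alpha>1 \<beta>1 by simp
  have \<alpha>2: "\<alpha> 2 l = 1 - l * m1 * L x1 * R x1" and \<beta>2: "\<beta> 2 l = l * m1 * L x1 * L x1"
    using conn1[OF sol(1) \<phi>(1,2)] \<alpha>1 \<beta>1 \<phi>x1 by auto
  have \<phi>x2: "\<phi> x2 = \<alpha> 2 l * L x2 + \<beta> 2 l * R x2" using \<phi>(2)[of x2] x by simp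
  have \<alpha>3: "\<alpha> 3 l = \<alpha> 2 l - l * m2 * \<phi> x2 * R x2" and \<beta>3: "\<beta> 3 l = \<beta> 2 l + l * m2 * \<phi> x2 * L x2"
    using conn2[OF sol(1) \<phi>(2,3)] by auto
  have \<psi>x2: "\<psi> x2 = R x2" using \<psi>(3)[of x2] x \<mu>3 \<gamma>3 by simp
  have \<mu>2: "\<mu> 2 l = l * m2 * R x2 * R x2" and \<gamma>2: "\<gamma> 2 l = 1 - l * m2 * R x2 * L x2"
    using conn2[OF sol(2) \<psi>(2,3)] \<mu>3 \<gamma>3 \<psi>x2 by auto
  have \<psi>x1: "\<psi> x1 = \<mu> 2 l * L x1 + \<gamma> 2 l * R x1" using \<psi>(2)[of x1] x by simp
  have \<mu>1: "\<mu> 1 l = \<mu> 2 l + l * m1 * \<psi> x1 * R x1" and \<gamma>1: "\<gamma> 1 l = \<gamma> 2 l - l * m1 * \<psi> x1 * L x1"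
    using conn1[OF sol(2) \<psi>(1,2)] by auto
  show "\<alpha> 2 l = 1 - l * Z1" using \<alpha>2 by (simp add: Z12_eq)
  show "\<beta> 2 l * R x1 / L x1 = l * Z1" using \<beta>2 pos12 by (simp add: Z12_eq)
  show "\<alpha> 3 l = E l"
    unfolding \<alpha>3 \<phi>x2 \<alpha>2 \<beta>2 char_poly_eq Z_rel unfolding Z12_eq by (simp add: algebra_simps power2_eq_square)
  show "\<beta> 3 l * R x2 / L x2 = l * ((Z1 * Z2 - Z3) / Z2 + Z2 - l * Z3)"
    unfolding A_eqs unfolding \<beta>3 \<phi>x2 \<alpha>2 \<beta>2 Z3_eq unfolding Z12_eq using pos12 by (simp add: field_simps power2_eq_square)
  show "\<gamma> 2 l = 1 - l * Z2" using \<gamma>2 by (simp add: Z12_eq)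
  show "\<mu> 2 l * L x1 / R x1 = l * ((Z1 * Z2 - Z3) / Z1)"
    unfolding A_eqs \<mu>2 using pos12 by (simp add: field_simps power2_eq_square)
  show "\<gamma> 1 l = E l"
    unfolding \<gamma>1 \<psi>x1 \<mu>2 \<gamma>2 char_poly_eq Z_rel unfolding Z12_eq by (simp add: algebra_simps power2_eq_square)
  show "\<mu> 1 l * L x1 / R x1 = l * ((Z1 * Z2 - Z3) / Z1 + Z1 - l * Z3)"
    unfolding A_eqs unfolding \<mu>1 \<psi>x1 \<mu>2 \<gamma>2 Z3_eq unfolding Z12_eq using pos12 by (simp add: field_simps power2_eq_square)
qed

lemma cauchy_coeffs_eq:
  assumes "connection_coeffs m1 m2 x1 x2 q L R \<alpha> \<beta> \<mu> \<gamma>"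
  shows "cauchy_coeffs x1 x2 L R \<alpha> \<beta> \<mu> \<gamma> j l = model_coeffs Z1 Z2 Z3 j l"
proof -
  note c = connection_formulas[OF assms, of l]
  have "\<mu> 1 l * L x1 / (\<gamma> 1 l * R x1) = (\<mu> 1 l * L x1 / R x1) / \<gamma> 1 l" by simp
  moreover have "\<beta> 2 l * R x1 / (\<alpha> 3 l * L x1) = (\<beta> 2 l * R x1 / L x1) / \<alpha> 3 l" by simp
  moreover have "R x2 * \<beta> 3 l / (\<alpha> 3 l * L x2) = (\<beta> 3 l * R x2 / L x2) / \<alpha> 3 l" by (simp add: mult.commute)
  ultimately show ?thesis unfolding cauchy_coeffs_def model_coeffs_def Let_def c by simp
qed

text \<open>Up to a positive factor, \<open>sqrt (1 / \<bar>deriv Y t\<bar>)\<close> is \<open>R\<close> to the left of \<open>x2\<close> and \<open>L\<close> to the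
  right. Both satisfy \<open>y'' = q * y\<close> almost everywhere and have no zero in the open interval.\<close>

lemma recovery: "recovers (Y_fun x1 x2 L R) ({0<..<1} - {x2}) q"
proof -
  let ?Y = "Y_fun x1 x2 L R"
  let ?f = "\<lambda>t. sqrt (1 / \<bar>deriv ?Y t\<bar>)"
  have dl: "(?Y has_real_derivative V' t) (at t)" if "t \<in> {0<..<x2}" for t
  proof (rule has_derivative_cong_open[OF V_derivative that])
    show "t \<in> {0<..<1}" using that x by auto
    show "V s = ?Y s" if "s \<in> {0<..<x2}" for s using that x V_fun_eq[of s] by (simp add: Y_fun_def)
  qed
  have dr: "(?Y has_real_derivative U' t) (at t)" if "t \<in> {x2<..<1}" for t
  proof (rule has_derivative_cong_open[OF U_derivative that])
    show "t \<in> {0<..<1}" using that x by auto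
    show "U s = ?Y s" if "s \<in> {x2<..<1}" for s using that x U_fun_eq[of s] by (simp add: Y_fun_def)
  qed
  define kl where "kl = sqrt (L x1 / R x1)"
  define kr where "kr = sqrt (R x2 / L x2)"
  have k: "kl > 0" "kr > 0" using pos12 by (simp_all add: kl_def kr_def)
  have fl: "?f t = kl * R t" if "t \<in> {0<..<x2}" for t
  proof -
    have "R t > 0" using that x Rpos by auto
    moreover have "1 / \<bar>V' t\<bar> = L x1 / R x1 * (R t)\<^sup>2" using pos12 by (simp add: V'_def abs_mult)
    ultimately have "sqrt (1 / \<bar>V' t\<bar>) = kl * R t" by (simp only: real_sqrt_mult kl_def real_sqrt_abs abs_of_pos)
    then show ?thesis using DERIV_imp_deriv[OF dl[OF that]] by simp
  qed
  have fr: "?f t = kr * L t" if "t \<in> {x2<..<1}" for t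
  proof -
    have "L t > 0" using that x Lpos by auto
    moreover have "1 / \<bar>U' t\<bar> = R x2 / L x2 * (L t)\<^sup>2" using pos12 by (simp add: U'_def abs_mult)
    ultimately have "sqrt (1 / \<bar>U' t\<bar>) = kr * L t" by (simp only: real_sqrt_mult kr_def real_sqrt_abs abs_of_pos)
    then show ?thesis using DERIV_imp_deriv[OF dr[OF that]] by simp
  qed
  have dfl: "(?f has_real_derivative kl * R' t) (at t)" if "t \<in> {0<..<x2}" for t
    by (rule has_derivative_cong_open[OF DERIV_cmult[OF derR_at] that]) (use that x fl in auto)
  have dfr: "(?f has_real_derivative kr * L' t) (at t)" if "t \<in> {x2<..<1}" for t
    by (rule has_derivative_cong_open[OF DERIV_cmult[OF derL_at] that]) (use that x fr in auto)
  have cases: "t \<in> {0<..<x2} \<or> t \<in> {x2<..<1}" if "t \<in> {0<..<1} - {x2}" for t using that by auto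
  show ?thesis
    unfolding recovers_def Let_def
  proof (intro conjI ballI)
    fix t assume t: "t \<in> {0<..<1} - {x2}"
    then have t01: "t \<in> {0..<1}" "t \<in> {0<..1}" by auto
    show "?Y differentiable at t" using cases[OF t] dl dr real_differentiable_def by blast
    show "deriv ?Y t \<noteq> 0"
      using cases[OF t] DERIV_imp_deriv[OF dl] DERIV_imp_deriv[OF dr] V'_pos[OF t01(1)] U'_neg[OF t01(2)] by auto
    show "?f differentiable at t" using cases[OF t] dfl dfr real_differentiable_def by blast
  next
    show "AE t in lebesgue. t \<in> {0<..<1} - {x2} \<longrightarrow> (\<exists>d. (deriv ?f has_real_derivative d) (at t) \<and> q t = d / ?f t)"
      using second_derivatives
    proof eventually_elim
      case (elim t)
      show ?case
      proof
        assume t: "t \<in> {0<..<1} - {x2}"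
        have el: "(L' has_real_derivative q t * L t) (at t)" "(R' has_real_derivative q t * R t) (at t)" using elim t by auto
        from cases[OF t] show "\<exists>d. (deriv ?f has_real_derivative d) (at t) \<and> q t = d / ?f t"
        proof
          assume tl: "t \<in> {0<..<x2}"
          have "(deriv ?f has_real_derivative kl * (q t * R t)) (at t)"
            by (rule has_derivative_cong_open[OF DERIV_cmult[OF el(2)] tl]) (simp add: DERIV_imp_deriv[OF dfl])
          moreover have "q t = kl * (q t * R t) / ?f t" using fl[OF tl] k Rpos[of t] t by simp
          ultimately show ?thesis by blast
        next
          assume tr: "t \<in> {x2<..<1}"
          have "(deriv ?f has_real_derivative kr * (q t * L t)) (at t)"
            by (rule has_derivative_cong_open[OF DERIV_cmult[OF el(1)] tr]) (simp add: DERIV_imp_deriv[OF dfr])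
          moreover have "q t = kr * (q t * L t) / ?f t" using fr[OF tr] k Lpos[of t] t by simp
          ultimately show ?thesis by blast
        qed
      qed
    qed
  qed
qed

lemma V'_continuous: "continuous_on {x1..x2} V'"
proof -
  have "continuous_on {x1..x2} R" using x by (intro continuous_on_subset[OF contR]) auto
  moreover have "L x1 * (R t)\<^sup>2 \<noteq> 0" if "t \<in> {x1..x2}" for t using Rpos[of t] that x pos12 by auto
  ultimately show ?thesis unfolding V'_def by (intro continuous_intros) blast+
qed

end

section \<open>The Cauchy problems and the uniqueness of the potential\<close>

lemma admissible_two_mass:
  assumes "admissible m1 m2 x1 x2 r q L R" "m1 > 0" "m2 > 0" "0 < x1" "x1 < x2" "x2 < 1" "r > 0"
  obtains L' R' where "two_mass q L R L' R' m1 m2 x1 x2 r"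
proof -
  have adm: "left_definite q" "normalized_pair q L R" using assms(1) by (auto simp: admissible_def)
  obtain L' R' where "fundamental_pair q L R L' R'" using normalized_pair_fundamental[OF adm(2)] .
  then show ?thesis using adm(1) assms(2-) by (intro that[of L' R'] two_mass.intro two_mass_axioms.intro)
qed

lemma recovers_subset: "recovers Y S q \<Longrightarrow> T \<subseteq> S \<Longrightarrow> recovers Y T q"
  unfolding recovers_def Let_def by (auto elim!: eventually_mono)

lemma recovers_unique:
  assumes S: "open S" and Y: "\<And>t. t \<in> S \<Longrightarrow> Y t = Y2 t" and r1: "recovers Y S q" and r2: "recovers Y2 S q2"
  shows "AE t in lebesgue. t \<in> S \<longrightarrow> q2 t = q t"
proof -
  let ?f = "\<lambda>t. sqrt (1 / \<bar>deriv Y t\<bar>)" and ?f2 = "\<lambda>t. sqrt (1 / \<bar>deriv Y2 t\<bar>)"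
  have near: "\<forall>\<^sub>F s in nhds t. s \<in> S" if "t \<in> S" for t using S that by (rule eventually_nhds_in_open)
  have d: "deriv Y t = deriv Y2 t" if "t \<in> S" for t
    by (rule deriv_cong_ev[OF _ refl]) (use near[OF that] Y in \<open>auto elim: eventually_mono\<close>)
  have df: "deriv ?f t = deriv ?f2 t" if "t \<in> S" for t
    by (rule deriv_cong_ev[OF _ refl]) (use near[OF that] d in \<open>auto elim!: eventually_mono\<close>)
  have "AE t in lebesgue. t \<in> S \<longrightarrow> (\<exists>d. (deriv ?f has_real_derivative d) (at t) \<and> q t = d / ?f t)"
    "AE t in lebesgue. t \<in> S \<longrightarrow> (\<exists>d. (deriv ?f2 has_real_derivative d) (at t) \<and> q2 t = d / ?f2 t)"
    using r1 r2 by (simp_all add: recovers_def Let_def)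
  then show ?thesis
  proof eventually_elim
    case (elim t)
    show ?case
    proof
      assume t: "t \<in> S"
      obtain d1 where d1: "(deriv ?f has_real_derivative d1) (at t)" "q t = d1 / ?f t" using elim(1) t by blast
      obtain d2 where d2: "(deriv ?f2 has_real_derivative d2) (at t)" "q2 t = d2 / ?f2 t" using elim(2) t by blast
      have ev: "\<forall>\<^sub>F s in nhds t. deriv ?f s = deriv ?f2 s"
        using near[OF t] by (rule eventually_mono) (rule df)
      have "(deriv ?f2 has_real_derivative d1) (at t)"
        using d1(1) DERIV_cong_ev[OF refl ev refl] by blast
      then have "d1 = d2" using d2(1) DERIV_unique by blast
      then show "q2 t = q t" using d1(2) d2(2) d[OF t] by simp
    qed
  qed
qed

context two_mass
begin

lemma V_fun_derivative: "t \<in> {0<..<1} \<Longrightarrow> (V_fun x1 L R has_real_derivative V' t) (at t)"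
  by (rule has_derivative_cong_open[OF V_derivative]) (auto simp: V_fun_eq)

lemma U_fun_derivative: "t \<in> {0<..<1} \<Longrightarrow> (U_fun x2 L R has_real_derivative U' t) (at t)"
  by (rule has_derivative_cong_open[OF U_derivative]) (auto simp: U_fun_eq)

lemma Cauchy_problems:
  assumes c: "connection_coeffs m1 m2 x1 x2 q L R \<alpha> \<beta> \<mu> \<gamma>"
    and j: "j \<in> {1, 2, 3}" and t: "t \<in> {node x1 x2 (j - 1)..node x1 x2 j} \<inter> {0<..<1}"
    and nz: "j = 2 \<Longrightarrow> \<alpha> 3 (lam t) \<noteq> 0"
  shows "case cauchy_coeffs x1 x2 L R \<alpha> \<beta> \<mu> \<gamma> j (lam t) of (c, b, l, g) \<Rightarrow>
    (Y_piece x1 x2 L R j has_real_derivative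
       r * (c * Y_piece x1 x2 L R j t + b) * (l * Y_piece x1 x2 L R j t + g)) (at t within S)"
proof -
  have t01: "t \<in> {0<..<1}" using t by auto
  consider "j = 1" | "j = 2" | "j = 3" using j by auto
  then show ?thesis
  proof cases
    case 1
    then have tj: "t \<in> {0<..x1}" using t by (auto simp: node_def)
    have "V_fun x1 L R t = V t" using V_fun_eq t01 by auto
    then show ?thesis
      using has_field_derivative_at_within[OF V_fun_derivative[OF t01]] left_ode(2)[OF tj refl] 1
      unfolding cauchy_coeffs_eq[OF c] by (simp add: model_coeffs_def Let_def Y_piece_def)
  next
    case 2
    then have tj: "t \<in> {x1..x2}" using t by (auto simp: node_def)
    have V: "V_fun x1 L R t = V t" using V_fun_eq t01 by auto
    have E: "E (lam t) \<noteq> 0" using nz[OF 2] connection_formulas(3)[OF c] by simp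
    have "r * ((1 - lam t * Z1) / E (lam t) * V t + lam t * Z1 / E (lam t))
          * (lam t * ((Z1 * Z2 - Z3) / Z1) * V t + (1 - lam t * Z2))
        = r * riccati_rhs Z1 Z2 Z3 (lam t) (V t) / E (lam t)"
      unfolding riccati_rhs_def using E by (simp add: add_divide_distrib[symmetric])
    also have "\<dots> = V' t" unfolding middle_ode[OF tj, symmetric] using E by simp
    finally show ?thesis
      using has_field_derivative_at_within[OF V_fun_derivative[OF t01]] 2
      unfolding cauchy_coeffs_eq[OF c] by (simp add: model_coeffs_def Let_def Y_piece_def V)
  next
    case 3
    then have tj: "t \<in> {x2..<1}" using t by (auto simp: node_def)
    have "U_fun x2 L R t = U t" using U_fun_eq t01 by auto
    then show ?thesis
      using has_field_derivative_at_within[OF U_fun_derivative[OF t01]] right_ode(2)[OF tj refl] 3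
      unfolding cauchy_coeffs_eq[OF c] by (simp add: model_coeffs_def Let_def Y_piece_def)
  qed
qed

lemma initial_values:
  "Y_piece x1 x2 L R 1 x1 = 1" "Y_piece x1 x2 L R 2 x1 = 1" "Y_piece x1 x2 L R 3 x2 = 1"
  using V_fun_eq[of x1] U_fun_eq[of x2] V_values x by (simp_all add: Y_piece_def)

end

text \<open>Both triples satisfy the linear system whose solution is unique.\<close>

lemma same_masses:
  assumes A: "two_mass q L R L' R' m1 m2 x1 x2 r" and B: "two_mass q2 L2 R2 L2' R2' m1 m2 x1 x2 r"
    and eq: "\<forall>t\<in>{0..1}. first_eigenvalue m1 m2 x1 x2 r q2 t = first_eigenvalue m1 m2 x1 x2 r q t"
  shows "two_mass.Z1 L2 R2 m1 x1 = two_mass.Z1 L R m1 x1 \<and> two_mass.Z2 L2 R2 m2 x2 = two_mass.Z2 L R m2 x2 \<and>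
    two_mass.Z3 L2 R2 m1 m2 x1 x2 = two_mass.Z3 L R m1 m2 x1 x2"
proof -
  interpret A: two_mass q L R L' R' m1 m2 x1 x2 r by (rule A)
  interpret B: two_mass q2 L2 R2 L2' R2' m1 m2 x1 x2 r by (rule B)
  have e: "B.lam 0 = A.lam 0" "B.lam x1 = A.lam x1" "B.lam x2 = A.lam x2" using eq A.x by auto
  show ?thesis by (rule A.Z_determined) (use B.mass_relations in \<open>simp_all only: e\<close>)
qed

text \<open>With the same \<open>Z1\<close>, \<open>Z2\<close>, \<open>Z3\<close> the functions \<open>V\<close> and \<open>U\<close> of the two potentials solve the
  same equations with the same initial values, also at \<open>x2\<close>, where \<open>V\<close> has the value
  \<open>Z1 * Z2 / (Z1 * Z2 - Z3)\<close>. The middle interval contains at most one point where the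
  coefficients of the Riccati equation may blow up. This point is reached from \<open>x1\<close> on the
  left and from \<open>x2\<close> on the right.\<close>

lemma potentials_coincide:
  assumes A: "two_mass q L R L' R' m1 m2 x1 x2 r" and B: "two_mass q2 L2 R2 L2' R2' m1 m2 x1 x2 r"
    and eq: "\<forall>t\<in>{0..1}. first_eigenvalue m1 m2 x1 x2 r q2 t = first_eigenvalue m1 m2 x1 x2 r q t"
  shows "AE x in lebesgue. x \<in> {0..1} \<longrightarrow> q2 x = q x"
proof -
  interpret A: two_mass q L R L' R' m1 m2 x1 x2 r by (rule A)
  interpret B: two_mass q2 L2 R2 L2' R2' m1 m2 x1 x2 r by (rule B)
  have Z: "B.Z1 = A.Z1" "B.Z2 = A.Z2" "B.Z3 = A.Z3" using same_masses[OF A B eq] by auto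
  have lam: "B.lam t = A.lam t" if "t \<in> {0..1}" for t using eq that by blast
  note x = A.x

  have left: "A.V t = B.V t" if t: "t \<in> {0<..x1}" for t
  proof (rule bernoulli_unique[where ?F1.0 = A.V and ?F2.0 = B.V and a = t and b = x1 and c = x1 and \<rho> = r
        and k = "\<lambda>s. A.lam s * ((A.Z1 * A.Z2 - A.Z3) / A.Z1 + A.Z1 - A.lam s * A.Z3) / A.E (A.lam s)"])
    fix s assume s: "s \<in> {t..x1}"
    then have s01: "s \<in> {0<..<1}" "s \<in> {0<..x1}" "s \<in> {0..1}" using t x by auto
    show "A.V s > 0" "B.V s > 0" using A.VU_pos(1) B.VU_pos(1) s01 by auto
    show "(A.V has_real_derivative r * A.V s * (A.lam s * ((A.Z1 * A.Z2 - A.Z3) / A.Z1 + A.Z1 - A.lam s * A.Z3)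
        / A.E (A.lam s) * A.V s + 1)) (at s within {t..x1})"
      using has_field_derivative_at_within[OF A.V_derivative[OF s01(1)]] A.left_ode(2)[OF s01(2) refl] by simp
    show "(B.V has_real_derivative r * B.V s * (A.lam s * ((A.Z1 * A.Z2 - A.Z3) / A.Z1 + A.Z1 - A.lam s * A.Z3)
        / A.E (A.lam s) * B.V s + 1)) (at s within {t..x1})"
      using has_field_derivative_at_within[OF B.V_derivative[OF s01(1)]] B.left_ode(2)[OF s01(2) lam[OF s01(3), symmetric]]
      unfolding Z by simp
  qed (use t A.V_values B.V_values in auto)

  have right: "A.U t = B.U t" if t: "t \<in> {x2..<1}" for t
  proof (rule bernoulli_unique[where ?F1.0 = A.U and ?F2.0 = B.U and a = x2 and b = t and c = x2 and \<rho> = "- r"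
        and k = "\<lambda>s. A.lam s * ((A.Z1 * A.Z2 - A.Z3) / A.Z2 + A.Z2 - A.lam s * A.Z3) / A.E (A.lam s)"])
    fix s assume s: "s \<in> {x2..t}"
    then have s01: "s \<in> {0<..<1}" "s \<in> {x2..<1}" "s \<in> {0..1}" using t x by auto
    show "A.U s > 0" "B.U s > 0" using A.VU_pos(2) B.VU_pos(2) s01 by auto
    show "(A.U has_real_derivative - r * A.U s * (A.lam s * ((A.Z1 * A.Z2 - A.Z3) / A.Z2 + A.Z2 - A.lam s * A.Z3)
        / A.E (A.lam s) * A.U s + 1)) (at s within {x2..t})"
      using has_field_derivative_at_within[OF A.U_derivative[OF s01(1)]] A.right_ode(2)[OF s01(2) refl] by simp
    show "(B.U has_real_derivative - r * B.U s * (A.lam s * ((A.Z1 * A.Z2 - A.Z3) / A.Z2 + A.Z2 - A.lam s * A.Z3)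
        / A.E (A.lam s) * B.U s + 1)) (at s within {x2..t})"
      using has_field_derivative_at_within[OF B.U_derivative[OF s01(1)]] B.right_ode(2)[OF s01(2) lam[OF s01(3), symmetric]]
      unfolding Z by simp
  qed (use t A.V_values B.V_values in auto)

  \<comment> \<open>a point where the value of \<open>V\<close> admits a common zero of numerator and denominator\<close>
  define bad where "bad s \<longleftrightarrow> s \<in> {x1..x2} \<and> (\<exists>l. A.E l = 0 \<and> riccati_rhs A.Z1 A.Z2 A.Z3 l (A.V s) = 0)" for s
  have bad_unique: "s = t" if "bad s" "bad t" for s t
    using A.exceptional_point_unique that unfolding bad_def by blast
  have piece: "A.V t = B.V t"
    if ab: "x1 \<le> a" "b \<le> x2" "c \<in> {a..b}" "t \<in> {a..b}" and c: "A.V c = B.V c"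
      and good: "\<And>s. s \<in> {a..b} \<Longrightarrow> \<not> bad s" for a b c t
  proof (rule riccati_unique[where ?V1.0 = A.V and ?V2.0 = B.V and V1' = A.V' and V2' = B.V' and lam = A.lam,
        OF A.Z_pos(3) A.r ab(3) _ _ _ _ _ _ c ab(4)])
    show "continuous_on {a..b} A.V'" using A.V'_continuous ab by (auto intro: continuous_on_subset)
  next
    fix s assume s: "s \<in> {a..b}"
    then have s01: "s \<in> {0<..<1}" "s \<in> {x1..x2}" "s \<in> {0..1}" using ab x by auto
    show "(A.V has_real_derivative A.V' s) (at s within {a..b})" "(B.V has_real_derivative B.V' s) (at s within {a..b})"
      using has_field_derivative_at_within A.V_derivative B.V_derivative s01 by blast+
    show "A.E (A.lam s) * A.V' s = r * riccati_rhs A.Z1 A.Z2 A.Z3 (A.lam s) (A.V s)" by (rule A.middle_ode[OF s01(2)])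
    show "A.E (A.lam s) * B.V' s = r * riccati_rhs A.Z1 A.Z2 A.Z3 (A.lam s) (B.V s)"
      using B.middle_ode[OF s01(2)] unfolding Z lam[OF s01(3)] .
    fix l assume "A.E l = 0"
    then show "riccati_rhs A.Z1 A.Z2 A.Z3 l (A.V s) \<noteq> 0" using good[OF s] s01(2) unfolding bad_def by blast
  qed
  have middle: "A.V t = B.V t" if t: "t \<in> {x1..x2}" "\<not> bad t" for t
  proof (cases "\<exists>s\<in>{x1..t}. bad s")
    case False
    then show ?thesis using t A.V_values B.V_values by (intro piece[of x1 t x1 t]) auto
  next
    case True
    then obtain s where s: "s \<in> {x1..t}" "bad s" by blast
    then have "\<not> bad u" if "u \<in> {t..x2}" for u using bad_unique[of s u] t that by (cases "u = t") auto
    then show ?thesis using t A.V_values B.V_values Z by (intro piece[of t x2 x2 t]) auto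
  qed

  obtain p where p: "\<And>s. bad s \<Longrightarrow> s = p" using bad_unique by blast
  define S where "S = {0<..<1} - {x2, p}"
  have "open S" unfolding S_def by (intro open_Diff) auto
  moreover have "Y_fun x1 x2 L R t = Y_fun x1 x2 L2 R2 t" if t: "t \<in> S" for t
  proof -
    have t01: "t \<in> {0..<1}" "t \<in> {0<..1}" "t \<noteq> x2" "t \<noteq> p" using t by (auto simp: S_def)
    have "A.V t = B.V t" if "t \<le> x2" using left[of t] middle[of t] p[of t] t01 that by (cases "t \<le> x1") auto
    moreover have "A.U t = B.U t" if "\<not> t \<le> x2" using right[of t] that t t01 by (auto simp: S_def)
    ultimately show ?thesis using A.V_fun_eq B.V_fun_eq A.U_fun_eq B.U_fun_eq t01 by (simp add: Y_fun_def)
  qed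
  moreover have "recovers (Y_fun x1 x2 L R) S q" by (rule recovers_subset[OF A.recovery]) (auto simp: S_def)
  moreover have "recovers (Y_fun x1 x2 L2 R2) S q2" by (rule recovers_subset[OF B.recovery]) (auto simp: S_def)
  ultimately have "AE t in lebesgue. t \<in> S \<longrightarrow> q2 t = q t" by (rule recovers_unique)
  moreover have "AE t in lebesgue. t \<notin> {0, 1, x2, p}"
    unfolding eventually_ae_filter_negligible by (intro exI[of _ "{0, 1, x2, p}"]) (auto simp: negligible_finite)
  ultimately show ?thesis by eventually_elim (auto simp: S_def)
qed

theorem theorem3p4:
  fixes q L R lam :: "real \<Rightarrow> real"
    and \<alpha> \<beta> \<mu> \<gamma> :: "nat \<Rightarrow> real \<Rightarrow> real"
    and m1 m2 x1 x2 r :: real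
  assumes m: "m1 > 0" "m2 > 0"
    and x: "0 < x1" "x1 < x2" "x2 < 1"
    and r: "r > 0"
    and adm: "admissible m1 m2 x1 x2 r q L R"
    and coeffs: "connection_coeffs m1 m2 x1 x2 q L R \<alpha> \<beta> \<mu> \<gamma>"
  defines "lam \<equiv> first_eigenvalue m1 m2 x1 x2 r q"
  shows
    "\<comment> \<open>the first eigenvalue function exists\<close>
     (\<forall>t\<in>{0..1}. perturbed_eigenvalue m1 m2 x1 x2 r q t (lam t) \<and>
       (\<forall>l. perturbed_eigenvalue m1 m2 x1 x2 r q t l \<longrightarrow> lam t \<le> l))
     \<comment> \<open>it determines the potential\<close>
     \<and> (\<forall>q2 L2 R2. admissible m1 m2 x1 x2 r q2 L2 R2 \<and>
       (\<forall>t\<in>{0..1}. first_eigenvalue m1 m2 x1 x2 r q2 t = lam t) \<longrightarrow>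
       (AE x in lebesgue. x \<in> {0..1} \<longrightarrow> q2 x = q x))
     \<comment> \<open>recovery formula; the exclusion of the single point where the branches of Y meet is
      immaterial for an almost-everywhere identity\<close>
     \<and> (recovers (Y_fun x1 x2 L R) ({0<..<1} - {x2}) q)
     \<comment> \<open>initial values\<close>
     \<and> (Y_piece x1 x2 L R 1 x1 = 1 \<and> Y_piece x1 x2 L R 2 x1 = 1 \<and> Y_piece x1 x2 L R 3 x2 = 1)
     \<comment> \<open>the denominators occurring in the coefficients do not vanish, with at most one exception
      in the middle subinterval\<close>
     \<and> (\<forall>t\<in>{0<..x1}. \<gamma> 1 (lam t) \<noteq> 0)
     \<and> (\<forall>t\<in>{x2..<1}. \<alpha> 3 (lam t) \<noteq> 0)
     \<and> (\<forall>s\<in>{x1..x2}. \<forall>t\<in>{x1..x2}. \<alpha> 3 (lam s) = 0 \<and> \<alpha> 3 (lam t) = 0 \<longrightarrow> s = t)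
     \<comment> \<open>differential equations\<close>
     \<and> (\<forall>j\<in>{1, 2, 3}. \<forall>t\<in>{node x1 x2 (j - 1)..node x1 x2 j} \<inter> {0<..<1}.
       (j = 2 \<longrightarrow> \<alpha> 3 (lam t) \<noteq> 0) \<longrightarrow>
       (case cauchy_coeffs x1 x2 L R \<alpha> \<beta> \<mu> \<gamma> j (lam t) of (c, b, l, g) \<Rightarrow>
          (Y_piece x1 x2 L R j has_real_derivative
             r * (c * Y_piece x1 x2 L R j t + b) * (l * Y_piece x1 x2 L R j t + g))
          (at t within {node x1 x2 (j - 1)..node x1 x2 j})))
     \<comment> \<open>the coefficients are determined by the first eigenvalue function\<close>
     \<and> (\<forall>q2 L2 R2 \<alpha>2 \<beta>2 \<mu>2 \<gamma>2. admissible m1 m2 x1 x2 r q2 L2 R2 \<and>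
       connection_coeffs m1 m2 x1 x2 q2 L2 R2 \<alpha>2 \<beta>2 \<mu>2 \<gamma>2 \<and>
       (\<forall>t\<in>{0..1}. first_eigenvalue m1 m2 x1 x2 r q2 t = lam t) \<longrightarrow>
       (\<forall>j\<in>{1, 2, 3}. \<forall>t\<in>{node x1 x2 (j - 1)..node x1 x2 j} \<inter> {0<..<1}.
          cauchy_coeffs x1 x2 L2 R2 \<alpha>2 \<beta>2 \<mu>2 \<gamma>2 j (lam t) =
          cauchy_coeffs x1 x2 L R \<alpha> \<beta> \<mu> \<gamma> j (lam t)))"
proof -
  obtain L' R' where T: "two_mass q L R L' R' m1 m2 x1 x2 r" using admissible_two_mass[OF adm m x r] .
  interpret two_mass q L R L' R' m1 m2 x1 x2 r by (rule T)
  note cf = connection_formulas[OF coeffs]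
  have other: "\<exists>L2' R2'. two_mass q2 L2 R2 L2' R2' m1 m2 x1 x2 r" if "admissible m1 m2 x1 x2 r q2 L2 R2" for q2 L2 R2
    using admissible_two_mass[OF that m x r] by metis
  have same_coeffs: "cauchy_coeffs x1 x2 L2 R2 \<alpha>2 \<beta>2 \<mu>2 \<gamma>2 j l = cauchy_coeffs x1 x2 L R \<alpha> \<beta> \<mu> \<gamma> j l"
    if a: "admissible m1 m2 x1 x2 r q2 L2 R2" "connection_coeffs m1 m2 x1 x2 q2 L2 R2 \<alpha>2 \<beta>2 \<mu>2 \<gamma>2"
      "\<forall>t\<in>{0..1}. first_eigenvalue m1 m2 x1 x2 r q2 t = first_eigenvalue m1 m2 x1 x2 r q t"
    for q2 L2 R2 \<alpha>2 \<beta>2 \<mu>2 \<gamma>2 j l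
  proof -
    obtain L2' R2' where T2: "two_mass q2 L2 R2 L2' R2' m1 m2 x1 x2 r" using other[OF a(1)] by blast
    show ?thesis
      unfolding two_mass.cauchy_coeffs_eq[OF T2 a(2)] cauchy_coeffs_eq[OF coeffs] using same_masses[OF T T2 a(3)] by simp
  qed
  show ?thesis
    unfolding lam_def
  proof (intro conjI, goal_cases)
    case 1
    then show ?case using first_eigenvalue_exists by blast
  next
    case 2
    then show ?case using potentials_coincide[OF T] other by blast
  next
    case 3
    then show ?case by (rule recovery)
  next
    case 7
    then show ?case unfolding cf(7) using left_ode(1) by blast
  next
    case 8
    then show ?case unfolding cf(3) using right_ode(1) by blast
  next
    case 9
    then show ?case unfolding cf(3) using at_most_one_exception by blast
  next
    case 10
    then show ?case by (intro ballI impI Cauchy_problems[OF coeffs]) blast+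
  next
    case 11
    then show ?case
    proof (intro allI impI ballI, elim conjE)
    qed (rule same_coeffs)
  \<comment> \<open>the cases 4 to 6 are the initial values\<close>
  qed (rule initial_values)+
qed

end
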